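(* The following statements hold. (1) The 2-parametric generating series $P_\Gamma(q,x)$ is a solution of the Cauchy problem $$\frac{\partial}{\partial q}P_\Gamma(q,x)=2Pe(q,x)P_\Gamma(q,x)+\frac{\partial}{\partial x}Pe(q,x)\Bigl(1+\frac{\partial}{\partial x}Pe(q,x)\Bigr),\qquad P_\Gamma(0,x)=P_\Gamma(x).$$ (2) The 2-parametric generating series $P_{Mas}(q,x)$ is a solution of the Cauchy problem $$\frac{\partial}{\partial q}P_{Mas}(q,x)=(x+Pe(q,x))P_{Mas}(q,x)+x^2\Bigl[2\frac{\partial}{\partial x}St(q,x)+St(q,x)P_\Gamma(q,x)+\frac{\partial}{\partial x}St(q,x)\,\frac{\partial}{\partial x}Pe(q,x)\Bigr],$$ $$P_{Mas}(0,x)=P_{Mas}(x).$$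
   Context: **Ring of polytopes.** $\mathcal P$ is the free abelian group on combinatorial types of simple polytopes, with addition corresponding to disjoint union and multiplication given by Cartesian product (unit: the point). $d:\mathcal P\to\mathcal P$ is the derivation sending a simple polytope to the disjoint union (sum) of its facets. Generating series have coefficients in $\mathcal P\otimes\mathbb Q$. **Nestohedra.** A building set on a finite nonempty set $V$ is a collection $B$ of nonempty subsets of $V$ containing all singletons and such that $S_1,S_2\in B$, $S_1\cap S_2\ne\varnothing$ imply $S_1\cup S_2\in B$; it is connected if $V\in B$. The nestohedron is the simple polytope $P_B=\sum_{S\in B}\operatorname{conv}(e_i\mid i\in S)\subset\mathbb R^V$ (Minkowski sum), of dimension $n$ if $B$ is connected on $[n+1]=\{1,\dots,n+1\}$. For a connected simple graph $G$ on $[n+1]$ the graph-associahedron is $P_{B(G)}$, where $B(G)$ consists of the nonempty vertex subsets inducing connected subgraphs. **The families.** $Pe^n$ (permutohedron) is the graph-associahedron of the complete graph on $[n+1]$; $St^n$ (stellahedron) is that of the star graph on $[n+1]$. $P_\Gamma^0$ is a point, $P_\Gamma^1$ a segment, and for $n\ge2$, $P_\Gamma^n=P_{B(\Gamma,n)}$, where $B(\Gamma,n)$ consists of all singletons of $[n+1]$, all subsets of $\{1,\dots,n\}$ with at least two elements, and all sets $\{1,n+1\}\cup J$ with $J\subseteq\{2,\dots,n\}$. $P^0_{Mas}$ is a point, $P^1_{Mas}$ a segment, and for $n\ge2$, $P^n_{Mas}=P_{B(P,n)}$, where $B(P,n)$ consists of all singletons of $[n+1]$, all sets $\{1,2\}\cup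 I$ with $I\subseteq\{3,\dots,n+1\}$, and all sets $\{1\}\cup J$ with $\varnothing\ne J\subseteq\{3,\dots,n\}$. **Generating series.** $$Pe(x)=\sum_{s\ge0}Pe^s\frac{x^{s+1}}{(s+1)!},\quad St(x)=\sum_{s\ge0}St^s\frac{x^s}{s!},\quad P_\Gamma(x)=\sum_{s\ge0}P_\Gamma^{s+1}\frac{x^s}{s!},\quad P_{Mas}(x)=\sum_{s\ge0}P_{Mas}^{s+2}\frac{x^{s+2}}{s!}.$$ For a simple polytope $P^n$ of dimension $n$ put $Q(P^n;q)=\sum_{k=0}^n(d^kP^n)\frac{q^k}{k!}$. The two-parameter extension of a series $\sum_n a_nP^nx^{n+n_0}$ is $\sum_n a_nQ(P^n;q)x^{n+n_0}$; applied to the four series above it gives $Pe(q,x)$, $St(q,x)$, $P_\Gamma(q,x)$, $P_{Mas}(q,x)$. *)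

theory Defs
  imports
    "HOL-Analysis.Analysis"
    "HOL-Analysis.Finite_Function_Topology"
    "HOL-Algebra.Free_Abelian_Groups"
    "HOL-Computational_Algebra.Formal_Power_Series"
begin

section \<open>Simple polytopes in arbitrary real vector spaces\<close>

text \<open>
  The library constants \<^const>\<open>aff_dim\<close> and \<^const>\<open>facet_of\<close> live in a fixed Euclidean
  space. Polytopes of all dimensions are needed at once here, so that \<open>\<real>\<^sup>V\<close> is
  realised inside \<open>'v \<Rightarrow>\<^sub>0 real\<close>, and dimension and facets are introduced for arbitrary real
  vector spaces: the dimension is that of the linear span of all differences of points, and
  facets are the inclusion-maximal proper nonempty faces. Lemmas \<open>pdim_eq_aff_dim\<close> and
  \<open>is_facet_iff_facet_of\<close> show the agreement with the library constants. Note that the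
  library counts both \<^term>\<open>{}\<close> and the polytope itself as faces.
\<close>

definition point_diffs :: "'a::real_vector set \<Rightarrow> 'a set"
  where "point_diffs P = {x - y |x y. x \<in> P \<and> y \<in> P}"

definition pdim :: "'a::real_vector set \<Rightarrow> nat"
  where "pdim P = dim (point_diffs P)"

definition is_facet :: "'a::real_vector set \<Rightarrow> 'a set \<Rightarrow> bool"
  where "is_facet F P \<longleftrightarrow> F face_of P \<and> F \<noteq> {} \<and> F \<noteq> P \<and>
    (\<forall>G. G face_of P \<and> F \<subseteq> G \<and> G \<noteq> P \<longrightarrow> G = F)"

definition simple_polytope :: "'a::real_vector set \<Rightarrow> bool"
  where "simple_polytope P \<longleftrightarrow> polytope P \<and> P \<noteq> {} \<and>
    (\<forall>v. v extreme_point_of P \<longrightarrow> card {F. is_facet F P \<and> v \<in> F} = pdim P)"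

definition comb_equiv :: "'a::real_vector set \<Rightarrow> 'b::real_vector set \<Rightarrow> bool"
  where "comb_equiv P Q \<longleftrightarrow>
    (\<exists>f. bij_betw f {F. F face_of P} {G. G face_of Q} \<and>
         (\<forall>F F'. F face_of P \<longrightarrow> F' face_of P \<longrightarrow> (F \<subseteq> F' \<longleftrightarrow> f F \<subseteq> f F')))"


lemma point_diffs_mono: "P \<subseteq> Q \<Longrightarrow> point_diffs P \<subseteq> point_diffs Q"
  unfolding point_diffs_def by blast

lemma pdim_eq_aff_dim:
  fixes S :: "'a::euclidean_space set"
  assumes "S \<noteq> {}"
  shows "int (pdim S) = aff_dim S"
proof -
  obtain a where a: "a \<in> S" using assms by blast
  have "span (point_diffs S) = span ((\<lambda>x. x - a) ` S)"
  proof (rule real_vector.span_eq[THEN iffD2], intro conjI)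
    show "point_diffs S \<subseteq> span ((\<lambda>x. x - a) ` S)"
    proof
      fix z assume "z \<in> point_diffs S"
      then obtain x y where z: "x \<in> S" "y \<in> S" "z = x - y" unfolding point_diffs_def by blast
      have "z = (x - a) - (y - a)" using z by simp
      moreover have "(x - a) - (y - a) \<in> span ((\<lambda>x. x - a) ` S)"
        using z by (intro real_vector.span_diff real_vector.span_base) auto
      ultimately show "z \<in> span ((\<lambda>x. x - a) ` S)" by simp
    qed
    show "(\<lambda>x. x - a) ` S \<subseteq> span (point_diffs S)"
      using a by (auto intro!: real_vector.span_base simp: point_diffs_def)
  qed
  then have "dim (point_diffs S) = dim ((\<lambda>x. x - a) ` S)"
    by (metis dim_span)
  moreover have "aff_dim S = int (dim ((\<lambda>x. x - a) ` S))"
    using a by (intro aff_dim_eq_dim_subtract) (simp add: hull_inc)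
  ultimately show ?thesis unfolding pdim_def by simp
qed

lemma is_facet_iff_facet_of:
  fixes P :: "'a::euclidean_space set"
  assumes "polytope P"
  shows "is_facet F P \<longleftrightarrow> F facet_of P"
proof
  have poly: "polyhedron P" and cP: "convex P"
    using assms by (simp_all add: polytope_imp_polyhedron polytope_imp_convex)
  {
    assume F: "is_facet F P"
    then obtain G where G: "G facet_of P" "F \<subseteq> G"
      using face_of_polyhedron_subset_facet[OF poly, of F] unfolding is_facet_def by blast
    then have "G face_of P" "G \<noteq> P" unfolding facet_of_def by auto
    then show "F facet_of P" using F G unfolding is_facet_def by blast
  }
  assume F: "F facet_of P"
  then have F': "F face_of P" "F \<noteq> {}" "F \<noteq> P" "aff_dim F = aff_dim P - 1"
    unfolding facet_of_def by auto
  have "G = F" if G: "G face_of P" "F \<subseteq> G" "G \<noteq> P" for G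
  proof (rule ccontr)
    assume "G \<noteq> F"
    have "F face_of G" using F' G by (meson face_of_imp_subset face_of_subset)
    moreover have "convex G" using G by (simp add: face_of_imp_convex)
    ultimately have "aff_dim F < aff_dim G" using face_of_aff_dim_lt \<open>G \<noteq> F\<close> by metis
    moreover have "aff_dim G < aff_dim P" using face_of_aff_dim_lt[OF cP] G by blast
    ultimately show False using F' by simp
  qed
  with F' show "is_facet F P" unfolding is_facet_def by blast
qed

subsection \<open>Dimension\<close>

definition findim :: "'a::real_vector set \<Rightarrow> bool"
  where "findim A \<longleftrightarrow> (\<exists>B. finite B \<and> A \<subseteq> span B)"

lemma findim_basis:
  assumes "findim A"
  obtains b where "finite b" "independent b" "span b = span A" "dim A = card b"
proof -
  obtain b where b: "b \<subseteq> A" "independent b" "A \<subseteq> span b" "card b = dim A"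
    by (rule real_vector.basis_exists)
  obtain B where B: "finite B" "A \<subseteq> span B" using assms unfolding findim_def by blast
  have "finite b"
    using real_vector.independent_span_bound[of B b] b B by blast
  moreover have "span b = span A"
    using b by (meson real_vector.span_eq real_vector.span_superset subset_trans)
  ultimately show thesis using that b by auto
qed

lemma span_Times0:
  fixes A :: "'a::real_vector set" and B :: "'b::real_vector set"
  assumes "0 \<in> A" "0 \<in> B"
  shows "span (A \<times> B) = span A \<times> span B"
proof
  show "span (A \<times> B) \<subseteq> span A \<times> span B"
    by (rule real_vector.span_minimal)
       (auto intro: real_vector.span_base subspace_Times)
  have 1: "span A \<times> {0} \<subseteq> span (A \<times> B)"
    using assms by (subst real_vector.span_Times_sing2[symmetric]) (intro real_vector.span_mono, auto)
  have 2: "{0} \<times> span B \<subseteq> span (A \<times> B)"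
    using assms by (subst real_vector.span_Times_sing1[symmetric]) (intro real_vector.span_mono, auto)
  show "span A \<times> span B \<subseteq> span (A \<times> B)"
  proof clarify
    fix a b assume "a \<in> span A" "b \<in> span B"
    then have "(a, 0) + (0, b) \<in> span (A \<times> B)"
      using 1 2 by (intro real_vector.span_add) auto
    then show "(a, b) \<in> span (A \<times> B)" by simp
  qed
qed

lemma dim_Times0:
  fixes A :: "'a::real_vector set" and B :: "'b::real_vector set"
  assumes "0 \<in> A" "0 \<in> B" "findim A" "findim B"
  shows "dim (A \<times> B) = dim A + dim B"
proof -
  obtain b1 where b1: "finite b1" "independent b1" "span b1 = span A" "dim A = card b1"
    using findim_basis[OF assms(3)] .
  obtain b2 where b2: "finite b2" "independent b2" "span b2 = span B" "dim B = card b2"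
    using findim_basis[OF assms(4)] .
  let ?C = "b1 \<times> {0} \<union> {0} \<times> b2"
  have z: "0 \<notin> b1" "0 \<notin> b2"
    using b1 b2 real_vector.dependent_zero by blast+
  have "independent ?C"
    unfolding real_vector.dependent_def
  proof safe
    fix a
    assume a: "a \<in> b1"
    assume "(a, 0) \<in> span (b1 \<times> {0} \<union> {0} \<times> b2 - {(a, 0)})"
    also have "b1 \<times> {0} \<union> {0} \<times> b2 - {(a, 0)} = (b1 - {a}) \<times> {0} \<union> {0} \<times> b2"
      using a z by auto
    finally show False
      using a b1(2) unfolding real_vector.dependent_def
      by (auto simp: real_vector.span_Un real_vector.span_Times_sing1 real_vector.span_Times_sing2)
  next
    fix b
    assume b: "b \<in> b2"
    assume "(0, b) \<in> span (b1 \<times> {0} \<union> {0} \<times> b2 - {(0, b)})"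
    also have "(b1 \<times> {0} \<union> {0} \<times> b2 - {(0, b)}) = b1 \<times> {0} \<union> {0} \<times> (b2 - {b})"
      using b z by auto
    finally show False
      using b b2(2) unfolding real_vector.dependent_def
      by (auto simp: real_vector.span_Un real_vector.span_Times_sing1 real_vector.span_Times_sing2)
  qed
  moreover have "span ?C = span (A \<times> B)"
  proof -
    have "span ?C = span b1 \<times> span b2"
      by (force simp: real_vector.span_Un real_vector.span_Times_sing1 real_vector.span_Times_sing2
          set_eq_iff)
    then show ?thesis using b1 b2 span_Times0[OF assms(1,2)] by simp
  qed
  ultimately have "dim (A \<times> B) = card ?C"
    by (metis real_vector.dim_eq_card)
  also have "\<dots> = card (b1 \<times> {0::'b}) + card ({0::'a} \<times> b2)"
    using z b1 b2 by (intro card_Un_disjoint) auto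
  also have "\<dots> = card b1 + card b2" by (simp add: card_cartesian_product)
  finally show ?thesis using b1 b2 by simp
qed

lemma dim_injective_image:
  fixes f :: "'a::real_vector \<Rightarrow> 'b::real_vector"
  assumes "linear f" "inj f"
  shows "dim (f ` A) = dim A"
proof -
  obtain b where b: "b \<subseteq> A" "independent b" "A \<subseteq> span b" "card b = dim A"
    by (rule real_vector.basis_exists)
  have sp: "span b = span A"
    using b by (meson real_vector.span_eq real_vector.span_superset subset_trans)
  have "independent (f ` b)"
    using assms b by (meson inj_on_subset linear_independent_injective_image subset_UNIV)
  moreover have "span (f ` b) = span (f ` A)"
    using sp assms by (simp add: linear_span_image)
  ultimately have "dim (f ` A) = card (f ` b)"
    by (metis real_vector.dim_eq_card)
  also have "\<dots> = card b" using assms by (meson card_image inj_on_subset subset_UNIV)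
  finally show ?thesis using b by simp
qed

lemma point_diffs_linear_image: "linear f \<Longrightarrow> point_diffs (f ` P) = f ` point_diffs P"
  unfolding point_diffs_def by (auto simp: linear_diff image_iff) (metis linear_diff)+

lemma point_diffs_Times: "point_diffs (P \<times> Q) = point_diffs P \<times> point_diffs Q"
  unfolding point_diffs_def by auto

lemma zero_in_diffs: "P \<noteq> {} \<Longrightarrow> 0 \<in> point_diffs P"
  unfolding point_diffs_def by force

lemma pdim_linear_image: "linear f \<Longrightarrow> inj f \<Longrightarrow> pdim (f ` P) = pdim P"
  unfolding pdim_def by (simp add: point_diffs_linear_image dim_injective_image)

lemma findim_polytope:
  assumes "polytope P" shows "findim (point_diffs P)"
proof -
  obtain v where v: "finite v" "P = convex hull v" using assms unfolding polytope_def by blast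
  have "P \<subseteq> span v"
    unfolding v by (rule hull_minimal) (auto simp: real_vector.span_base subspace_imp_convex)
  then have "point_diffs P \<subseteq> span v"
    unfolding point_diffs_def by (auto intro!: real_vector.span_diff)
  with v show ?thesis unfolding findim_def by blast
qed

lemma pdim_Times:
  assumes "findim (point_diffs P)" "findim (point_diffs Q)" "P \<noteq> {}" "Q \<noteq> {}"
  shows "pdim (P \<times> Q) = pdim P + pdim Q"
  unfolding pdim_def point_diffs_Times using assms by (intro dim_Times0 zero_in_diffs)

subsection \<open>Faces\<close>

lemma face_Times_rect:
  fixes P :: "'a::real_vector set" and Q :: "'b::real_vector set"
  assumes C: "C face_of (P \<times> Q)"
  shows "C = fst ` C \<times> snd ` C"
proof -
  have "(a, d) \<in> C" if ab: "(a, b) \<in> C" and cd: "(c, d) \<in> C" for a b c d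
  proof (cases "a = c \<or> b = d")
    case True then show ?thesis using ab cd by auto
  next
    case False
    have CP: "C \<subseteq> P \<times> Q" and cC: "convex C" using C unfolding face_of_def by auto
    have "(1/2) *\<^sub>R (a, b) + (1/2) *\<^sub>R (c, d) \<in> C"
      using convexD[OF cC ab cd, of "1/2" "1/2"] by simp
    moreover have "(1/2) *\<^sub>R (a, b) + (1/2) *\<^sub>R (c, d) = (1/2) *\<^sub>R (a, d) + (1/2) *\<^sub>R (c, b)"
      by (simp add: add.commute)
    ultimately have m: "(1/2) *\<^sub>R (a, d) + (1/2) *\<^sub>R (c, b) \<in> C" by metis
    moreover have "(1/2) *\<^sub>R (a, d) + (1/2) *\<^sub>R (c, b) \<in> open_segment (a, d) (c, b)"
      using False by (auto simp: in_segment intro!: exI[of _ "1/2"])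
    ultimately show ?thesis
      using face_ofD[OF C _ _ _ m, of "(a, d)" "(c, b)"] ab cd CP by auto
  qed
  then show ?thesis by force
qed

lemma face_fst:
  assumes C: "C face_of (P \<times> Q)" shows "fst ` C face_of P"
  unfolding face_of_def
proof (intro conjI ballI impI)
  have CP: "C \<subseteq> P \<times> Q" and cC: "convex C" using C unfolding face_of_def by auto
  show "fst ` C \<subseteq> P" using CP by auto
  show "convex (fst ` C)" using cC by (intro convex_linear_image linear_fst)
  fix a b x assume ab: "a \<in> P" "b \<in> P" and x: "x \<in> fst ` C" "x \<in> open_segment a b"
  obtain y where y: "(x, y) \<in> C" using x by auto
  obtain u where u: "0 < u" "u < 1" "x = (1 - u) *\<^sub>R a + u *\<^sub>R b" "a \<noteq> b"
    using x(2) by (auto simp: in_segment)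
  have "(x, y) \<in> open_segment (a, y) (b, y)"
    using u by (auto simp: in_segment algebra_simps intro!: exI[of _ u])
  then have "(a, y) \<in> C \<and> (b, y) \<in> C"
    using face_ofD[OF C _ _ _ y] ab y CP by auto
  then show "a \<in> fst ` C" "b \<in> fst ` C" by force+
qed

lemma face_snd:
  assumes C: "C face_of (P \<times> Q)" shows "snd ` C face_of Q"
  unfolding face_of_def
proof (intro conjI ballI impI)
  have CP: "C \<subseteq> P \<times> Q" and cC: "convex C" using C unfolding face_of_def by auto
  show "snd ` C \<subseteq> Q" using CP by auto
  show "convex (snd ` C)" using cC by (intro convex_linear_image linear_snd)
  fix a b y assume ab: "a \<in> Q" "b \<in> Q" and y: "y \<in> snd ` C" "y \<in> open_segment a b"
  obtain x where x: "(x, y) \<in> C" using y by auto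
  obtain u where u: "0 < u" "u < 1" "y = (1 - u) *\<^sub>R a + u *\<^sub>R b" "a \<noteq> b"
    using y(2) by (auto simp: in_segment)
  have "(x, y) \<in> open_segment (x, a) (x, b)"
    using u by (auto simp: in_segment algebra_simps intro!: exI[of _ u])
  then have "(x, a) \<in> C \<and> (x, b) \<in> C"
    using face_ofD[OF C _ _ _ x] ab x CP by auto
  then show "a \<in> snd ` C" "b \<in> snd ` C" by force+
qed

lemma faces_Times:
  "C face_of (P \<times> Q) \<longleftrightarrow> (\<exists>F G. F face_of P \<and> G face_of Q \<and> C = F \<times> G)"
  using face_Times_rect face_fst face_snd face_of_Times by metis

subsection \<open>Combinatorial equivalence\<close>

lemma comb_equiv_refl: "comb_equiv P P"
  unfolding comb_equiv_def by (intro exI[of _ id]) auto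

lemma comb_equiv_sym:
  assumes "comb_equiv P Q" shows "comb_equiv Q P"
proof -
  obtain f where f: "bij_betw f {F. F face_of P} {G. G face_of Q}"
    "\<And>F F'. F face_of P \<Longrightarrow> F' face_of P \<Longrightarrow> (F \<subseteq> F' \<longleftrightarrow> f F \<subseteq> f F')"
    using assms unfolding comb_equiv_def by blast
  let ?g = "inv_into {F. F face_of P} f"
  have g: "bij_betw ?g {G. G face_of Q} {F. F face_of P}" using f by (simp add: bij_betw_inv_into)
  have "G \<subseteq> G' \<longleftrightarrow> ?g G \<subseteq> ?g G'" if "G face_of Q" "G' face_of Q" for G G'
  proof -
    have "?g G face_of P" "?g G' face_of P" using g that unfolding bij_betw_def by auto
    moreover have "f (?g G) = G" "f (?g G') = G'"
      using f that by (simp_all add: bij_betw_inv_into_right)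
    ultimately show ?thesis using f(2)[of "?g G" "?g G'"] by simp
  qed
  with g show ?thesis unfolding comb_equiv_def by blast
qed

lemma comb_equiv_trans:
  assumes "comb_equiv P Q" "comb_equiv Q R" shows "comb_equiv P R"
proof -
  obtain f where f: "bij_betw f {F. F face_of P} {G. G face_of Q}"
    "\<And>F F'. F face_of P \<Longrightarrow> F' face_of P \<Longrightarrow> (F \<subseteq> F' \<longleftrightarrow> f F \<subseteq> f F')"
    using assms(1) unfolding comb_equiv_def by blast
  obtain g where g: "bij_betw g {F. F face_of Q} {G. G face_of R}"
    "\<And>F F'. F face_of Q \<Longrightarrow> F' face_of Q \<Longrightarrow> (F \<subseteq> F' \<longleftrightarrow> g F \<subseteq> g F')"
    using assms(2) unfolding comb_equiv_def by blast
  have "f F face_of Q" if "F face_of P" for F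
    using f(1) that unfolding bij_betw_def by auto
  then show ?thesis
    using bij_betw_trans[OF f(1) g(1)] f(2) g(2) unfolding comb_equiv_def
    by (intro exI[of _ "g \<circ> f"]) auto
qed

lemma comb_equiv_linear_image:
  assumes "linear f" "inj f" shows "comb_equiv P (f ` P)"
  unfolding comb_equiv_def
proof (intro exI[of _ "image f"] conjI allI impI)
  show "bij_betw ((`) f) {F. F face_of P} {G. G face_of f ` P}"
    unfolding bij_betw_def faces_of_linear_image[OF assms]
    using assms(2) by (auto intro!: inj_onI simp: inj_image_eq_iff)
  show "F \<subseteq> F' \<longleftrightarrow> f ` F \<subseteq> f ` F'" for F F'
    using assms(2) by (simp add: inj_image_subset_iff)
qed

lemma face_iso_empty:
  assumes f: "bij_betw f {F. F face_of P} {G. G face_of Q}"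
    "\<And>F F'. F face_of P \<Longrightarrow> F' face_of P \<Longrightarrow> (F \<subseteq> F' \<longleftrightarrow> f F \<subseteq> f F')"
  shows "f {} = {}"
proof -
  have "{} \<in> f ` {F. F face_of P}" using f(1) unfolding bij_betw_def by auto
  then obtain F where "F face_of P" "f F = {}" by auto
  then show ?thesis using f(2)[of "{}" F] by auto
qed

lemma comb_equiv_Times:
  assumes "comb_equiv P P'" "comb_equiv Q Q'"
  shows "comb_equiv (P \<times> Q) (P' \<times> Q')"
proof -
  obtain f where f: "bij_betw f {F. F face_of P} {G. G face_of P'}"
    "\<And>F F'. F face_of P \<Longrightarrow> F' face_of P \<Longrightarrow> (F \<subseteq> F' \<longleftrightarrow> f F \<subseteq> f F')"
    using assms(1) unfolding comb_equiv_def by blast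
  obtain g where g: "bij_betw g {F. F face_of Q} {G. G face_of Q'}"
    "\<And>F F'. F face_of Q \<Longrightarrow> F' face_of Q \<Longrightarrow> (F \<subseteq> F' \<longleftrightarrow> g F \<subseteq> g F')"
    using assms(2) unfolding comb_equiv_def by blast
  have f0: "f {} = {}" and g0: "g {} = {}" using face_iso_empty[OF f] face_iso_empty[OF g] by auto
  have fne: "f F \<noteq> {}" if "F face_of P" "F \<noteq> {}" for F
    using f(2)[of F "{}"] that f0 by auto
  have gne: "g F \<noteq> {}" if "F face_of Q" "F \<noteq> {}" for F
    using g(2)[of F "{}"] that g0 by auto
  have ff: "f F face_of P'" if "F face_of P" for F using f(1) that unfolding bij_betw_def by auto
  have gf: "g F face_of Q'" if "F face_of Q" for F using g(1) that unfolding bij_betw_def by auto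
  define h where "h C = f (fst ` C) \<times> g (snd ` C)" for C
  have h: "h (F \<times> G) = f F \<times> g G" if "F face_of P" "G face_of Q" for F G
    unfolding h_def using f0 g0 by (cases "F = {} \<or> G = {}") auto
  have mono: "C \<subseteq> C' \<longleftrightarrow> h C \<subseteq> h C'" if CC: "C face_of P \<times> Q" "C' face_of P \<times> Q" for C C'
  proof -
    obtain F G F' G' where
      FG: "F face_of P" "G face_of Q" "C = F \<times> G" "F' face_of P" "G' face_of Q" "C' = F' \<times> G'"
      using CC unfolding faces_Times by blast
    have "C \<subseteq> C' \<longleftrightarrow> F = {} \<or> G = {} \<or> (F \<subseteq> F' \<and> G \<subseteq> G')"
      unfolding FG by (auto simp: times_subset_iff)
    also have "\<dots> \<longleftrightarrow> f F = {} \<or> g G = {} \<or> (f F \<subseteq> f F' \<and> g G \<subseteq> g G')"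
      using FG f(2) g(2) fne gne f0 g0 by metis
    also have "\<dots> \<longleftrightarrow> h C \<subseteq> h C'"
      unfolding FG h[OF FG(1,2)] h[OF FG(4,5)] by (auto simp: times_subset_iff)
    finally show ?thesis .
  qed
  have "h ` {F. F face_of P \<times> Q} = {G. G face_of P' \<times> Q'}"
  proof
    show "h ` {F. F face_of P \<times> Q} \<subseteq> {G. G face_of P' \<times> Q'}"
      unfolding faces_Times using h ff gf by blast
    show "{G. G face_of P' \<times> Q'} \<subseteq> h ` {F. F face_of P \<times> Q}"
    proof
      fix D assume "D \<in> {G. G face_of P' \<times> Q'}"
      then obtain F' G' where D: "F' face_of P'" "G' face_of Q'" "D = F' \<times> G'"
        by (auto simp: faces_Times)
      obtain F where F: "F face_of P" "F' = f F" using f(1) D unfolding bij_betw_def by blast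
      obtain G where G: "G face_of Q" "G' = g G" using g(1) D unfolding bij_betw_def by blast
      have "D = h (F \<times> G)" using h F G D by simp
      then show "D \<in> h ` {F. F face_of P \<times> Q}" using F G face_of_Times by blast
    qed
  qed
  moreover have "inj_on h {F. F face_of P \<times> Q}"
    using mono by (intro inj_onI) (metis mem_Collect_eq subset_antisym order_refl)
  ultimately show ?thesis unfolding comb_equiv_def bij_betw_def using mono by blast
qed

subsection \<open>Simple polytopes\<close>

lemma is_facet_linear_image:
  assumes f: "linear f" "inj f"
  shows "is_facet (f ` F) (f ` P) \<longleftrightarrow> is_facet F P"
proof -
  have "(\<forall>G. G face_of f ` P \<and> f ` F \<subseteq> G \<and> G \<noteq> f ` P \<longrightarrow> G = f ` F) \<longleftrightarrow>
        (\<forall>G \<in> {T. T face_of f ` P}. f ` F \<subseteq> G \<and> G \<noteq> f ` P \<longrightarrow> G = f ` F)" by auto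
  also have "\<dots> \<longleftrightarrow> (\<forall>G. G face_of P \<and> F \<subseteq> G \<and> G \<noteq> P \<longrightarrow> G = F)"
    unfolding faces_of_linear_image[OF f] using f
    by (auto simp: inj_image_subset_iff inj_image_eq_iff)
  finally show ?thesis
    unfolding is_facet_def using f by (simp add: face_of_linear_image inj_image_eq_iff)
qed

lemma simple_polytope_linear_image:
  fixes f :: "'a::real_vector \<Rightarrow> 'b::real_vector"
  assumes f: "linear f" "inj f" and P: "simple_polytope P"
  shows "simple_polytope (f ` P)"
  unfolding simple_polytope_def
proof (intro conjI allI impI)
  show "polytope (f ` P)" "f ` P \<noteq> {}"
    using P f unfolding simple_polytope_def by (auto intro: polytope_linear_image)
  fix w assume w: "w extreme_point_of f ` P"
  then have wf: "{w} face_of f ` P" by (simp add: face_of_singleton)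
  obtain v where v: "v \<in> P" "w = f v" using w unfolding extreme_point_of_def by auto
  have "{v} face_of P" using wf face_of_linear_image[OF f, of "{v}" P] v by simp
  then have ev: "v extreme_point_of P" by (simp add: face_of_singleton)
  have "{F. is_facet F (f ` P) \<and> w \<in> F} = (`) f ` {F. is_facet F P \<and> v \<in> F}"
    (is "?L = ?R")
  proof
    show "?L \<subseteq> ?R"
    proof
      fix F assume F: "F \<in> ?L"
      then have "F \<in> {T. T face_of f ` P}" unfolding is_facet_def by simp
      then obtain G where G: "F = f ` G" unfolding faces_of_linear_image[OF f] by auto
      then have "is_facet G P" "v \<in> G"
        using F f v is_facet_linear_image[OF f, of G P] by (auto simp: inj_image_mem_iff)
      then show "F \<in> ?R" using G by auto
    qed
    show "?R \<subseteq> ?L" using f v is_facet_linear_image[OF f] by auto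
  qed
  then have "card {F. is_facet F (f ` P) \<and> w \<in> F} = card {F. is_facet F P \<and> v \<in> F}"
    using f by (simp add: card_image inj_on_def inj_image_eq_iff)
  then show "card {F. is_facet F (f ` P) \<and> w \<in> F} = pdim (f ` P)"
    using P ev f unfolding simple_polytope_def by (simp add: pdim_linear_image)
qed

lemma is_facet_Times:
  assumes ne: "P \<noteq> {}" "Q \<noteq> {}" and cv: "convex P" "convex Q"
  shows "is_facet C (P \<times> Q) \<longleftrightarrow>
    (\<exists>F. is_facet F P \<and> C = F \<times> Q) \<or> (\<exists>G. is_facet G Q \<and> C = P \<times> G)"
proof
  have PP: "P face_of P" "Q face_of Q" using cv by (simp_all add: face_of_refl)
  {
    assume C: "is_facet C (P \<times> Q)"
    then obtain F G where FG: "F face_of P" "G face_of Q" "C = F \<times> G"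
      unfolding faces_Times is_facet_def by blast
    have mx: "C' = C" if "C' face_of P \<times> Q" "C \<subseteq> C'" "C' \<noteq> P \<times> Q" for C'
      using C that unfolding is_facet_def by blast
    have FGne: "F \<noteq> {}" "G \<noteq> {}" using C FG unfolding is_facet_def by auto
    have "F = P \<or> G = Q"
    proof (rule ccontr)
      assume n: "\<not> ?thesis"
      have "F \<times> Q = F \<times> G"
        unfolding FG(3)[symmetric]
      proof (rule mx)
        show "F \<times> Q face_of P \<times> Q" using FG PP face_of_Times by blast
        show "C \<subseteq> F \<times> Q" using FG face_of_imp_subset by blast
        show "F \<times> Q \<noteq> P \<times> Q" using n ne by (auto simp: times_eq_iff)
      qed
      with n FGne show False by (auto simp: times_eq_iff)
    qed
    then show "(\<exists>F. is_facet F P \<and> C = F \<times> Q) \<or> (\<exists>G. is_facet G Q \<and> C = P \<times> G)"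
    proof
      assume F: "F = P"
      have "G \<noteq> Q" using C FG F unfolding is_facet_def by auto
      moreover have "G' = G" if "G' face_of Q" "G \<subseteq> G'" "G' \<noteq> Q" for G'
        using mx[of "P \<times> G'"] that FG F ne face_of_Times[OF PP(1) that(1)]
        by (auto simp: times_eq_iff)
      ultimately have "is_facet G Q" using FG FGne unfolding is_facet_def by blast
      then show ?thesis using FG F by blast
    next
      assume G: "G = Q"
      have "F \<noteq> P" using C FG G unfolding is_facet_def by auto
      moreover have "F' = F" if "F' face_of P" "F \<subseteq> F'" "F' \<noteq> P" for F'
        using mx[of "F' \<times> Q"] that FG G ne face_of_Times[OF that(1) PP(2)]
        by (auto simp: times_eq_iff)
      ultimately have "is_facet F P" using FG FGne unfolding is_facet_def by blast
      then show ?thesis using FG G by blast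
    qed
  }
  assume "(\<exists>F. is_facet F P \<and> C = F \<times> Q) \<or> (\<exists>G. is_facet G Q \<and> C = P \<times> G)"
  then show "is_facet C (P \<times> Q)"
  proof (elim disjE exE conjE)
    fix F assume F: "is_facet F P" "C = F \<times> Q"
    then have F': "F face_of P" "F \<noteq> {}" "F \<noteq> P"
      "\<And>F'. F' face_of P \<Longrightarrow> F \<subseteq> F' \<Longrightarrow> F' \<noteq> P \<Longrightarrow> F' = F"
      unfolding is_facet_def by auto
    have "C' = C" if C': "C' face_of P \<times> Q" "C \<subseteq> C'" "C' \<noteq> P \<times> Q" for C'
    proof -
      obtain H G where H: "H face_of P" "G face_of Q" "C' = H \<times> G"
        using C' unfolding faces_Times by blast
      then have "F \<subseteq> H" "Q \<subseteq> G" using C' F F' ne by (auto simp: times_subset_iff)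
      then have "G = Q" using H face_of_imp_subset by blast
      then show ?thesis using H C' F F'(4)[OF H(1) \<open>F \<subseteq> H\<close>] by auto
    qed
    moreover have "C face_of P \<times> Q" unfolding F(2) by (rule face_of_Times[OF F'(1) PP(2)])
    moreover have "C \<noteq> {}" "C \<noteq> P \<times> Q" using F F' ne by (auto simp: times_eq_iff)
    ultimately show ?thesis unfolding is_facet_def by blast
  next
    fix G assume G: "is_facet G Q" "C = P \<times> G"
    then have G': "G face_of Q" "G \<noteq> {}" "G \<noteq> Q"
      "\<And>G'. G' face_of Q \<Longrightarrow> G \<subseteq> G' \<Longrightarrow> G' \<noteq> Q \<Longrightarrow> G' = G"
      unfolding is_facet_def by auto
    have "C' = C" if C': "C' face_of P \<times> Q" "C \<subseteq> C'" "C' \<noteq> P \<times> Q" for C'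
    proof -
      obtain F H where H: "F face_of P" "H face_of Q" "C' = F \<times> H"
        using C' unfolding faces_Times by blast
      then have "G \<subseteq> H" "P \<subseteq> F" using C' G G' ne by (auto simp: times_subset_iff)
      then have "F = P" using H face_of_imp_subset by blast
      then show ?thesis using H C' G G'(4)[OF H(2) \<open>G \<subseteq> H\<close>] by auto
    qed
    moreover have "C face_of P \<times> Q" unfolding G(2) by (rule face_of_Times[OF PP(1) G'(1)])
    moreover have "C \<noteq> {}" "C \<noteq> P \<times> Q" using G G' ne by (auto simp: times_eq_iff)
    ultimately show ?thesis unfolding is_facet_def by blast
  qed
qed

lemma no_facet_of_pdim_0:
  assumes fin: "findim (point_diffs P)" and d: "pdim P = 0"
  shows "\<not> is_facet F P"
proof
  assume "is_facet F P"
  then have F: "F \<subseteq> P" "F \<noteq> {}" "F \<noteq> P" unfolding is_facet_def by (auto simp: face_of_def)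
  obtain b where b: "finite b" "span b = span (point_diffs P)" "dim (point_diffs P) = card b"
    using findim_basis[OF fin] .
  then have "b = {}" using d unfolding pdim_def by simp
  then have "point_diffs P \<subseteq> {0}" using b real_vector.span_superset[of "point_diffs P"] by simp
  then have "x = y" if "x \<in> P" "y \<in> P" for x y using that unfolding point_diffs_def by force
  then show False using F by blast
qed

lemma simple_polytope_Times:
  fixes P :: "'a::real_vector set" and Q :: "'b::real_vector set"
  assumes P: "simple_polytope P" and Q: "simple_polytope Q"
  shows "simple_polytope (P \<times> Q)"
  unfolding simple_polytope_def
proof (intro conjI allI impI)
  have pP: "polytope P" and pQ: "polytope Q" and ne: "P \<noteq> {}" "Q \<noteq> {}"
    using P Q unfolding simple_polytope_def by auto
  obtain v w where vw: "finite v" "P = convex hull v" "finite w" "Q = convex hull w"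
    using pP pQ unfolding polytope_def by blast
  then have cv: "convex P" "convex Q" by auto
  have fin: "findim (point_diffs P)" "findim (point_diffs Q)" using pP pQ findim_polytope by auto
  show "polytope (P \<times> Q)"
    unfolding polytope_def using vw by (intro exI[of _ "v \<times> w"]) (simp add: convex_hull_Times)
  show "P \<times> Q \<noteq> {}" using ne by simp
  fix z assume "z extreme_point_of P \<times> Q"
  then have zf: "{z} face_of P \<times> Q" by (simp add: face_of_singleton)
  obtain a b where z: "z = (a, b)" by (cases z)
  have "{a} face_of P" "{b} face_of Q"
    using face_fst[OF zf] face_snd[OF zf] z by auto
  then have ab: "a extreme_point_of P" "b extreme_point_of Q" by (simp_all add: face_of_singleton)
  then have abin: "a \<in> P" "b \<in> Q" unfolding extreme_point_of_def by auto
  let ?A = "{F. is_facet F P \<and> a \<in> F}" and ?B = "{G. is_facet G Q \<and> b \<in> G}"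
  have cA: "card ?A = pdim P" and cB: "card ?B = pdim Q"
    using P Q ab unfolding simple_polytope_def by auto
  have fA: "finite ?A"
  proof (cases "pdim P = 0")
    case True then show ?thesis using no_facet_of_pdim_0[OF fin(1)] by simp
  next
    case False then show ?thesis using cA card_ge_0_finite[of ?A] by simp
  qed
  have fB: "finite ?B"
  proof (cases "pdim Q = 0")
    case True then show ?thesis using no_facet_of_pdim_0[OF fin(2)] by simp
  next
    case False then show ?thesis using cB card_ge_0_finite[of ?B] by simp
  qed
  have eq: "{C. is_facet C (P \<times> Q) \<and> z \<in> C} = (\<lambda>F. F \<times> Q) ` ?A \<union> (\<lambda>G. P \<times> G) ` ?B"
    unfolding is_facet_Times[OF ne cv] z using abin by auto
  have inj: "inj_on (\<lambda>F. F \<times> Q) ?A" "inj_on (\<lambda>G. P \<times> G) ?B"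
    using ne by (auto intro!: inj_onI simp: times_eq_iff)
  have "(\<lambda>F. F \<times> Q) ` ?A \<inter> (\<lambda>G. P \<times> G) ` ?B = {}"
  proof (rule ccontr)
    assume "\<not> ?thesis"
    then obtain F G where "is_facet F P" "F \<times> Q = P \<times> G" by auto
    then have "F = P" "is_facet F P" using ne unfolding is_facet_def by (auto simp: times_eq_iff)
    then show False unfolding is_facet_def by simp
  qed
  then have "card {C. is_facet C (P \<times> Q) \<and> z \<in> C} = card ?A + card ?B"
    unfolding eq using fA fB inj by (subst card_Un_disjoint) (auto simp: card_image)
  then show "card {C. is_facet C (P \<times> Q) \<and> z \<in> C} = pdim (P \<times> Q)"
    using cA cB pdim_Times[OF fin ne] by simp
qed

lemma simple_polytope_singleton: "simple_polytope {a::'a::real_vector}"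
  unfolding simple_polytope_def
proof (intro conjI allI impI)
  show "polytope {a}" unfolding polytope_def by (intro exI[of _ "{a}"]) simp
  have d: "point_diffs {a} = {0}" unfolding point_diffs_def by auto
  moreover have "dim {0::'a} = card ({}::'a set)"
    by (rule real_vector.dim_eq_card) (auto simp: real_vector.independent_empty)
  ultimately have "pdim {a} = 0" unfolding pdim_def by simp
  moreover have "findim (point_diffs {a})" unfolding findim_def d by (intro exI[of _ "{}"]) simp
  ultimately have "pdim {a} = 0" "\<not> is_facet F {a}" for F
    using no_facet_of_pdim_0[of "{a}"] by auto
  then show "card {F. is_facet F {a} \<and> v \<in> F} = pdim {a}" for v by simp
qed simp

section \<open>The ring of simple polytopes\<close>

text \<open>
  A combinatorial type is the class of all its realisations in \<^typ>\<open>nat \<Rightarrow>\<^sub>0 real\<close>, the union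
  of the spaces \<open>\<real>\<^sup>n\<close>, by simple polytopes. The type of a polytope in another real vector
  space is then available through combinatorial equivalence; the value of \<open>type_of\<close> is only
  meaningful for simple polytopes.
\<close>

definition simple_class :: "'a::real_vector set \<Rightarrow> (nat \<Rightarrow>\<^sub>0 real) set set"
  where "simple_class P = {Q. simple_polytope Q \<and> comb_equiv P Q}"

typedef simple_type = "{simple_class P |P :: (nat \<Rightarrow>\<^sub>0 real) set. simple_polytope P}"
  by (rule exI, rule CollectI, rule exI, rule conjI, rule refl, rule simple_polytope_singleton)

definition type_of :: "'a::real_vector set \<Rightarrow> simple_type"
  where "type_of P = Abs_simple_type (simple_class P)"

definition rep_of :: "simple_type \<Rightarrow> (nat \<Rightarrow>\<^sub>0 real) set"
  where "rep_of t = (SOME P. P \<in> Rep_simple_type t)"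

lemma simple_class_eq: "comb_equiv P Q \<Longrightarrow> simple_class P = simple_class Q"
  unfolding simple_class_def
  by (auto intro: comb_equiv_trans[OF comb_equiv_sym[of P Q]] comb_equiv_trans[of P Q])

lemma type_of_eq: "comb_equiv P Q \<Longrightarrow> type_of P = type_of Q"
  unfolding type_of_def by (simp add: simple_class_eq)

lemma rep_in: "rep_of t \<in> Rep_simple_type t"
proof -
  obtain P :: "(nat \<Rightarrow>\<^sub>0 real) set" where "simple_polytope P" "Rep_simple_type t = simple_class P"
    using Rep_simple_type[of t] by blast
  then have "P \<in> Rep_simple_type t" by (simp add: simple_class_def comb_equiv_refl)
  then show ?thesis unfolding rep_of_def by (rule someI)
qed

lemma simple_rep: "simple_polytope (rep_of t)"
  using rep_in[of t] Rep_simple_type[of t] unfolding simple_class_def by auto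

lemma type_of_rep: "type_of (rep_of t) = t"
proof -
  obtain P :: "(nat \<Rightarrow>\<^sub>0 real) set" where P: "Rep_simple_type t = simple_class P"
    using Rep_simple_type[of t] by blast
  then have "comb_equiv P (rep_of t)" using rep_in[of t] unfolding simple_class_def by auto
  then have "simple_class (rep_of t) = Rep_simple_type t" using P simple_class_eq[of P "rep_of t"] by simp
  then show ?thesis unfolding type_of_def by (simp add: Rep_simple_type_inverse)
qed

lemma rep_type_of:
  fixes Q :: "(nat \<Rightarrow>\<^sub>0 real) set"
  assumes "simple_polytope Q" "comb_equiv P Q"
  shows "comb_equiv P (rep_of (type_of P))"
proof -
  have "simple_class P = simple_class Q" using assms(2) by (rule simple_class_eq)
  then have "Rep_simple_type (type_of P) = simple_class P"
    unfolding type_of_def using assms by (intro Abs_simple_type_inverse) blast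
  then show ?thesis using rep_in[of "type_of P"] unfolding simple_class_def by auto
qed

text \<open>
  An embedding of \<open>\<real>\<^sup>\<infinity> \<times> \<real>\<^sup>\<infinity>\<close> into \<open>\<real>\<^sup>\<infinity>\<close>, needed only to see that the product of two simple
  polytopes in \<^typ>\<open>nat \<Rightarrow>\<^sub>0 real\<close> has a combinatorial type.
\<close>

definition interleave :: "(nat \<Rightarrow>\<^sub>0 real) \<times> (nat \<Rightarrow>\<^sub>0 real) \<Rightarrow> (nat \<Rightarrow>\<^sub>0 real)"
  where "interleave z = Abs_poly_mapping (\<lambda>i.
    if even i then Poly_Mapping.lookup (fst z) (i div 2) else Poly_Mapping.lookup (snd z) (i div 2))"

lemma lookup_interleave:
  "Poly_Mapping.lookup (interleave z) i =
    (if even i then Poly_Mapping.lookup (fst z) (i div 2) else Poly_Mapping.lookup (snd z) (i div 2))"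
proof -
  have "{i. (if even i then Poly_Mapping.lookup (fst z) (i div 2) else Poly_Mapping.lookup (snd z) (i div 2)) \<noteq> 0}
      \<subseteq> (\<lambda>k. 2 * k) ` Poly_Mapping.keys (fst z) \<union> (\<lambda>k. 2 * k + 1) ` Poly_Mapping.keys (snd z)"
  proof
    fix i
    assume "i \<in> {i. (if even i then Poly_Mapping.lookup (fst z) (i div 2) else Poly_Mapping.lookup (snd z) (i div 2)) \<noteq> 0}"
    then show "i \<in> (\<lambda>k. 2 * k) ` Poly_Mapping.keys (fst z) \<union> (\<lambda>k. 2 * k + 1) ` Poly_Mapping.keys (snd z)"
      by (cases "even i") (auto simp: in_keys_iff elim!: evenE oddE)
  qed
  then have "finite {i. (if even i then Poly_Mapping.lookup (fst z) (i div 2) else Poly_Mapping.lookup (snd z) (i div 2)) \<noteq> 0}"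
    by (rule finite_subset) simp
  then show ?thesis unfolding interleave_def by (subst Abs_poly_mapping_inverse) auto
qed

lemma lookup_scaleR: "Poly_Mapping.lookup (c *\<^sub>R (x :: 'v \<Rightarrow>\<^sub>0 real)) i = c * Poly_Mapping.lookup x i"
proof -
  have "finite {i. c *\<^sub>R Poly_Mapping.lookup x i \<noteq> 0}"
    by (rule finite_subset[of _ "Poly_Mapping.keys x"]) (auto simp: in_keys_iff)
  then show ?thesis unfolding scaleR_poly_mapping_def by (simp add: Abs_poly_mapping_inverse)
qed

lemma linear_interleave: "linear interleave"
  by (rule linearI) (auto intro!: poly_mapping_eqI simp: lookup_interleave lookup_add lookup_scaleR)

lemma inj_interleave: "inj interleave"
proof (rule injI)
  fix z w assume eq: "interleave z = interleave w"
  have "Poly_Mapping.lookup (fst z) i = Poly_Mapping.lookup (fst w) i" for i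
    using arg_cong[OF eq, of "\<lambda>p. Poly_Mapping.lookup p (2 * i)"] by (simp add: lookup_interleave)
  moreover have "Poly_Mapping.lookup (snd z) i = Poly_Mapping.lookup (snd w) i" for i
    using arg_cong[OF eq, of "\<lambda>p. Poly_Mapping.lookup p (2 * i + 1)"] by (simp add: lookup_interleave)
  ultimately show "z = w" by (simp add: prod_eq_iff poly_mapping_eqI)
qed

lemma rep_type_of_Times:
  "comb_equiv (rep_of s \<times> rep_of t) (rep_of (type_of (rep_of s \<times> rep_of t)))"
  by (rule rep_type_of[of "interleave ` (rep_of s \<times> rep_of t)"])
     (simp_all add: simple_polytope_linear_image simple_polytope_Times simple_rep
       comb_equiv_linear_image linear_interleave inj_interleave)

text \<open>
  The monoid of combinatorial types under the Cartesian product is written additively (with the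
  point as zero), so that \<^typ>\<open>simple_type \<Rightarrow>\<^sub>0 int\<close>, whose library multiplication is
  convolution along \<open>+\<close> on the keys, is the ring of simple polytopes: its addition is
  disjoint union, its multiplication the bilinear extension of the Cartesian product.
\<close>

instantiation simple_type :: comm_monoid_add
begin

definition zero_simple_type :: simple_type
  where "0 = type_of {0::nat \<Rightarrow>\<^sub>0 real}"

definition plus_simple_type :: "simple_type \<Rightarrow> simple_type \<Rightarrow> simple_type"
  where "s + t = type_of (rep_of s \<times> rep_of t)"

instance
proof
  fix r s t :: simple_type
  show "r + s + t = r + (s + t)"
  proof -
    have "comb_equiv (rep_of (r + s) \<times> rep_of t) ((rep_of r \<times> rep_of s) \<times> rep_of t)"
      unfolding plus_simple_type_def
      by (intro comb_equiv_Times comb_equiv_refl comb_equiv_sym[OF rep_type_of_Times])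
    moreover have "comb_equiv ((rep_of r \<times> rep_of s) \<times> rep_of t) (rep_of r \<times> (rep_of s \<times> rep_of t))"
    proof -
      let ?f = "\<lambda>z :: ((nat \<Rightarrow>\<^sub>0 real) \<times> (nat \<Rightarrow>\<^sub>0 real)) \<times> (nat \<Rightarrow>\<^sub>0 real).
        (fst (fst z), (snd (fst z), snd z))"
      have "linear ?f" by (rule linearI) auto
      moreover have "inj ?f" by (rule injI) (auto simp: prod_eq_iff)
      moreover have "?f ` ((rep_of r \<times> rep_of s) \<times> rep_of t) = rep_of r \<times> (rep_of s \<times> rep_of t)" by force
      ultimately show ?thesis using comb_equiv_linear_image[of ?f "(rep_of r \<times> rep_of s) \<times> rep_of t"] by simp
    qed
    moreover have "comb_equiv (rep_of r \<times> (rep_of s \<times> rep_of t)) (rep_of r \<times> rep_of (s + t))"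
      unfolding plus_simple_type_def
      by (intro comb_equiv_Times comb_equiv_refl rep_type_of_Times)
    ultimately have "comb_equiv (rep_of (r + s) \<times> rep_of t) (rep_of r \<times> rep_of (s + t))"
      by (rule comb_equiv_trans[OF comb_equiv_trans])
    then show ?thesis unfolding plus_simple_type_def[of "r + s" t] plus_simple_type_def[of r "s + t"]
      by (rule type_of_eq)
  qed
  show "s + t = t + s"
  proof -
    let ?f = "\<lambda>z :: (nat \<Rightarrow>\<^sub>0 real) \<times> (nat \<Rightarrow>\<^sub>0 real). (snd z, fst z)"
    have "linear ?f" by (rule linearI) auto
    moreover have "inj ?f" by (rule injI) (auto simp: prod_eq_iff)
    moreover have "?f ` (rep_of s \<times> rep_of t) = rep_of t \<times> rep_of s" by (auto simp: image_iff)
    ultimately have "comb_equiv (rep_of s \<times> rep_of t) (rep_of t \<times> rep_of s)"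
      using comb_equiv_linear_image[of ?f "rep_of s \<times> rep_of t"] by simp
    then show ?thesis unfolding plus_simple_type_def by (rule type_of_eq)
  qed
  show "0 + t = t"
  proof -
    let ?O = "{0::nat \<Rightarrow>\<^sub>0 real}"
    let ?f = "\<lambda>z :: nat \<Rightarrow>\<^sub>0 real. (0 :: nat \<Rightarrow>\<^sub>0 real, z)"
    have "linear ?f" by (rule linearI) auto
    moreover have "inj ?f" by (rule injI) auto
    moreover have "?f ` rep_of t = ?O \<times> rep_of t" by (auto simp: image_iff)
    ultimately have "comb_equiv (rep_of t) (?O \<times> rep_of t)"
      using comb_equiv_linear_image[of ?f "rep_of t"] by simp
    moreover have "comb_equiv ?O (rep_of 0)"
      unfolding zero_simple_type_def
      by (rule rep_type_of[OF simple_polytope_singleton comb_equiv_refl])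
    then have "comb_equiv (?O \<times> rep_of t) (rep_of 0 \<times> rep_of t)"
      by (intro comb_equiv_Times comb_equiv_refl)
    ultimately have "comb_equiv (rep_of t) (rep_of 0 \<times> rep_of t)" by (rule comb_equiv_trans)
    from type_of_eq[OF this] show ?thesis unfolding plus_simple_type_def by (simp add: type_of_rep)
  qed
qed

end

type_synonym polytope_ring = "simple_type \<Rightarrow>\<^sub>0 int"

text \<open>The tensor product of the free abelian group with \<open>\<rat>\<close> is the free \<open>\<rat>\<close>-vector space on the
  same basis.\<close>

type_synonym rat_polytope_ring = "simple_type \<Rightarrow>\<^sub>0 rat"

definition to_rat :: "polytope_ring \<Rightarrow> rat_polytope_ring"
  where "to_rat p = Poly_Mapping.map rat_of_int p"

definition rat_scalar :: "rat \<Rightarrow> rat_polytope_ring"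
  where "rat_scalar c = Poly_Mapping.single 0 c"

definition facet_sum :: "'a::real_vector set \<Rightarrow> polytope_ring"
  where "facet_sum P = (\<Sum>F | is_facet F P. frag_of (type_of F))"

text \<open>
  Facets of simple polytopes are simple, and the choice of representatives does not matter: for
  the sum of facets by \<open>facet_sum_cong\<close> and \<open>pol_d_type_of\<close>, and for the dimension since it is
  the number of facets through any vertex of a simple polytope.
\<close>

definition pol_d :: "polytope_ring \<Rightarrow> polytope_ring"
  where "pol_d = frag_extend (\<lambda>t. facet_sum (rep_of t))"

definition type_dim :: "simple_type \<Rightarrow> nat"
  where "type_dim t = pdim (rep_of t)"

lemma facet_sum_cong:
  assumes "comb_equiv P Q" and cv: "convex P" "convex Q"
  shows "facet_sum P = facet_sum Q"
proof -
  obtain f where f: "bij_betw f {F. F face_of P} {G. G face_of Q}"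
    "\<And>F F'. F face_of P \<Longrightarrow> F' face_of P \<Longrightarrow> (F \<subseteq> F' \<longleftrightarrow> f F \<subseteq> f F')"
    using assms unfolding comb_equiv_def by blast
  have ff: "f F face_of Q" if "F face_of P" for F using f(1) that unfolding bij_betw_def by auto
  have eq: "f F = f F' \<longleftrightarrow> F = F'" if "F face_of P" "F' face_of P" for F F'
    using f(1) that unfolding bij_betw_def inj_on_def by auto
  have surj: "\<exists>F. F face_of P \<and> G = f F" if "G face_of Q" for G
    using f(1) that unfolding bij_betw_def by blast
  have f0: "f {} = {}" by (rule face_iso_empty[OF f])
  have f1: "f P = Q"
  proof -
    obtain F where F: "F face_of P" "Q = f F" using surj cv face_of_refl by blast
    then have "f F \<subseteq> f P" using f(2)[of F P] face_of_imp_subset face_of_refl[OF cv(1)] by blast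
    then show ?thesis using F ff[OF face_of_refl[OF cv(1)]] face_of_imp_subset by blast
  qed
  have Pf: "P face_of P" using cv by (simp add: face_of_refl)
  have fac: "is_facet (f F) Q \<longleftrightarrow> is_facet F P" if F: "F face_of P" for F
  proof -
    have "(\<forall>G. G face_of Q \<and> f F \<subseteq> G \<and> G \<noteq> Q \<longrightarrow> G = f F) \<longleftrightarrow>
      (\<forall>G. G face_of P \<and> f F \<subseteq> f G \<and> f G \<noteq> f P \<longrightarrow> f G = f F)"
      unfolding f1 using surj ff by metis
    also have "\<dots> \<longleftrightarrow> (\<forall>G. G face_of P \<and> F \<subseteq> G \<and> G \<noteq> P \<longrightarrow> G = F)"
      using f(2) eq F Pf by metis
    finally show ?thesis
      unfolding is_facet_def using eq[OF F Pf] eq[OF F empty_face_of] ff[OF F] F f0 f1 by simp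
  qed
  have "bij_betw f {F. is_facet F P} {G. is_facet G Q}"
    unfolding bij_betw_def
  proof
    show "inj_on f {F. is_facet F P}" using eq by (auto intro!: inj_onI simp: is_facet_def)
    show "f ` {F. is_facet F P} = {G. is_facet G Q}"
    proof
      show "f ` {F. is_facet F P} \<subseteq> {G. is_facet G Q}" using fac by (auto simp: is_facet_def)
      show "{G. is_facet G Q} \<subseteq> f ` {F. is_facet F P}"
      proof
        fix G assume "G \<in> {G. is_facet G Q}"
        then have G: "is_facet G Q" "G face_of Q" unfolding is_facet_def by auto
        then show "G \<in> f ` {F. is_facet F P}" using surj[of G] fac by auto
      qed
    qed
  qed
  moreover have "type_of (f F) = type_of F" if "is_facet F P" for F
  proof (rule type_of_eq, rule comb_equiv_sym)
    have F: "F face_of P" using that unfolding is_facet_def by blast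
    have faces: "{G. G face_of F} = {G \<in> {G. G face_of P}. G \<subseteq> F}"
      "{G. G face_of f F} = {G \<in> {G. G face_of Q}. G \<subseteq> f F}"
      using face_of_face[OF F] face_of_face[OF ff[OF F]] by auto
    have "f ` {G. G face_of F} = {G. G face_of f F}"
    proof
      show "f ` {G. G face_of F} \<subseteq> {G. G face_of f F}"
        unfolding faces using f(2) F ff by auto
      show "{G. G face_of f F} \<subseteq> f ` {G. G face_of F}"
      proof
        fix G assume "G \<in> {G. G face_of f F}"
        then have G: "G face_of Q" "G \<subseteq> f F" unfolding faces by auto
        obtain H where H: "H face_of P" "G = f H" using surj G by blast
        then have "H \<subseteq> F" using f(2)[OF H(1) F] G by simp
        then show "G \<in> f ` {G. G face_of F}" unfolding faces using H by blast
      qed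
    qed
    moreover have "inj_on f {G. G face_of F}"
      unfolding faces using eq by (auto intro!: inj_onI)
    moreover have "\<forall>G H. G face_of F \<longrightarrow> H face_of F \<longrightarrow> (G \<subseteq> H \<longleftrightarrow> f G \<subseteq> f H)"
      using f(2) face_of_face[OF F] by auto
    ultimately show "comb_equiv F (f F)" unfolding comb_equiv_def bij_betw_def by blast
  qed
  ultimately have bij: "bij_betw f {F. is_facet F P} {G. is_facet G Q}"
    and ty: "\<And>F. is_facet F P \<Longrightarrow> type_of (f F) = type_of F" by blast+
  have "facet_sum Q = (\<Sum>F | is_facet F P. frag_of (type_of (f F)))"
    unfolding facet_sum_def by (rule sum.reindex_bij_betw[OF bij, symmetric])
  also have "\<dots> = facet_sum P" unfolding facet_sum_def using ty by (intro sum.cong) auto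
  finally show ?thesis by simp
qed

lemma pol_d_type_of:
  fixes P :: "(nat \<Rightarrow>\<^sub>0 real) set"
  assumes P: "simple_polytope P"
  shows "pol_d (frag_of (type_of P)) = facet_sum P"
proof -
  have "convex P" "convex (rep_of (type_of P))"
    using P simple_rep[of "type_of P"] unfolding simple_polytope_def polytope_def by auto
  with facet_sum_cong[OF rep_type_of[OF P comb_equiv_refl]] show ?thesis
    unfolding pol_d_def by (simp add: frag_extend_def)
qed

definition pol_Q :: "simple_type \<Rightarrow> rat_polytope_ring fps"
  where "pol_Q t = (\<Sum>k\<le>type_dim t.
    fps_const (to_rat ((pol_d ^^ k) (frag_of t)) * rat_scalar (1 / fact k)) * fps_X ^ k)"

section \<open>Nestohedra\<close>

definition building_set :: "'v set \<Rightarrow> 'v set set \<Rightarrow> bool"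
  where "building_set V B \<longleftrightarrow> finite V \<and> V \<noteq> {} \<and> (\<forall>S\<in>B. S \<noteq> {} \<and> S \<subseteq> V) \<and>
    (\<forall>i\<in>V. {i} \<in> B) \<and> (\<forall>S\<in>B. \<forall>T\<in>B. S \<inter> T \<noteq> {} \<longrightarrow> S \<union> T \<in> B)"

text \<open>The sum is the Minkowski sum of \<^theory>\<open>HOL-Library.Set_Algebras\<close>.\<close>

definition nestohedron :: "'v set set \<Rightarrow> ('v \<Rightarrow>\<^sub>0 real) set"
  where "nestohedron B = (\<Sum>S\<in>B. convex hull ((\<lambda>i. Poly_Mapping.single i 1) ` S))"

text \<open>A simple graph is given by its symmetric irreflexive edge relation; the star has centre 1.\<close>

definition graph_building :: "'v set \<Rightarrow> 'v rel \<Rightarrow> 'v set set"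
  where "graph_building V E = {S. S \<noteq> {} \<and> S \<subseteq> V \<and>
    (\<forall>u\<in>S. \<forall>v\<in>S. (u, v) \<in> (E \<inter> S \<times> S)\<^sup>*)}"

definition complete_graph :: "nat \<Rightarrow> nat rel"
  where "complete_graph m = {(i, j). i \<in> {1..m} \<and> j \<in> {1..m} \<and> i \<noteq> j}"

definition star_graph :: "nat \<Rightarrow> nat rel"
  where "star_graph m = {(i, j). i \<in> {1..m} \<and> j \<in> {1..m} \<and> i \<noteq> j \<and> (i = 1 \<or> j = 1)}"

definition B_Gamma :: "nat \<Rightarrow> nat set set"
  where "B_Gamma n = {{i} |i. i \<in> {1..n+1}} \<union> {S. S \<subseteq> {1..n} \<and> card S \<ge> 2}
    \<union> {{1, n+1} \<union> J |J. J \<subseteq> {2..n}}"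

definition B_P :: "nat \<Rightarrow> nat set set"
  where "B_P n = {{i} |i. i \<in> {1..n+1}} \<union> {{1, 2} \<union> I |I. I \<subseteq> {3..n+1}}
    \<union> {{1} \<union> J |J. J \<noteq> {} \<and> J \<subseteq> {3..n}}"

definition point_type :: simple_type
  where "point_type = type_of {0::real}"

definition segment_type :: simple_type
  where "segment_type = type_of {0..1::real}"

definition Pe :: "nat \<Rightarrow> simple_type"
  where "Pe n = type_of (nestohedron (graph_building {1..n+1} (complete_graph (n+1))))"

definition St :: "nat \<Rightarrow> simple_type"
  where "St n = type_of (nestohedron (graph_building {1..n+1} (star_graph (n+1))))"

definition P_Gamma :: "nat \<Rightarrow> simple_type"
  where "P_Gamma n = (if n = 0 then point_type else if n = 1 then segment_type
    else type_of (nestohedron (B_Gamma n)))"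

definition P_Mas :: "nat \<Rightarrow> simple_type"
  where "P_Mas n = (if n = 0 then point_type else if n = 1 then segment_type
    else type_of (nestohedron (B_P n)))"

lemma building_set_B_Gamma:
  assumes "n \<ge> 2" shows "building_set {1..n+1} (B_Gamma n)" "{1..n+1} \<in> B_Gamma n"
proof -
  have char: "S \<in> B_Gamma n \<longleftrightarrow>
      S \<noteq> {} \<and> S \<subseteq> {1..n+1} \<and> (n + 1 \<in> S \<longrightarrow> 1 \<in> S \<or> S = {n+1})" for S
  proof
    assume "S \<in> B_Gamma n"
    then show "S \<noteq> {} \<and> S \<subseteq> {1..n+1} \<and> (n + 1 \<in> S \<longrightarrow> 1 \<in> S \<or> S = {n+1})"
      using assms unfolding B_Gamma_def by fastforce
  next
    assume S: "S \<noteq> {} \<and> S \<subseteq> {1..n+1} \<and> (n + 1 \<in> S \<longrightarrow> 1 \<in> S \<or> S = {n+1})"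
    show "S \<in> B_Gamma n"
    proof (cases "n + 1 \<in> S")
      case True
      show ?thesis
      proof (cases "S = {n+1}")
        case True then show ?thesis unfolding B_Gamma_def by auto
      next
        case False
        have "S = {1, n+1} \<union> (S - {1, n+1})" using S True False by auto
        moreover have "S - {1, n+1} \<subseteq> {2..n}" using S by (auto simp: subset_iff le_Suc_eq)
        ultimately show ?thesis unfolding B_Gamma_def by blast
      qed
    next
      case False
      have sub: "S \<subseteq> {1..n}" using S False by (auto simp: subset_iff le_Suc_eq)
      then have "finite S" by (rule finite_subset) simp
      show ?thesis
      proof (cases "card S \<ge> 2")
        case True then show ?thesis using sub unfolding B_Gamma_def by blast
      next
        case False
        then have "card S = 1" using S \<open>finite S\<close> by (metis One_nat_def Suc_1 card_0_eq le_SucE not_less_eq_eq le_zero_eq)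
        then obtain i where "S = {i}" by (metis card_1_singletonE)
        then show ?thesis using S unfolding B_Gamma_def by auto
      qed
    qed
  qed
  show "building_set {1..n+1} (B_Gamma n)"
    unfolding building_set_def by (auto simp: char)
  show "{1..n+1} \<in> B_Gamma n" unfolding char by auto
qed

lemma building_set_B_P:
  assumes "n \<ge> 2" shows "building_set {1..n+1} (B_P n)" "{1..n+1} \<in> B_P n"
proof -
  have char: "S \<in> B_P n \<longleftrightarrow> S \<noteq> {} \<and> S \<subseteq> {1..n+1} \<and>
      ((\<exists>i. S = {i}) \<or> 1 \<in> S \<and> (n + 1 \<in> S \<longrightarrow> 2 \<in> S))" for S
  proof
    assume "S \<in> B_P n"
    then show "S \<noteq> {} \<and> S \<subseteq> {1..n+1} \<and> ((\<exists>i. S = {i}) \<or> 1 \<in> S \<and> (n + 1 \<in> S \<longrightarrow> 2 \<in> S))"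
      using assms unfolding B_P_def by fastforce
  next
    assume S: "S \<noteq> {} \<and> S \<subseteq> {1..n+1} \<and> ((\<exists>i. S = {i}) \<or> 1 \<in> S \<and> (n + 1 \<in> S \<longrightarrow> 2 \<in> S))"
    have ge3: "i \<ge> 3" if "i \<in> S" "i \<noteq> 1" "i \<noteq> 2" for i
    proof -
      have "i \<ge> 1" using S that by auto
      then show ?thesis using that by linarith
    qed
    show "S \<in> B_P n"
    proof (cases "\<exists>i. S = {i}")
      case True then show ?thesis using S unfolding B_P_def by auto
    next
      case False
      then have 1: "1 \<in> S" "n + 1 \<in> S \<longrightarrow> 2 \<in> S" using S by auto
      show ?thesis
      proof (cases "2 \<in> S")
        case True
        then have "S = {1, 2} \<union> (S - {1, 2})" using 1 by auto
        moreover have "S - {1, 2} \<subseteq> {3..n+1}" using S ge3 by auto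
        ultimately show ?thesis unfolding B_P_def by blast
      next
        case F: False
        have "i \<le> n" if "i \<in> S" for i
        proof -
          have "i \<noteq> n + 1" "i \<le> n + 1" using 1 F S that by auto
          then show ?thesis by linarith
        qed
        then have "S - {1} \<subseteq> {3..n}" using F ge3 by (metis DiffE atLeastAtMost_iff insertI1 subsetI)
        moreover have "S = {1} \<union> (S - {1})" using 1 by auto
        moreover have "S - {1} \<noteq> {}" using 1 False by blast
        ultimately show ?thesis unfolding B_P_def by blast
      qed
    qed
  qed
  show "building_set {1..n+1} (B_P n)"
    unfolding building_set_def
  proof (intro conjI ballI impI)
    fix S T assume ST: "S \<in> B_P n" "T \<in> B_P n" "S \<inter> T \<noteq> {}"
    show "S \<union> T \<in> B_P n"
    proof (cases "(\<exists>i. S = {i}) \<or> (\<exists>i. T = {i})")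
      case True
      then have "S \<union> T = S \<or> S \<union> T = T" using ST(3) by auto
      then show ?thesis using ST by auto
    next
      case False
      then show ?thesis using ST unfolding char by blast
    qed
  qed (auto simp: char)
  show "{1..n+1} \<in> B_P n" unfolding char using assms by auto
qed

section \<open>Generating series\<close>

text \<open>
  The series \<open>\<Sum>\<^sub>s c\<^sub>s T\<^sub>s x\<^bsup>s+e\<^esup>\<close> and its two-parameter extension. In \<^typ>\<open>rat_polytope_ring fps fps\<close>
  the outer variable is \<open>x\<close> and the inner one is \<open>q\<close>.
\<close>

definition gen_series :: "nat \<Rightarrow> (nat \<Rightarrow> rat) \<Rightarrow> (nat \<Rightarrow> simple_type) \<Rightarrow> rat_polytope_ring fps"
  where "gen_series e c T = Abs_fps (\<lambda>m. if m < e then 0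
    else rat_scalar (c (m - e)) * to_rat (frag_of (T (m - e))))"

definition gen_series2 :: "nat \<Rightarrow> (nat \<Rightarrow> rat) \<Rightarrow> (nat \<Rightarrow> simple_type) \<Rightarrow> rat_polytope_ring fps fps"
  where "gen_series2 e c T = Abs_fps (\<lambda>m. if m < e then 0
    else fps_const (rat_scalar (c (m - e))) * pol_Q (T (m - e)))"

definition P_Gamma_series :: "rat_polytope_ring fps"
  where "P_Gamma_series = gen_series 0 (\<lambda>s. 1 / fact s) (\<lambda>s. P_Gamma (s + 1))"

definition P_Mas_series :: "rat_polytope_ring fps"
  where "P_Mas_series = gen_series 2 (\<lambda>s. 1 / fact s) (\<lambda>s. P_Mas (s + 2))"

definition Pe_series2 :: "rat_polytope_ring fps fps"
  where "Pe_series2 = gen_series2 1 (\<lambda>s. 1 / fact (s + 1)) Pe"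

definition St_series2 :: "rat_polytope_ring fps fps"
  where "St_series2 = gen_series2 0 (\<lambda>s. 1 / fact s) St"

definition P_Gamma_series2 :: "rat_polytope_ring fps fps"
  where "P_Gamma_series2 = gen_series2 0 (\<lambda>s. 1 / fact s) (\<lambda>s. P_Gamma (s + 1))"

definition P_Mas_series2 :: "rat_polytope_ring fps fps"
  where "P_Mas_series2 = gen_series2 2 (\<lambda>s. 1 / fact s) (\<lambda>s. P_Mas (s + 2))"

definition deriv_x :: "'a::comm_semiring_1 fps fps \<Rightarrow> 'a fps fps"
  where "deriv_x = fps_deriv"

definition deriv_q :: "'a::comm_semiring_1 fps fps \<Rightarrow> 'a fps fps"
  where "deriv_q F = Abs_fps (\<lambda>m. fps_deriv (fps_nth F m))"

definition at_q0 :: "'a::zero fps fps \<Rightarrow> 'a fps"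
  where "at_q0 F = Abs_fps (\<lambda>m. fps_nth (fps_nth F m) 0)"

end

theory Submission
  imports Defs
begin

text \<open>
  The differential equations are facet recurrences in disguise. Since \<open>Q(P;q) = exp(q d) P\<close> and \<open>d\<close> is
  a derivation, \<open>Q\<close> is multiplicative and \<open>\<partial>/\<partial>q\<close> acts on it as \<open>d\<close>. The facets of the nestohedron of
  a connected building set \<open>B\<close> on \<open>V\<close> correspond to the \<open>S \<in> B - {V}\<close>, the facet of \<open>S\<close> having the
  type of the product of the nestohedra of the restriction to \<open>S\<close> and of the contraction by \<open>S\<close>. For
  the two families these are again permutohedra, stellahedra or members of the families, and
  summing over all subsets of a given size turns the recurrences into products of exponential
  generating functions.

  Everything about nestohedra is read off from the face lattice, which is the poset of nested sets
  ordered by reverse inclusion: the face of \<open>N\<close> consists of the points whose coordinate sum over each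
  \<open>S \<in> N\<close> is minimal.
\<close>

section \<open>Faces of a nestohedron\<close>

text \<open>Two obstacles shape the proof. First, \<open>pol_d\<close> and \<open>type_dim\<close>
  are computed on an arbitrarily chosen representative of a type, and \<open>pol_Q\<close> is cut
  off at the dimension of that representative. So the dimension must be recoverable from the face
  poset. For simple polytopes it is: it counts the facets through a vertex. This is why simplicity,
  existence of vertices and the dimension of nestohedra come before any algebra; the cut-off then
  disappears because high powers of \<open>d\<close> vanish. Second, the Leibniz rule can be
  iterated only if every facet that occurs again has a type. Facets of nestohedra are controlled
  only up to combinatorial equivalence with products of nestohedra, so the calculus takes place in
  the additive span of the types of such products, which is stable under multiplication and
  \<open>d\<close>. The families are restated over arbitrary ground sets with marked elements, since
  restrictions and contractions do not live on an initial interval. Classifying \<open>S\<close> by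
  the marked elements it contains yields the terms of the equations; the unmarked elements split
  freely, whence binomial convolutions.\<close>

definition unit_simplex :: "'v set \<Rightarrow> ('v \<Rightarrow>\<^sub>0 real) set"
  where "unit_simplex S = {x. (\<forall>i. 0 \<le> Poly_Mapping.lookup x i) \<and> Poly_Mapping.keys x \<subseteq> S \<and>
    (\<Sum>i\<in>S. Poly_Mapping.lookup x i) = 1}"

section \<open>Supports and coordinate sums of points of a simplex\<close>

definition mass :: "('v \<Rightarrow>\<^sub>0 real) \<Rightarrow> 'v set \<Rightarrow> real"
  where "mass x S = (\<Sum>i\<in>S. Poly_Mapping.lookup x i)"

lemma lookup_sum_poly: "Poly_Mapping.lookup (\<Sum>a\<in>A. f a) i = (\<Sum>a\<in>A. Poly_Mapping.lookup (f a) i)"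
  by (induction A rule: infinite_finite_induct) (simp_all add: lookup_add)

lemma mass_add: "mass (x + y) S = mass x S + mass y S"
  by (simp add: mass_def lookup_add sum.distrib)

lemma mass_scaleR: "mass (c *\<^sub>R x) S = c * mass x S"
  by (simp add: mass_def lookup_scaleR sum_distrib_left)

lemma mass_sum: "mass (\<Sum>a\<in>A. f a) S = (\<Sum>a\<in>A. mass (f a) S)"
  unfolding mass_def lookup_sum_poly by (rule sum.swap)

lemma poly_mapping_expansion:
  assumes "finite S" "Poly_Mapping.keys x \<subseteq> S"
  shows "(x :: 'v \<Rightarrow>\<^sub>0 real) = (\<Sum>i\<in>S. Poly_Mapping.lookup x i *\<^sub>R Poly_Mapping.single i 1)"
proof (rule poly_mapping_eqI)
  fix k
  have "(\<Sum>i\<in>S. Poly_Mapping.lookup x i * Poly_Mapping.lookup (Poly_Mapping.single i 1) k)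
      = (\<Sum>i\<in>S. if k = i then Poly_Mapping.lookup x i else 0)"
    by (intro sum.cong) (auto simp: lookup_single when_def)
  also have "\<dots> = Poly_Mapping.lookup x k"
    using assms by (auto simp: in_keys_iff)
  finally show "Poly_Mapping.lookup x k =
      Poly_Mapping.lookup (\<Sum>i\<in>S. Poly_Mapping.lookup x i *\<^sub>R Poly_Mapping.single i 1) k"
    by (simp add: lookup_sum_poly lookup_scaleR)
qed

lemma simplex_nonneg: "x \<in> unit_simplex S \<Longrightarrow> 0 \<le> Poly_Mapping.lookup x i"
  by (simp add: unit_simplex_def)

lemma simplex_keys: "x \<in> unit_simplex S \<Longrightarrow> Poly_Mapping.keys x \<subseteq> S"
  by (simp add: unit_simplex_def)

text \<open>A sum over an infinite set defaults to 0, which cannot equal 1; infinite index sets thus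
  give the empty simplex.\<close>

lemma simplex_finite:
  assumes "x \<in> unit_simplex S" shows "finite S"
  using assms sum.infinite[of S "Poly_Mapping.lookup x"] unfolding unit_simplex_def by force

lemma simplex_le_1:
  assumes "x \<in> unit_simplex S" shows "Poly_Mapping.lookup x i \<le> 1"
proof (cases "i \<in> S")
  case True
  have "Poly_Mapping.lookup x i \<le> (\<Sum>i\<in>S. Poly_Mapping.lookup x i)"
    using True assms simplex_finite by (intro member_le_sum) (auto simp: unit_simplex_def)
  then show ?thesis using assms by (simp add: unit_simplex_def)
next
  case False
  then have "Poly_Mapping.lookup x i = 0" using simplex_keys[OF assms] by (auto simp: in_keys_iff)
  then show ?thesis by simp
qed

lemma simplex_keys_nonempty:
  assumes "x \<in> unit_simplex S" shows "Poly_Mapping.keys x \<noteq> {}"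
  using assms by (auto simp: unit_simplex_def)

text \<open>Passing to a face of a simplex is purely a condition on the support. All later
  descriptions of faces rest on this.\<close>

lemma simplex_iff_mono:
  assumes "finite T" "S \<subseteq> T"
  shows "x \<in> unit_simplex S \<longleftrightarrow> x \<in> unit_simplex T \<and> Poly_Mapping.keys x \<subseteq> S"
proof -
  have "(\<Sum>i\<in>T. Poly_Mapping.lookup x i) = (\<Sum>i\<in>S. Poly_Mapping.lookup x i)"
    if "Poly_Mapping.keys x \<subseteq> S"
    using assms that by (intro sum.mono_neutral_right) (auto simp: in_keys_iff)
  then show ?thesis using assms unfolding unit_simplex_def by auto
qed

lemma convex_simplex: "convex (unit_simplex S)"
proof (rule convexI)
  fix x y :: "'a \<Rightarrow>\<^sub>0 real" and u v :: real
  assume xy: "x \<in> unit_simplex S" "y \<in> unit_simplex S" and uv: "0 \<le> u" "0 \<le> v" "u + v = 1"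
  have "Poly_Mapping.keys (u *\<^sub>R x + v *\<^sub>R y) \<subseteq> S"
  proof
    fix i assume "i \<in> Poly_Mapping.keys (u *\<^sub>R x + v *\<^sub>R y)"
    then have "i \<in> Poly_Mapping.keys x \<or> i \<in> Poly_Mapping.keys y"
      by (auto simp: in_keys_iff lookup_add lookup_scaleR)
    then show "i \<in> S" using xy simplex_keys by blast
  qed
  moreover have "(\<Sum>i\<in>S. Poly_Mapping.lookup (u *\<^sub>R x + v *\<^sub>R y) i) = u * 1 + v * 1"
    using xy by (simp add: unit_simplex_def lookup_add lookup_scaleR sum.distrib sum_distrib_left[symmetric])
  ultimately show "u *\<^sub>R x + v *\<^sub>R y \<in> unit_simplex S"
    using xy uv by (simp add: unit_simplex_def lookup_add lookup_scaleR)
qed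

lemma convex_hull_simplex:
  fixes S :: "'v set"
  assumes "finite S"
  shows "convex hull ((\<lambda>i. Poly_Mapping.single i 1) ` S) = unit_simplex S"
proof
  show "convex hull ((\<lambda>i. Poly_Mapping.single i 1) ` S) \<subseteq> unit_simplex S"
  proof (rule hull_minimal)
    show "(\<lambda>i. Poly_Mapping.single i 1) ` S \<subseteq> unit_simplex S"
      using assms by (auto simp: unit_simplex_def lookup_single when_def)
  qed (rule convex_simplex)
  show "unit_simplex S \<subseteq> convex hull ((\<lambda>i. Poly_Mapping.single i 1) ` S)"
  proof
    fix x :: "'v \<Rightarrow>\<^sub>0 real" assume x: "x \<in> unit_simplex S"
    have "(\<Sum>i\<in>S. Poly_Mapping.lookup x i *\<^sub>R Poly_Mapping.single i (1::real))
        \<in> convex hull ((\<lambda>i. Poly_Mapping.single i 1) ` S)"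
      using x assms by (intro convex_sum) (auto simp: unit_simplex_def intro: hull_inc)
    then show "x \<in> convex hull ((\<lambda>i. Poly_Mapping.single i 1) ` S)"
      using poly_mapping_expansion[OF assms simplex_keys[OF x]] by simp
  qed
qed

lemma mass_simplex_sup:
  assumes "y \<in> unit_simplex T" "T \<subseteq> S" "finite S"
  shows "mass y S = 1"
proof -
  have "y \<in> unit_simplex S" using simplex_iff_mono[OF assms(3,2)] assms(1) by blast
  then show ?thesis by (simp add: mass_def unit_simplex_def)
qed

lemma mass_simplex_nonneg: "y \<in> unit_simplex T \<Longrightarrow> 0 \<le> mass y S"
  unfolding mass_def by (intro sum_nonneg) (simp add: unit_simplex_def)

lemma mass_simplex_eq_0:
  assumes "y \<in> unit_simplex T" "finite S"
  shows "mass y S = 0 \<longleftrightarrow> Poly_Mapping.keys y \<inter> S = {}"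
  unfolding mass_def using assms
  by (subst sum_nonneg_eq_0_iff) (auto simp: unit_simplex_def in_keys_iff)

text \<open>A canonical point of full support, that is, in the relative interior of the
  simplex.\<close>

definition bary :: "'v set \<Rightarrow> ('v \<Rightarrow>\<^sub>0 real)"
  where "bary S = (\<Sum>i\<in>S. (1 / real (card S)) *\<^sub>R Poly_Mapping.single i 1)"

lemma lookup_bary:
  assumes "finite S"
  shows "Poly_Mapping.lookup (bary S) i = (if i \<in> S then 1 / real (card S) else 0)"
proof -
  have "Poly_Mapping.lookup (bary S) i = (\<Sum>k\<in>S. if i = k then 1 / real (card S) else 0)"
    unfolding bary_def lookup_sum_poly lookup_scaleR
    by (intro sum.cong) (auto simp: lookup_single when_def)
  then show ?thesis using assms by simp
qed

lemma bary_simplex: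
  assumes "finite S" "S \<noteq> {}"
  shows "bary S \<in> unit_simplex S" "Poly_Mapping.keys (bary S) = S"
proof -
  show keys: "Poly_Mapping.keys (bary S) = S"
    unfolding set_eq_iff in_keys_iff lookup_bary[OF assms(1)] using assms by simp
  have "(\<Sum>i\<in>S. Poly_Mapping.lookup (bary S) i) = 1"
    using assms by (simp add: lookup_bary)
  then show "bary S \<in> unit_simplex S"
    using assms keys by (simp add: unit_simplex_def lookup_bary)
qed

lemma simplex_shift:
  assumes "y \<in> unit_simplex T" "i \<in> T" "j \<in> T" "0 \<le> d" "d \<le> Poly_Mapping.lookup y i"
  shows "y + d *\<^sub>R (Poly_Mapping.single j 1 - Poly_Mapping.single i 1) \<in> unit_simplex T"
proof -
  have fin: "finite T" by (rule simplex_finite[OF assms(1)])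
  let ?z = "y + d *\<^sub>R (Poly_Mapping.single j 1 - Poly_Mapping.single i 1)"
  have lz: "Poly_Mapping.lookup ?z k = Poly_Mapping.lookup y k + d * ((if k = j then 1 else 0) - (if k = i then 1 else 0))" for k
    by (simp add: lookup_add lookup_scaleR lookup_minus lookup_single when_def)
  have "(\<Sum>k\<in>T. Poly_Mapping.lookup ?z k) = 1"
    unfolding lz using assms fin
    by (simp add: sum.distrib sum_distrib_left[symmetric] sum_subtractf unit_simplex_def)
  moreover have "0 \<le> Poly_Mapping.lookup ?z k" for k
    using assms simplex_nonneg[OF assms(1), of k] unfolding lz by auto
  moreover have "Poly_Mapping.keys ?z \<subseteq> T"
    using assms simplex_keys[OF assms(1)] by (auto simp: in_keys_iff lz subset_iff split: if_splits)
  ultimately show ?thesis by (simp add: unit_simplex_def)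
qed

lemma is_facetI:
  "F face_of P \<Longrightarrow> F \<noteq> {} \<Longrightarrow> F \<noteq> P \<Longrightarrow>
    (\<And>G. G face_of P \<Longrightarrow> F \<subseteq> G \<Longrightarrow> G \<noteq> P \<Longrightarrow> G = F) \<Longrightarrow> is_facet F P"
  unfolding is_facet_def by blast

text \<open>
  The nested sets of a building set here contain its maximal element \<open>V\<close>. The condition on unions
  says at once that two members are disjoint or comparable, and that no union of at least two
  pairwise disjoint members lies in the building set.
\<close>

definition nested :: "'v set \<Rightarrow> 'v set set \<Rightarrow> 'v set set \<Rightarrow> bool"
  where "nested V B N \<longleftrightarrow> N \<subseteq> B \<and> V \<in> N \<and> (\<forall>M\<subseteq>N. M \<noteq> {} \<longrightarrow> \<Union>M \<in> B \<longrightarrow> \<Union>M \<in> M)"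

lemma nested_subset: "nested V B N \<Longrightarrow> N \<subseteq> B" and nested_top: "nested V B N \<Longrightarrow> V \<in> N"
  unfolding nested_def by blast+

lemma nestedD: "nested V B N \<Longrightarrow> M \<subseteq> N \<Longrightarrow> M \<noteq> {} \<Longrightarrow> \<Union>M \<in> B \<Longrightarrow> \<Union>M \<in> M"
  unfolding nested_def by blast

text \<open>One format for a nestohedron and for all its faces: the index set stays
  \<open>B\<close>, and only the simplex \<open>c T\<close> used for the summand \<open>T\<close>
  shrinks.\<close>

definition msum :: "'v set set \<Rightarrow> ('v set \<Rightarrow> 'v set) \<Rightarrow> ('v \<Rightarrow>\<^sub>0 real) set"
  where "msum B c = {\<Sum>T\<in>B. y T |y. \<forall>T\<in>B. y T \<in> unit_simplex (c T)}"

lemma msumI: "(\<And>T. T \<in> B \<Longrightarrow> y T \<in> unit_simplex (c T)) \<Longrightarrow> (\<Sum>T\<in>B. y T) \<in> msum B c"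
  unfolding msum_def by blast

lemma msumE:
  assumes "x \<in> msum B c"
  obtains y where "x = (\<Sum>T\<in>B. y T)" "\<And>T. T \<in> B \<Longrightarrow> y T \<in> unit_simplex (c T)"
  using assms unfolding msum_def by blast

lemma convex_msum: "convex (msum B c)"
proof (rule convexI)
  fix x y :: "'a \<Rightarrow>\<^sub>0 real" and u v :: real
  assume xy: "x \<in> msum B c" "y \<in> msum B c" and uv: "0 \<le> u" "0 \<le> v" "u + v = 1"
  obtain a where a: "x = (\<Sum>T\<in>B. a T)" "\<And>T. T \<in> B \<Longrightarrow> a T \<in> unit_simplex (c T)" using xy(1) by (rule msumE) blast
  obtain b where b: "y = (\<Sum>T\<in>B. b T)" "\<And>T. T \<in> B \<Longrightarrow> b T \<in> unit_simplex (c T)" using xy(2) by (rule msumE) blast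
  have "u *\<^sub>R x + v *\<^sub>R y = (\<Sum>T\<in>B. u *\<^sub>R a T + v *\<^sub>R b T)"
    unfolding a b by (simp add: scaleR_sum_right sum.distrib)
  also have "\<dots> \<in> msum B c"
    using a b uv by (intro msumI convexD[OF convex_simplex]) auto
  finally show "u *\<^sub>R x + v *\<^sub>R y \<in> msum B c" .
qed

lemma msum_eq_sum:
  assumes "finite B" shows "msum B c = (\<Sum>T\<in>B. unit_simplex (c T))"
  using set_sum_alt[OF assms, of "\<lambda>T. unit_simplex (c T)"] unfolding msum_def by auto

lemma polytope_set_plus:
  fixes P Q :: "'a::real_vector set"
  assumes "polytope P" "polytope Q" shows "polytope (P + Q)"
proof -
  obtain v w where vw: "finite v" "P = convex hull v" "finite w" "Q = convex hull w"
    using assms unfolding polytope_def by blast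
  have "P + Q = convex hull (v + w)" using vw by (simp add: convex_hull_set_plus)
  moreover have "finite (v + w)" using vw by (simp add: finite_set_plus)
  ultimately show ?thesis unfolding polytope_def by blast
qed

lemma polytope_sum:
  fixes P :: "'b \<Rightarrow> 'a::real_vector set"
  assumes "finite I" "\<And>i. i \<in> I \<Longrightarrow> polytope (P i)"
  shows "polytope (\<Sum>i\<in>I. P i)"
  using assms
proof (induction I rule: finite_induct)
  case empty
  have "polytope {0::'a}" unfolding polytope_def by (intro exI[of _ "{0}"]) simp
  then show ?case by simp
qed (simp add: polytope_set_plus)

lemma polytope_msum:
  assumes "finite B" "\<And>T. T \<in> B \<Longrightarrow> finite (c T)"
  shows "polytope (msum B c)"
  unfolding msum_eq_sum[OF assms(1)]
proof (rule polytope_sum)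
  fix T assume "T \<in> B"
  then show "polytope (unit_simplex (c T))"
    using assms(2) convex_hull_simplex[of "c T"] unfolding polytope_def
    by (intro exI[of _ "(\<lambda>i. Poly_Mapping.single i 1) ` c T"]) auto
qed (rule assms(1))

section \<open>Faces of a nestohedron as sets of tight inequalities\<close>

locale connected_building_set =
  fixes V :: "'v set" and B :: "'v set set"
  assumes building: "building_set V B" and V_in: "V \<in> B"
begin

lemma finite_V: "finite V" and V_nonempty: "V \<noteq> {}"
  using building unfolding building_set_def by auto

lemma B_subset: "S \<in> B \<Longrightarrow> S \<subseteq> V" and B_nonempty: "S \<in> B \<Longrightarrow> S \<noteq> {}"
  using building unfolding building_set_def by auto

lemma B_singleton: "i \<in> V \<Longrightarrow> {i} \<in> B"
  using building unfolding building_set_def by auto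

lemma B_Un: "S \<in> B \<Longrightarrow> T \<in> B \<Longrightarrow> S \<inter> T \<noteq> {} \<Longrightarrow> S \<union> T \<in> B"
  using building unfolding building_set_def by blast

lemma B_finite: "S \<in> B \<Longrightarrow> finite S"
  using B_subset finite_V finite_subset by blast

lemma finite_B: "finite B"
  using B_subset finite_V finite_subset[of B "Pow V"] by blast

text \<open>The set \<open>T\<close> acts as glue: members of \<open>M\<close> may be disjoint from
  each other, but each can be joined to the growing union through \<open>T\<close>.\<close>

lemma B_Union:
  assumes "M \<subseteq> B" "T \<in> B" "\<And>S. S \<in> M \<Longrightarrow> S \<inter> T \<noteq> {}"
  shows "T \<union> \<Union>M \<in> B"
proof -
  have "finite M" using assms(1) finite_B finite_subset by blast
  then show ?thesis using assms(1,3)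
  proof (induction M rule: finite_induct)
    case empty then show ?case using assms(2) by simp
  next
    case (insert S M)
    have "T \<union> \<Union>M \<in> B" using insert.prems by (intro insert.IH) auto
    moreover have "S \<in> B" using insert.prems by simp
    moreover have "(T \<union> \<Union>M) \<inter> S \<noteq> {}" using insert.prems(2)[of S] by blast
    ultimately have "T \<union> \<Union>M \<union> S \<in> B" by (rule B_Un)
    then show ?case by (simp add: Un_ac)
  qed
qed

abbreviation P :: "('v \<Rightarrow>\<^sub>0 real) set"
  where "P \<equiv> msum B (\<lambda>T. T)"

lemma nestohedron_eq: "nestohedron B = P"
  unfolding nestohedron_def msum_eq_sum[OF finite_B]
  by (intro sum.cong) (simp_all add: convex_hull_simplex B_finite)

text \<open>The smallest coordinate sum over \<open>S\<close> that is possible: a summand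
  \<open>T\<close> inside \<open>S\<close> has all its mass there and contributes exactly 1, any
  other summand contributes at least 0.\<close>

definition low :: "'v set \<Rightarrow> real"
  where "low S = real (card {T\<in>B. T \<subseteq> S})"

lemma mass_decomp:
  assumes y: "\<And>T. T \<in> B \<Longrightarrow> y T \<in> unit_simplex T" and S: "S \<in> B"
  shows "low S \<le> mass (\<Sum>T\<in>B. y T) S"
    and "mass (\<Sum>T\<in>B. y T) S = low S \<longleftrightarrow>
      (\<forall>T\<in>B. \<not> T \<subseteq> S \<longrightarrow> Poly_Mapping.keys (y T) \<inter> S = {})"
proof -
  let ?A = "{T\<in>B. T \<subseteq> S}" and ?C = "{T\<in>B. \<not> T \<subseteq> S}"
  have finS: "finite S" using S B_finite by blast
  have "(\<Sum>T\<in>B. mass (y T) S) = (\<Sum>T\<in>?A \<union> ?C. mass (y T) S)" by (intro sum.cong) auto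
  also have "\<dots> = (\<Sum>T\<in>?A. mass (y T) S) + (\<Sum>T\<in>?C. mass (y T) S)"
    using finite_B by (intro sum.union_disjoint) auto
  also have "(\<Sum>T\<in>?A. mass (y T) S) = (\<Sum>T\<in>?A. 1)"
    using y finS by (intro sum.cong) (auto intro: mass_simplex_sup)
  finally have eq: "mass (\<Sum>T\<in>B. y T) S = low S + (\<Sum>T\<in>?C. mass (y T) S)"
    by (simp add: mass_sum low_def)
  have nn: "\<And>T. T \<in> ?C \<Longrightarrow> 0 \<le> mass (y T) S" using y mass_simplex_nonneg by blast
  show "low S \<le> mass (\<Sum>T\<in>B. y T) S" unfolding eq using sum_nonneg[of ?C "\<lambda>T. mass (y T) S", OF nn] by linarith
  have "mass (\<Sum>T\<in>B. y T) S = low S \<longleftrightarrow> (\<forall>T\<in>?C. mass (y T) S = 0)"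
    unfolding eq using sum_nonneg_eq_0_iff[of ?C "\<lambda>T. mass (y T) S", OF _ nn] finite_B by simp
  also have "\<dots> \<longleftrightarrow> (\<forall>T\<in>B. \<not> T \<subseteq> S \<longrightarrow> Poly_Mapping.keys (y T) \<inter> S = {})"
    using mass_simplex_eq_0[OF y finS] by auto
  finally show "mass (\<Sum>T\<in>B. y T) S = low S \<longleftrightarrow>
      (\<forall>T\<in>B. \<not> T \<subseteq> S \<longrightarrow> Poly_Mapping.keys (y T) \<inter> S = {})" .
qed

lemma low_le_mass:
  assumes "x \<in> P" "S \<in> B" shows "low S \<le> mass x S"
  using assms(1) mass_decomp(1)[OF _ assms(2)] by (auto elim!: msumE)

definition F :: "'v set set \<Rightarrow> ('v \<Rightarrow>\<^sub>0 real) set"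
  where "F N = {x \<in> P. \<forall>S\<in>N. mass x S = low S}"

text \<open>Tightness at \<open>S\<close> forbids every summand not contained in \<open>S\<close> to
  put mass on \<open>S\<close>. What these conditions leave of \<open>T\<close> is the simplex
  available to its summand on the face of \<open>N\<close>.\<close>

definition c :: "'v set set \<Rightarrow> 'v set \<Rightarrow> 'v set"
  where "c N T = T - \<Union>{S\<in>N. \<not> T \<subseteq> S}"

lemma c_subset: "c N T \<subseteq> T"
  by (auto simp: c_def)

text \<open>Decompositions of a point are not unique, but by \<open>mass_decomp\<close> tightness
  can be tested on any one of them.\<close>

lemma F_decomp:
  assumes N: "N \<subseteq> B" and y: "\<And>T. T \<in> B \<Longrightarrow> y T \<in> unit_simplex T"
  shows "(\<Sum>T\<in>B. y T) \<in> F N \<longleftrightarrow> (\<forall>T\<in>B. y T \<in> unit_simplex (c N T))"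
proof -
  have 1: "(\<Sum>T\<in>B. y T) \<in> P" using y by (rule msumI)
  have "(\<forall>S\<in>N. mass (\<Sum>T\<in>B. y T) S = low S) \<longleftrightarrow>
    (\<forall>S\<in>N. \<forall>T\<in>B. \<not> T \<subseteq> S \<longrightarrow> Poly_Mapping.keys (y T) \<inter> S = {})"
    using N by (intro ball_cong refl mass_decomp(2) y) auto
  also have "\<dots> \<longleftrightarrow> (\<forall>T\<in>B. Poly_Mapping.keys (y T) \<subseteq> c N T)"
    unfolding c_def using y simplex_keys by blast
  also have "\<dots> \<longleftrightarrow> (\<forall>T\<in>B. y T \<in> unit_simplex (c N T))"
    using y simplex_iff_mono[OF B_finite c_subset] by blast
  finally show ?thesis using 1 unfolding F_def by blast
qed

lemma F_eq:
  assumes N: "N \<subseteq> B" shows "F N = msum B (c N)"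
proof
  show "F N \<subseteq> msum B (c N)"
  proof
    fix x assume x: "x \<in> F N"
    then have "x \<in> P" unfolding F_def by blast
    then obtain y where y: "x = (\<Sum>T\<in>B. y T)" "\<And>T. T \<in> B \<Longrightarrow> y T \<in> unit_simplex T" by (rule msumE) blast
    then show "x \<in> msum B (c N)" using x F_decomp[OF N, of y] msumI[of B y "c N"] by blast
  qed
  show "msum B (c N) \<subseteq> F N"
  proof
    fix x assume "x \<in> msum B (c N)"
    then obtain y where y: "x = (\<Sum>T\<in>B. y T)" "\<And>T. T \<in> B \<Longrightarrow> y T \<in> unit_simplex (c N T)" by (rule msumE) blast
    then have "\<And>T. T \<in> B \<Longrightarrow> y T \<in> unit_simplex T" using simplex_iff_mono[OF B_finite c_subset] by blast
    then show "x \<in> F N" using y F_decomp[OF N, of y] by blast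
  qed
qed

lemma F_face:
  assumes N: "N \<subseteq> B" shows "F N face_of P"
  unfolding face_of_def
proof (intro conjI ballI impI)
  show "F N \<subseteq> P" unfolding F_def by blast
  show "convex (F N)" unfolding F_eq[OF N] by (rule convex_msum)
  fix a b x assume ab: "a \<in> P" "b \<in> P" and x: "x \<in> F N" "x \<in> open_segment a b"
  obtain u where u: "0 < u" "u < 1" "x = (1 - u) *\<^sub>R a + u *\<^sub>R b"
    using x(2) by (auto simp: in_segment)
  have "mass a S = low S \<and> mass b S = low S" if S: "S \<in> N" for S
  proof -
    have le: "low S \<le> mass a S" "low S \<le> mass b S" using ab S N low_le_mass by blast+
    have "low S = (1 - u) * mass a S + u * mass b S"
      using x(1) S unfolding F_def u(3) by (simp add: mass_add mass_scaleR)
    then have "(1 - u) * (mass a S - low S) + u * (mass b S - low S) = 0" by algebra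
    moreover have "0 \<le> (1 - u) * (mass a S - low S)" "0 \<le> u * (mass b S - low S)"
      using u le by auto
    ultimately have "(1 - u) * (mass a S - low S) = 0" "u * (mass b S - low S) = 0" by linarith+
    then show ?thesis using u by auto
  qed
  then show "a \<in> F N" "b \<in> F N" using ab unfolding F_def by auto
qed

text \<open>If members of \<open>N\<close> not containing \<open>T\<close> covered \<open>T\<close>,
  those meeting \<open>T\<close> would be glued by \<open>T\<close> to a union in \<open>B\<close>.
  Nestedness makes this union one of them, and that one contains \<open>T\<close>.\<close>

lemma c_nonempty:
  assumes N: "nested V B N" and T: "T \<in> B" shows "c N T \<noteq> {}"
proof
  assume e: "c N T = {}"
  let ?M = "{S\<in>N. \<not> T \<subseteq> S \<and> S \<inter> T \<noteq> {}}"
  have sub: "T \<subseteq> \<Union>?M" using e unfolding c_def by blast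
  have MN: "?M \<subseteq> N" "?M \<subseteq> B" using nested_subset[OF N] by auto
  have ne: "?M \<noteq> {}" using sub B_nonempty[OF T] by blast
  have "T \<union> \<Union>?M \<in> B" using MN(2) T by (rule B_Union) blast
  moreover have "T \<union> \<Union>?M = \<Union>?M" using sub by blast
  ultimately have "\<Union>?M \<in> ?M" using nestedD[OF N MN(1) ne] by simp
  then show False using sub by blast
qed

lemma nested_cases:
  assumes N: "nested V B N" and S: "S \<in> N" "T \<in> N"
  shows "S \<subseteq> T \<or> T \<subseteq> S \<or> S \<inter> T = {}"
proof (cases "S \<inter> T = {}")
  case False
  have "S \<union> T \<in> B" using B_Un False nested_subset[OF N] S by blast
  then have "\<Union>{S, T} \<in> {S, T}" using S by (intro nestedD[OF N]) auto
  then show ?thesis by auto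
qed simp

lemma finite_c: "T \<in> B \<Longrightarrow> finite (c N T)"
  by (rule finite_subset[OF c_subset B_finite])

text \<open>A point of the face of \<open>N\<close> whose summands all have the largest supports
  allowed there, so that it satisfies no accidental equations.\<close>

definition centre :: "'v set set \<Rightarrow> ('v \<Rightarrow>\<^sub>0 real)"
  where "centre N = (\<Sum>T\<in>B. bary (c N T))"

lemma centre_in_F:
  assumes N: "nested V B N" shows "centre N \<in> F N"
proof -
  have "N \<subseteq> B" by (rule nested_subset[OF N])
  then show ?thesis unfolding F_eq[OF \<open>N \<subseteq> B\<close>] centre_def
    using c_nonempty[OF N] finite_c by (intro msumI bary_simplex) auto
qed

lemma smallest_above:
  assumes N: "nested V B N" and S: "S \<in> B"
  obtains R where "R \<in> N" "S \<subseteq> R" "\<And>R'. R' \<in> N \<Longrightarrow> S \<subseteq> R' \<Longrightarrow> R \<subseteq> R'"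
proof -
  have "V \<in> N \<and> S \<subseteq> V"
    using nested_top[OF N] B_subset[OF S] by blast
  then obtain R where R: "R \<in> N" "S \<subseteq> R" "\<And>R'. R' \<in> N \<Longrightarrow> S \<subseteq> R' \<Longrightarrow> card R \<le> card R'"
    using ex_has_least_nat[of "\<lambda>R. R \<in> N \<and> S \<subseteq> R" V card] by metis
  have "R \<subseteq> R'" if R': "R' \<in> N" "S \<subseteq> R'" for R'
  proof (rule ccontr)
    assume n: "\<not> R \<subseteq> R'"
    then have "R' \<subset> R" using nested_cases[OF N R(1) R'(1)] R R' B_nonempty[OF S] by blast
    moreover have "finite R" using R nested_subset[OF N] B_finite by blast
    ultimately show False using R(3)[OF R'] psubset_card_mono[of R R'] by simp
  qed
  with R show thesis using that by blast
qed

text \<open>This recovers \<open>N\<close> from its face. Let \<open>R\<close> be the smallest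
  member of \<open>N\<close> containing \<open>S\<close>. If \<open>S\<close> were tight without
  being \<open>R\<close>, the support \<open>c N R\<close> would avoid \<open>S\<close>, so members
  of \<open>N\<close> not containing \<open>R\<close> would cover \<open>S\<close>; glued along
  \<open>S\<close> they give a member of \<open>N\<close> containing \<open>S\<close> but not
  \<open>R\<close>.\<close>

lemma centre_tight:
  assumes N: "nested V B N" and S: "S \<in> B"
  shows "mass (centre N) S = low S \<longleftrightarrow> S \<in> N"
proof
  assume "S \<in> N" then show "mass (centre N) S = low S" using centre_in_F[OF N] unfolding F_def by blast
next
  assume eq: "mass (centre N) S = low S"
  have ys: "\<And>T. T \<in> B \<Longrightarrow> bary (c N T) \<in> unit_simplex T" "\<And>T. T \<in> B \<Longrightarrow> Poly_Mapping.keys (bary (c N T)) = c N T"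
    using bary_simplex[OF finite_c c_nonempty[OF N]] simplex_iff_mono[OF B_finite c_subset] by blast+
  have off: "c N T \<inter> S = {}" if "T \<in> B" "\<not> T \<subseteq> S" for T
    using eq mass_decomp(2)[of "\<lambda>T. bary (c N T)", OF ys(1) S] that ys(2) unfolding centre_def by blast
  obtain R where R: "R \<in> N" "S \<subseteq> R" "\<And>R'. R' \<in> N \<Longrightarrow> S \<subseteq> R' \<Longrightarrow> R \<subseteq> R'"
    using smallest_above[OF N S] by metis
  have NB: "N \<subseteq> B" by (rule nested_subset[OF N])
  show "S \<in> N"
  proof (rule ccontr)
    assume "S \<notin> N"
    then have "\<not> R \<subseteq> S" using R(1,2) by (metis subset_antisym)
    then have "c N R \<inter> S = {}" using off R NB by blast
    then have sub: "S \<subseteq> \<Union>{S'\<in>N. \<not> R \<subseteq> S' \<and> S' \<inter> S \<noteq> {}}" using R(2) unfolding c_def by blast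
    let ?M = "{S'\<in>N. \<not> R \<subseteq> S' \<and> S' \<inter> S \<noteq> {}}"
    have "S \<union> \<Union>?M \<in> B" using NB S by (intro B_Union) auto
    moreover have "S \<union> \<Union>?M = \<Union>?M" using sub by blast
    moreover have "?M \<noteq> {}" using sub B_nonempty[OF S] by blast
    ultimately have "\<Union>?M \<in> ?M" using nestedD[OF N, of ?M] by auto
    then show False using sub R(3) by blast
  qed
qed

lemma F_subset_iff:
  assumes "nested V B N" "nested V B M" shows "F N \<subseteq> F M \<longleftrightarrow> M \<subseteq> N"
proof
  assume "F N \<subseteq> F M"
  then have "centre N \<in> F M" using centre_in_F assms by blast
  then show "M \<subseteq> N" using centre_tight[OF assms(1)] nested_subset[OF assms(2)] unfolding F_def by blast
qed (auto simp: F_def)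

text \<open>
  The summands \<open>s T\<close> of a face are the supports of a decomposition of one of its points with
  largest supports. That they come from a nested set is seen by moving the point
  inside the polytope in the directions \<open>e\<^sub>j - e\<^sub>i\<close>.
\<close>

lemma face_eq_F:
  assumes G: "G face_of P" "G \<noteq> {}"
  obtains N where "nested V B N" "G = F N"
proof -
  have GP: "G \<subseteq> P" and cG: "convex G" using G unfolding face_of_def by auto
  let ?e = "\<lambda>i. Poly_Mapping.single i (1::real) :: 'v \<Rightarrow>\<^sub>0 real"
  define R where "R = {y. (\<forall>T\<in>B. y T \<in> unit_simplex T) \<and> (\<Sum>T\<in>B. y T) \<in> G}"
  define m where "m y = (\<Sum>T\<in>B. card (Poly_Mapping.keys (y T)))" for y :: "'v set \<Rightarrow> ('v \<Rightarrow>\<^sub>0 real)"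
  obtain y1 where "y1 \<in> R"
  proof -
    obtain x where "x \<in> G" using G by blast
    then have "x \<in> P" using GP by blast
    then obtain y where "x = (\<Sum>T\<in>B. y T)" "\<And>T. T \<in> B \<Longrightarrow> y T \<in> unit_simplex T"
      by (rule msumE) blast
    then show thesis using \<open>x \<in> G\<close> that unfolding R_def by blast
  qed
  moreover have "\<forall>y. y \<in> R \<longrightarrow> m y < Suc (\<Sum>T\<in>B. card T)"
    unfolding m_def R_def by (auto intro!: le_imp_less_Suc sum_mono card_mono B_finite dest: simplex_keys)
  ultimately have "\<exists>y. y \<in> R \<and> (\<forall>z. z \<in> R \<longrightarrow> m z \<le> m y)"
    by (rule ex_has_greatest_nat)
  then obtain y0 where y0: "y0 \<in> R" "\<And>y. y \<in> R \<Longrightarrow> m y \<le> m y0" by blast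
  define s where "s T = Poly_Mapping.keys (y0 T)" for T
  define x0 where "x0 = (\<Sum>T\<in>B. y0 T)"
  have y0s: "y0 T \<in> unit_simplex T" if "T \<in> B" for T using y0(1) that unfolding R_def by blast
  have x0G: "x0 \<in> G" using y0(1) unfolding R_def x0_def by blast
  have sT: "s T \<subseteq> T" "s T \<noteq> {}" if "T \<in> B" for T
    using y0s[OF that] simplex_keys simplex_keys_nonempty unfolding s_def by blast+
  have max: "Poly_Mapping.keys (y T) \<subseteq> s T" if y: "y \<in> R" and T: "T \<in> B" for y T
  proof -
    \<comment> \<open>The midpoint stays in \<open>G\<close> by convexity, and since coordinates are
      nonnegative its supports are the unions of both. Maximality of the total support size
      therefore forces the supports of \<open>y\<close> into those of \<open>y0\<close>, for every
      decomposition of every point of \<open>G\<close>.\<close>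
    define z where "z T = (1/2) *\<^sub>R y0 T + (1/2) *\<^sub>R y T" for T
    have ys: "\<And>T. T \<in> B \<Longrightarrow> y T \<in> unit_simplex T" using y unfolding R_def by blast
    have kz: "Poly_Mapping.keys (z T) = s T \<union> Poly_Mapping.keys (y T)" if "T \<in> B" for T
      using simplex_nonneg[OF y0s[OF that]] simplex_nonneg[OF ys[OF that]]
      by (auto simp: s_def z_def in_keys_iff lookup_add lookup_scaleR add_nonneg_eq_0_iff)
    have "(\<Sum>T\<in>B. z T) = (1/2) *\<^sub>R (\<Sum>T\<in>B. y0 T) + (1/2) *\<^sub>R (\<Sum>T\<in>B. y T)"
      unfolding z_def by (simp add: sum.distrib scaleR_sum_right)
    also have "\<dots> \<in> G" using y y0(1) cG unfolding R_def by (intro convexD) auto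
    finally have "z \<in> R"
      unfolding R_def z_def using ys y0s by (auto intro!: convexD[OF convex_simplex])
    then have "m z \<le> m y0" by (rule y0(2))
    moreover have "card (s T) \<le> card (Poly_Mapping.keys (z T))" if "T \<in> B" for T
      using kz[OF that] by (intro card_mono) (auto simp: s_def)
    ultimately have "card (Poly_Mapping.keys (z T)) = card (s T)"
      using T finite_B sum_mono_inv[of "\<lambda>T. card (s T)" B "\<lambda>T. card (Poly_Mapping.keys (z T))" T]
      unfolding m_def s_def[symmetric] using sum_mono[of B "\<lambda>T. card (s T)" "\<lambda>T. card (Poly_Mapping.keys (z T))"]
      by (metis le_antisym)
    then have "s T = Poly_Mapping.keys (z T)"
      using kz[OF T] by (intro card_subset_eq finite_keys) simp_all
    then show ?thesis using kz[OF T] by blast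
  qed
  \<comment> \<open>Mass can be moved from \<open>i\<close> to \<open>j\<close> without leaving the
    polytope. This relation depends on the point \<open>x0\<close> only, not on its decomposition,
    and is a preorder.\<close>
  define adm where "adm i j \<longleftrightarrow> (\<exists>d>0. x0 + d *\<^sub>R (?e j - ?e i) \<in> P)" for i j
  have x0P: "x0 \<in> P" using x0G GP by blast
  have adm_refl: "adm i i" for i unfolding adm_def using x0P by (intro exI[of _ 1]) simp
  have adm_trans: "adm i k" if ij: "adm i j" and jk: "adm j k" for i j k
  proof -
    obtain d where d: "d > 0" "x0 + d *\<^sub>R (?e j - ?e i) \<in> P" using ij unfolding adm_def by blast
    obtain d' where d': "d' > 0" "x0 + d' *\<^sub>R (?e k - ?e j) \<in> P" using jk unfolding adm_def by blast
    \<comment> \<open>The weights are chosen so that the two contributions at \<open>j\<close>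
      cancel, leaving a pure move from \<open>i\<close> to \<open>k\<close>.\<close>
    define u where "u = d' / (d + d')"
    have u: "0 \<le> u" "0 \<le> 1 - u" "u * d = d * d' / (d + d')" "(1 - u) * d' = d * d' / (d + d')"
      using d d' unfolding u_def by (auto simp: field_simps)
    have "u *\<^sub>R (x0 + d *\<^sub>R (?e j - ?e i)) + (1 - u) *\<^sub>R (x0 + d' *\<^sub>R (?e k - ?e j)) \<in> P"
      using d d' u by (intro convexD[OF convex_msum]) auto
    also have "u *\<^sub>R (x0 + d *\<^sub>R (?e j - ?e i)) + (1 - u) *\<^sub>R (x0 + d' *\<^sub>R (?e k - ?e j))
        = x0 + ((u * d) *\<^sub>R (?e j - ?e i) + ((1 - u) * d') *\<^sub>R (?e k - ?e j))"
      by (simp add: scaleR_add_right scaleR_left_diff_distrib)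
    also have "(u * d) *\<^sub>R (?e j - ?e i) + ((1 - u) * d') *\<^sub>R (?e k - ?e j) = (d * d' / (d + d')) *\<^sub>R (?e k - ?e i)"
      unfolding u(3,4) by (simp add: scaleR_diff_right)
    finally show ?thesis unfolding adm_def using d d' by (intro exI[of _ "d * d' / (d + d')"]) auto
  qed
  have shift: "(\<Sum>S\<in>B. (y0(T := y0 T + w)) S) = x0 + w" if "T \<in> B" for T w
  proof -
    have "(\<Sum>S\<in>B. (y0(T := y0 T + w)) S) = (\<Sum>S\<in>B. y0 S + (if S = T then w else 0))"
      by (intro sum.cong) auto
    then show ?thesis using that finite_B unfolding x0_def by (simp add: sum.distrib)
  qed
  have step: "\<exists>d>0. d \<le> Poly_Mapping.lookup (y0 T) i \<and>
      (\<forall>S\<in>B. (y0(T := y0 T + d *\<^sub>R (?e j - ?e i))) S \<in> unit_simplex S)"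
    if T: "T \<in> B" "i \<in> s T" "j \<in> T" for T i j
  proof (intro exI[of _ "Poly_Mapping.lookup (y0 T) i"] conjI ballI)
    show "0 < Poly_Mapping.lookup (y0 T) i"
      using T simplex_nonneg[OF y0s[OF T(1)], of i] by (simp add: s_def in_keys_iff)
    fix S assume S: "S \<in> B"
    have "y0 T + Poly_Mapping.lookup (y0 T) i *\<^sub>R (?e j - ?e i) \<in> unit_simplex T"
      using T sT y0s simplex_nonneg[OF y0s[OF T(1)], of i] by (intro simplex_shift) auto
    then show "(y0(T := y0 T + Poly_Mapping.lookup (y0 T) i *\<^sub>R (?e j - ?e i))) S \<in> unit_simplex S"
      using y0s[OF S] by auto
  qed simp
  have adm_step: "adm i j" if T: "T \<in> B" "i \<in> s T" "j \<in> T" for T i j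
  proof -
    obtain d where d: "d > 0" "\<forall>S\<in>B. (y0(T := y0 T + d *\<^sub>R (?e j - ?e i))) S \<in> unit_simplex S"
      using step[OF T] by blast
    then have "x0 + d *\<^sub>R (?e j - ?e i) \<in> P"
      unfolding shift[OF T(1), symmetric] by (intro msumI) auto
    then show ?thesis unfolding adm_def using d by blast
  qed
  \<comment> \<open>By \<open>mass_decomp\<close> these are exactly the members of \<open>B\<close>
    whose inequality is tight at \<open>x0\<close>.\<close>
  define N where "N = {S\<in>B. \<forall>T\<in>B. s T \<inter> S \<noteq> {} \<longrightarrow> T \<subseteq> S}"
  have NB: "N \<subseteq> B" unfolding N_def by blast
  have nest: "nested V B N"
    unfolding nested_def
  proof (intro conjI allI impI)
    show "N \<subseteq> B" by (rule NB)
    show "V \<in> N" unfolding N_def using V_in B_subset by blast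
    fix M assume M: "M \<subseteq> N" "M \<noteq> {}" "\<Union>M \<in> B"
    obtain i where "i \<in> s (\<Union>M)" using sT M by blast
    then obtain S where S: "S \<in> M" "i \<in> S" using sT(1)[OF M(3)] by blast
    then have "\<Union>M \<subseteq> S" using M \<open>i \<in> s (\<Union>M)\<close> unfolding N_def by blast
    then have "\<Union>M = S" using S by blast
    then show "\<Union>M \<in> M" using S by simp
  qed
  have sc: "s T = c N T" if T: "T \<in> B" for T
  proof
    show "s T \<subseteq> c N T" using sT(1)[OF T] T unfolding c_def N_def by blast
    show "c N T \<subseteq> s T"
    proof
      fix i assume i: "i \<in> c N T"
      then have iT: "i \<in> T" using c_subset by blast
      \<comment> \<open>A largest member of \<open>B\<close> that contains \<open>i\<close> and is
        reachable from \<open>i\<close> absorbs every \<open>T'\<close> whose support meets it, so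
        it belongs to \<open>N\<close>. As \<open>i\<close> lies in \<open>c N T\<close>, it must
        contain \<open>T\<close>; hence mass can be moved from \<open>i\<close> to the support of
        the summand \<open>T\<close>.\<close>
      let ?Q = "\<lambda>U. U \<in> B \<and> i \<in> U \<and> (\<forall>j\<in>U. adm i j)"
      have "?Q {i}" using B_singleton iT T B_subset adm_refl by blast
      moreover have "\<forall>U. ?Q U \<longrightarrow> card U < Suc (card V)"
        using B_subset finite_V by (auto intro!: le_imp_less_Suc card_mono)
      ultimately have "\<exists>U. ?Q U \<and> (\<forall>U'. ?Q U' \<longrightarrow> card U' \<le> card U)"
        by (rule ex_has_greatest_nat)
      then obtain U where U: "?Q U" "\<And>U'. ?Q U' \<Longrightarrow> card U' \<le> card U" by metis
      have "T' \<subseteq> U" if T': "T' \<in> B" "s T' \<inter> U \<noteq> {}" for T'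
      proof -
        obtain a where a: "a \<in> s T'" "a \<in> U" using T' by blast
        have "adm i b" if "b \<in> T'" for b
          using adm_trans[OF _ adm_step[OF T'(1) a(1) that]] U(1) a by blast
        moreover have "U \<union> T' \<in> B" using U(1) T' a sT(1)[OF T'(1)] by (intro B_Un) auto
        ultimately have "?Q (U \<union> T')" using U(1) by blast
        then have "card (U \<union> T') \<le> card U" by (rule U(2))
        moreover have "finite (U \<union> T')" using U(1) T' B_finite by blast
        ultimately have "U = U \<union> T'" by (intro card_seteq) auto
        then show ?thesis by blast
      qed
      then have "U \<in> N" using U(1) unfolding N_def by blast
      then have TU: "T \<subseteq> U" using i U(1) unfolding c_def by blast
      obtain j where j: "j \<in> s T" using sT(2)[OF T] by blast
      show "i \<in> s T"
      proof (cases "i = j")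
        case False
        have "adm i j" using U(1) j sT(1)[OF T] TU by blast
        then obtain d where d: "d > 0" "x0 + d *\<^sub>R (?e j - ?e i) \<in> P" unfolding adm_def by blast
        \<comment> \<open>The opposite move, carried out inside the summand \<open>T\<close>, makes
          \<open>x0\<close> an inner point of a segment in the polytope. The face property then puts
          the endpoint into \<open>G\<close>, and the decomposition of this endpoint has
          \<open>i\<close> in the support of its summand \<open>T\<close>.\<close>
        obtain d' where d': "d' > 0" "\<forall>S\<in>B. (y0(T := y0 T + d' *\<^sub>R (?e i - ?e j))) S \<in> unit_simplex S"
          "d' \<le> Poly_Mapping.lookup (y0 T) j"
          using step[OF T j iT] by blast
        let ?y = "y0(T := y0 T + d' *\<^sub>R (?e i - ?e j))"
        let ?a = "x0 + d *\<^sub>R (?e j - ?e i)" and ?b = "x0 + d' *\<^sub>R (?e i - ?e j)"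
        have bP: "?b \<in> P"
          unfolding shift[OF T, symmetric] using d' by (intro msumI) auto
        \<comment> \<open>The weight at which the two opposite moves cancel and the segment passes
          through \<open>x0\<close>.\<close>
        define u where "u = d / (d + d')"
        have u: "0 < u" "u < 1" "(1 - u) * d = u * d'"
          using d d' unfolding u_def by (auto simp: field_simps)
        have ne: "?e j - ?e i \<noteq> 0"
        proof
          assume "?e j - ?e i = 0"
          then have "Poly_Mapping.lookup (?e j - ?e i) j = 0" by simp
          then show False using False by (simp add: lookup_minus lookup_single when_def)
        qed
        have "(1 - u) *\<^sub>R ?a + u *\<^sub>R ?b = x0 + (((1 - u) * d) *\<^sub>R (?e j - ?e i) + (u * d') *\<^sub>R (?e i - ?e j))"
          by (simp add: scaleR_add_right scaleR_left_diff_distrib)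
        also have "\<dots> = x0" unfolding u(3) by (simp add: scaleR_diff_right)
        finally have x0u: "x0 = (1 - u) *\<^sub>R ?a + u *\<^sub>R ?b" by simp
        have "?b - ?a = - (d + d') *\<^sub>R (?e j - ?e i)"
          by (simp add: algebra_simps)
        moreover have "- (d + d') *\<^sub>R (?e j - ?e i) \<noteq> 0" using ne d d' by auto
        ultimately have "?a \<noteq> ?b" by (metis right_minus_eq)
        then have "x0 \<in> open_segment ?a ?b" using x0u u by (auto simp: in_segment)
        then have "?b \<in> G" using face_ofD[OF G(1) _ d(2) bP x0G] by blast
        then have "?y \<in> R" unfolding R_def using d' shift[OF T] by auto
        then have "Poly_Mapping.keys (?y T) \<subseteq> s T" using T by (rule max)
        moreover have "0 < Poly_Mapping.lookup (?y T) i"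
          using False d' simplex_nonneg[OF y0s[OF T], of i]
          by (simp add: lookup_add lookup_scaleR lookup_minus lookup_single when_def)
        ultimately show ?thesis by (auto simp: in_keys_iff subset_iff)
      qed (use j in simp)
    qed
  qed
  have "G \<subseteq> F N"
  proof
    fix x assume x: "x \<in> G"
    then have "x \<in> P" using GP by blast
    then obtain y where y: "x = (\<Sum>T\<in>B. y T)" "\<And>T. T \<in> B \<Longrightarrow> y T \<in> unit_simplex T"
      by (rule msumE) blast
    then have "y \<in> R" using x unfolding R_def by blast
    then have "Poly_Mapping.keys (y T) \<subseteq> c N T" if "T \<in> B" for T using max sc that by blast
    then have "y T \<in> unit_simplex (c N T)" if "T \<in> B" for T
      using y(2) simplex_iff_mono[OF B_finite c_subset] that by blast
    then show "x \<in> F N" unfolding F_eq[OF NB] y(1) by (intro msumI)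
  qed
  moreover have "F N \<subseteq> G"
  proof
    fix z assume "z \<in> F N"
    then obtain w where w: "z = (\<Sum>T\<in>B. w T)" "\<And>T. T \<in> B \<Longrightarrow> w T \<in> unit_simplex (c N T)"
      unfolding F_eq[OF NB] by (rule msumE) blast
    then have ws: "\<And>T. T \<in> B \<Longrightarrow> w T \<in> unit_simplex T" using simplex_iff_mono[OF B_finite c_subset] by blast
    then have zP: "z \<in> P" unfolding w(1) by (rule msumI)
    \<comment> \<open>The smallest positive coordinate occurring in the summands of
      \<open>y0\<close>. As coordinates of \<open>w\<close> are at most 1, the point
      \<open>x0\<close> can be pushed away from \<open>z\<close> by this factor within the polytope;
      \<open>z\<close> is then an endpoint of a segment through \<open>x0\<close>, hence in
      \<open>G\<close>.\<close>
    let ?L = "(\<lambda>(T, i). Poly_Mapping.lookup (y0 T) i) ` (SIGMA T:B. s T)"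
    define d where "d = Min ?L"
    have finL: "finite ?L" using finite_B unfolding s_def by auto
    have "?L \<noteq> {}" using V_in sT(2)[OF V_in] by blast
    then have "d \<in> ?L" using finL unfolding d_def by (intro Min_in)
    then have d0: "0 < d"
      using simplex_nonneg[OF y0s] by (auto simp: s_def in_keys_iff order_less_le)
    have dle: "d \<le> Poly_Mapping.lookup (y0 T) i" if "T \<in> B" "i \<in> s T" for T i
      unfolding d_def using finL that by (intro Min_le) force+
    have "y0 T + d *\<^sub>R (y0 T - w T) \<in> unit_simplex T" if T: "T \<in> B" for T
    proof -
      have l: "Poly_Mapping.lookup (y0 T + d *\<^sub>R (y0 T - w T)) i =
        Poly_Mapping.lookup (y0 T) i + d * (Poly_Mapping.lookup (y0 T) i - Poly_Mapping.lookup (w T) i)" for i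
        by (simp add: lookup_add lookup_scaleR lookup_minus)
      have "0 \<le> Poly_Mapping.lookup (y0 T + d *\<^sub>R (y0 T - w T)) i" for i
      proof (cases "i \<in> s T")
        case True
        have "d * Poly_Mapping.lookup (w T) i \<le> d * 1"
          using d0 simplex_le_1[OF ws[OF T]] by (intro mult_left_mono) auto
        moreover have "0 \<le> d * Poly_Mapping.lookup (y0 T) i" using d0 simplex_nonneg[OF y0s[OF T]] by simp
        ultimately show ?thesis unfolding l using dle[OF T True] by (simp add: right_diff_distrib)
      next
        case False
        then have "i \<notin> Poly_Mapping.keys (w T)" using w(2)[OF T] simplex_keys sc[OF T] by blast
        then show ?thesis using False unfolding l by (simp add: s_def in_keys_iff)
      qed
      moreover have "(\<Sum>i\<in>T. Poly_Mapping.lookup (y0 T + d *\<^sub>R (y0 T - w T)) i) = 1"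
        unfolding l using y0s[OF T] ws[OF T]
        by (simp add: unit_simplex_def sum.distrib sum_subtractf sum_distrib_left[symmetric])
      moreover have "Poly_Mapping.keys (y0 T + d *\<^sub>R (y0 T - w T)) \<subseteq> T"
      proof
        fix i assume "i \<in> Poly_Mapping.keys (y0 T + d *\<^sub>R (y0 T - w T))"
        then have "i \<in> Poly_Mapping.keys (y0 T) \<or> i \<in> Poly_Mapping.keys (w T)"
          by (auto simp: in_keys_iff l)
        then show "i \<in> T" using simplex_keys[OF y0s[OF T]] simplex_keys[OF ws[OF T]] by blast
      qed
      ultimately show ?thesis by (simp add: unit_simplex_def)
    qed
    then have "(\<Sum>T\<in>B. y0 T + d *\<^sub>R (y0 T - w T)) \<in> P" by (rule msumI)
    also have "(\<Sum>T\<in>B. y0 T + d *\<^sub>R (y0 T - w T)) = x0 + d *\<^sub>R (x0 - z)"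
      unfolding x0_def w(1) by (simp add: sum.distrib scaleR_sum_right[symmetric] sum_subtractf)
    finally have aP: "x0 + d *\<^sub>R (x0 - z) \<in> P" .
    show "z \<in> G"
    proof (cases "z = x0")
      case False
      \<comment> \<open>Solves \<open>u * (1 + d) = 1\<close>, which cancels \<open>z\<close> from
        the convex combination.\<close>
      define u where "u = 1 / (1 + d)"
      have u: "0 < u" "u < 1" "u * (1 + d) = 1" "u * d = 1 - u"
        using d0 unfolding u_def by (auto simp: field_simps)
      have "(1 - u) *\<^sub>R z + u *\<^sub>R (x0 + d *\<^sub>R (x0 - z)) = (u * (1 + d)) *\<^sub>R x0 + ((1 - u) - u * d) *\<^sub>R z"
        by (simp add: algebra_simps)
      then have "x0 = (1 - u) *\<^sub>R z + u *\<^sub>R (x0 + d *\<^sub>R (x0 - z))" unfolding u by simp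
      moreover have "z \<noteq> x0 + d *\<^sub>R (x0 - z)"
      proof
        assume "z = x0 + d *\<^sub>R (x0 - z)"
        then have "(1 + d) *\<^sub>R (x0 - z) = 0" by (simp add: algebra_simps)
        then show False using d0 False by auto
      qed
      ultimately have "x0 \<in> open_segment z (x0 + d *\<^sub>R (x0 - z))" using u by (auto simp: in_segment)
      then show ?thesis using face_ofD[OF G(1) _ zP aP x0G] by blast
    qed (use x0G in simp)
  qed
  ultimately show thesis using that nest by blast
qed

end

section \<open>Face posets\<close>

text \<open>Exposes the bijection hidden in \<open>comb_equiv\<close>, so that individual faces can
  be followed through it.\<close>

definition face_iso :: "('a::real_vector set \<Rightarrow> 'b::real_vector set) \<Rightarrow> 'a set \<Rightarrow> 'b set \<Rightarrow> bool"
  where "face_iso f P Q \<longleftrightarrow> bij_betw f {F. F face_of P} {G. G face_of Q} \<and>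
    (\<forall>F F'. F face_of P \<longrightarrow> F' face_of P \<longrightarrow> (F \<subseteq> F' \<longleftrightarrow> f F \<subseteq> f F'))"

lemma comb_equiv_iff_face_iso: "comb_equiv P Q \<longleftrightarrow> (\<exists>f. face_iso f P Q)"
  unfolding comb_equiv_def face_iso_def by blast

section \<open>What an isomorphism of face posets preserves\<close>

context
  fixes f :: "'a::real_vector set \<Rightarrow> 'b::real_vector set" and P Q
  assumes f: "face_iso f P Q"
begin

lemma face_iso_face: "F face_of P \<Longrightarrow> f F face_of Q"
  using f unfolding face_iso_def bij_betw_def by blast

lemma face_iso_surj: "G face_of Q \<Longrightarrow> \<exists>F. F face_of P \<and> G = f F"
  using f unfolding face_iso_def bij_betw_def by blast

lemma face_iso_subset: "F face_of P \<Longrightarrow> F' face_of P \<Longrightarrow> f F \<subseteq> f F' \<longleftrightarrow> F \<subseteq> F'"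
  using f unfolding face_iso_def by blast

lemma face_iso_eq: "F face_of P \<Longrightarrow> F' face_of P \<Longrightarrow> f F = f F' \<longleftrightarrow> F = F'"
  using face_iso_subset by (metis subset_antisym order_refl)

lemma face_iso_eq_empty: "F face_of P \<Longrightarrow> f F = {} \<longleftrightarrow> F = {}"
  using face_iso_empty[of f P Q] f face_iso_eq[of F "{}"] unfolding face_iso_def by auto

lemma face_iso_top:
  assumes "convex P" "convex Q" shows "f P = Q"
proof -
  obtain F where F: "F face_of P" "Q = f F" using face_iso_surj assms(2) face_of_refl by blast
  then have "Q \<subseteq> f P" using face_iso_subset face_of_imp_subset face_of_refl[OF assms(1)] by blast
  moreover have "f P \<subseteq> Q"
    using face_iso_face[OF face_of_refl[OF assms(1)]] by (rule face_of_imp_subset)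
  ultimately show ?thesis by blast
qed

lemma face_iso_facet:
  assumes cv: "convex P" "convex Q" and F: "F face_of P"
  shows "is_facet (f F) Q \<longleftrightarrow> is_facet F P"
proof -
  have Pf: "P face_of P" using cv by (simp add: face_of_refl)
  have "(\<forall>G. G face_of Q \<and> f F \<subseteq> G \<and> G \<noteq> Q \<longrightarrow> G = f F) \<longleftrightarrow>
    (\<forall>G. G face_of P \<and> f F \<subseteq> f G \<and> f G \<noteq> Q \<longrightarrow> f G = f F)"
    using face_iso_surj face_iso_face by metis
  also have "\<dots> \<longleftrightarrow> (\<forall>G. G face_of P \<and> F \<subseteq> G \<and> G \<noteq> P \<longrightarrow> G = F)"
    using face_iso_subset face_iso_eq face_iso_top[OF cv] F Pf by metis
  finally show ?thesis
    unfolding is_facet_def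
    using face_iso_eq[OF F Pf] face_iso_top[OF cv] face_iso_eq_empty[OF F] face_iso_face[OF F] F by simp
qed

lemma face_iso_restrict:
  assumes F: "F face_of P" shows "comb_equiv F (f F)"
proof -
  have faces: "{G. G face_of F} = {G \<in> {G. G face_of P}. G \<subseteq> F}"
    "{G. G face_of f F} = {G \<in> {G. G face_of Q}. G \<subseteq> f F}"
    using face_of_face[OF F] face_of_face[OF face_iso_face[OF F]] by auto
  have "f ` {G. G face_of F} = {G. G face_of f F}"
  proof
    show "f ` {G. G face_of F} \<subseteq> {G. G face_of f F}"
      unfolding faces using F face_iso_face face_iso_subset by auto
    show "{G. G face_of f F} \<subseteq> f ` {G. G face_of F}"
    proof
      fix G assume "G \<in> {G. G face_of f F}"
      then have G: "G face_of Q" "G \<subseteq> f F" unfolding faces by auto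
      obtain H where H: "H face_of P" "G = f H" using face_iso_surj G by blast
      then have "H \<subseteq> F" using face_iso_subset[OF H(1) F] G by simp
      then show "G \<in> f ` {G. G face_of F}" unfolding faces using H by blast
    qed
  qed
  moreover have "inj_on f {G. G face_of F}"
    unfolding faces using face_iso_eq by (auto intro!: inj_onI)
  moreover have "\<forall>G H. G face_of F \<longrightarrow> H face_of F \<longrightarrow> (G \<subseteq> H \<longleftrightarrow> f G \<subseteq> f H)"
    using face_iso_subset face_of_face[OF F] by auto
  ultimately show ?thesis unfolding comb_equiv_def bij_betw_def by blast
qed

end

text \<open>An index poset for the nonempty faces only. Excluding the empty face makes the faces of
  a product correspond uniquely to pairs; it is put back in
  \<open>comb_equiv_face_models\<close>.\<close>

definition face_model :: "'a::real_vector set \<Rightarrow> 'i set \<Rightarrow> ('i \<Rightarrow> 'a set) \<Rightarrow> ('i \<Rightarrow> 'i \<Rightarrow> bool) \<Rightarrow> bool"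
  where "face_model P A \<Phi> lq \<longleftrightarrow> bij_betw \<Phi> A {F. F face_of P \<and> F \<noteq> {}} \<and>
    (\<forall>a\<in>A. \<forall>b\<in>A. \<Phi> a \<subseteq> \<Phi> b \<longleftrightarrow> lq a b)"

lemma face_model_reindex:
  assumes "face_model P A \<Phi> lq" "bij_betw h A' A"
    and "\<And>a b. a \<in> A' \<Longrightarrow> b \<in> A' \<Longrightarrow> lq (h a) (h b) \<longleftrightarrow> lq' a b"
  shows "face_model P A' (\<Phi> \<circ> h) lq'"
proof -
  have "h a \<in> A" if "a \<in> A'" for a using assms(2) that unfolding bij_betw_def by blast
  then show ?thesis using assms bij_betw_trans[OF assms(2), of \<Phi>] unfolding face_model_def by auto
qed

lemma comb_equiv_face_models:
  assumes P: "face_model P A \<Phi> lq" and Q: "face_model Q A \<Psi> lq"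
  shows "comb_equiv P Q"
proof -
  have bP: "bij_betw \<Phi> A {F. F face_of P \<and> F \<noteq> {}}" and bQ: "bij_betw \<Psi> A {F. F face_of Q \<and> F \<noteq> {}}"
    using P Q unfolding face_model_def by auto
  let ?g = "\<lambda>F. \<Psi> (inv_into A \<Phi> F)"
  define f where "f F = (if F = {} then {} else ?g F)" for F
  have g: "bij_betw ?g {F. F face_of P \<and> F \<noteq> {}} {F. F face_of Q \<and> F \<noteq> {}}"
    using bij_betw_trans[OF bij_betw_inv_into[OF bP] bQ] by (simp add: o_def)
  have "bij_betw f ({F. F face_of P \<and> F \<noteq> {}} \<union> {{}}) ({F. F face_of Q \<and> F \<noteq> {}} \<union> {{}})"
  proof (rule bij_betw_combine)
    show "bij_betw f {F. F face_of P \<and> F \<noteq> {}} {F. F face_of Q \<and> F \<noteq> {}}"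
      using g by (rule bij_betw_cong[THEN iffD1, rotated]) (simp add: f_def)
  qed (auto simp: f_def)
  moreover have "{F. F face_of P \<and> F \<noteq> {}} \<union> {{}} = {F. F face_of P}"
    "{F. F face_of Q \<and> F \<noteq> {}} \<union> {{}} = {F. F face_of Q}" by auto
  ultimately have bij: "bij_betw f {F. F face_of P} {F. F face_of Q}" by simp
  have "F \<subseteq> F' \<longleftrightarrow> f F \<subseteq> f F'" if F: "F face_of P" "F' face_of P" for F F'
  proof (cases "F = {} \<or> F' = {}")
    case True
    have "f F = {} \<longleftrightarrow> F = {}" using g F unfolding f_def bij_betw_def by auto
    then show ?thesis using True by (auto simp: f_def)
  next
    case False
    then have "F \<in> \<Phi> ` A" "F' \<in> \<Phi> ` A"
      using F unfolding bij_betw_imp_surj_on[OF bP] by auto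
    then obtain a b where ab: "a \<in> A" "F = \<Phi> a" "b \<in> A" "F' = \<Phi> b" by blast
    then have "f F = \<Psi> a" "f F' = \<Psi> b"
      using False bij_betw_inv_into_left[OF bP] unfolding f_def by auto
    then show ?thesis using ab P Q unfolding face_model_def by simp
  qed
  with bij show ?thesis unfolding comb_equiv_def by blast
qed

lemma face_model_Times:
  assumes P: "face_model P A \<Phi> lq" and Q: "face_model Q A' \<Psi> lq'"
  shows "face_model (P \<times> Q) (A \<times> A') (\<lambda>(a, b). \<Phi> a \<times> \<Psi> b) (\<lambda>(a, b) (c, d). lq a c \<and> lq' b d)"
proof -
  have P': "\<Phi> ` A = {F. F face_of P \<and> F \<noteq> {}}" "inj_on \<Phi> A"
    "\<And>a b. a \<in> A \<Longrightarrow> b \<in> A \<Longrightarrow> \<Phi> a \<subseteq> \<Phi> b \<longleftrightarrow> lq a b"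
    using P unfolding face_model_def bij_betw_def by auto
  have Q': "\<Psi> ` A' = {F. F face_of Q \<and> F \<noteq> {}}" "inj_on \<Psi> A'"
    "\<And>a b. a \<in> A' \<Longrightarrow> b \<in> A' \<Longrightarrow> \<Psi> a \<subseteq> \<Psi> b \<longleftrightarrow> lq' a b"
    using Q unfolding face_model_def bij_betw_def by auto
  have ne: "\<Phi> a \<noteq> {}" "\<Psi> b \<noteq> {}" if "a \<in> A" "b \<in> A'" for a b using P'(1) Q'(1) that by blast+
  have "inj_on (\<lambda>(a, b). \<Phi> a \<times> \<Psi> b) (A \<times> A')"
    using P'(2) Q'(2) ne unfolding inj_on_def by (auto simp: times_eq_iff)
  moreover have "(\<lambda>(a, b). \<Phi> a \<times> \<Psi> b) ` (A \<times> A') = {F. F face_of P \<times> Q \<and> F \<noteq> {}}"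
  proof
    show "(\<lambda>(a, b). \<Phi> a \<times> \<Psi> b) ` (A \<times> A') \<subseteq> {F. F face_of P \<times> Q \<and> F \<noteq> {}}"
    proof
      fix C assume "C \<in> (\<lambda>(a, b). \<Phi> a \<times> \<Psi> b) ` (A \<times> A')"
      then obtain a b where ab: "a \<in> A" "b \<in> A'" "C = \<Phi> a \<times> \<Psi> b" by auto
      then have "\<Phi> a face_of P" "\<Psi> b face_of Q" using P'(1) Q'(1) by blast+
      then have "C face_of P \<times> Q" unfolding ab(3) by (rule face_of_Times)
      then show "C \<in> {F. F face_of P \<times> Q \<and> F \<noteq> {}}" using ne[OF ab(1,2)] ab(3) by simp
    qed
    show "{F. F face_of P \<times> Q \<and> F \<noteq> {}} \<subseteq> (\<lambda>(a, b). \<Phi> a \<times> \<Psi> b) ` (A \<times> A')"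
    proof
      fix C assume C: "C \<in> {F. F face_of P \<times> Q \<and> F \<noteq> {}}"
      then obtain F G where FG: "F face_of P" "G face_of Q" "C = F \<times> G" by (auto simp: faces_Times)
      then have "F \<in> \<Phi> ` A" "G \<in> \<Psi> ` A'" unfolding P'(1) Q'(1) using C by auto
      then show "C \<in> (\<lambda>(a, b). \<Phi> a \<times> \<Psi> b) ` (A \<times> A')" using FG(3) by auto
    qed
  qed
  moreover have "\<Phi> a \<times> \<Psi> b \<subseteq> \<Phi> c \<times> \<Psi> d \<longleftrightarrow> lq a c \<and> lq' b d"
    if "a \<in> A" "b \<in> A'" "c \<in> A" "d \<in> A'" for a b c d
    using ne that P'(3) Q'(3) by (simp add: times_subset_iff)
  ultimately show ?thesis unfolding face_model_def bij_betw_def by auto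
qed

section \<open>Vertices, and dimension as a combinatorial invariant\<close>

lemma polytope_extreme_point:
  assumes "polytope Q" "Q \<noteq> {}"
  obtains v where "v extreme_point_of (Q :: 'a::real_vector set)"
proof -
  have "\<exists>v. finite v \<and> Q = convex hull v" using assms(1) unfolding polytope_def by blast
  \<comment> \<open>In a generating set of least size no point lies in the hull of the others, and
    such a point turns out to be extreme.\<close>
  then obtain v where v: "finite v \<and> Q = convex hull v"
    and min: "\<And>w. finite w \<and> Q = convex hull w \<Longrightarrow> card v \<le> card w"
    using ex_has_least_nat[of "\<lambda>v. finite v \<and> Q = convex hull v" _ card] by metis
  then obtain x where x: "x \<in> v" using assms(2) by fastforce
  define w where "w = v - {x}"
  have vw: "v = insert x w" using x unfolding w_def by blast
  have xw: "x \<notin> convex hull w"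
  proof
    assume "x \<in> convex hull w"
    then have "Q = convex hull w" using v hull_redundant[of x convex w] vw by simp
    then have "card v \<le> card w" using v w_def by (intro min) auto
    then show False using v x unfolding w_def by (metis card_Diff1_less linorder_not_less)
  qed
  have "x extreme_point_of Q"
    unfolding extreme_point_of_def
  proof (intro conjI ballI notI)
    show "x \<in> Q" using v x by (simp add: hull_inc)
    fix a b assume ab: "a \<in> Q" "b \<in> Q" and seg: "x \<in> open_segment a b"
    obtain t where t: "0 < t" "t < 1" "x = (1 - t) *\<^sub>R a + t *\<^sub>R b" "a \<noteq> b"
      using seg by (auto simp: in_segment)
    show False
    proof (cases "w = {}")
      case True then show False using v vw ab t(4) by simp
    next
      case False
      have Q: "Q = {y. \<exists>u\<ge>0. \<exists>v\<ge>0. \<exists>b. u + v = 1 \<and> b \<in> convex hull w \<and> y = u *\<^sub>R x + v *\<^sub>R b}"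
        using v convex_hull_insert[OF False, of x] vw by simp
      obtain u1 v1 a' where a': "0 \<le> u1" "0 \<le> v1" "u1 + v1 = 1" "a' \<in> convex hull w" "a = u1 *\<^sub>R x + v1 *\<^sub>R a'"
        using ab(1) unfolding Q by blast
      obtain u2 v2 b' where b': "0 \<le> u2" "0 \<le> v2" "u2 + v2 = 1" "b' \<in> convex hull w" "b = u2 *\<^sub>R x + v2 *\<^sub>R b'"
        using ab(2) unfolding Q by blast
      \<comment> \<open>The total weight that the segment places on the hull of the other
        generators. If it is positive, solving for \<open>x\<close> puts \<open>x\<close> into that
        hull; if it is 0, both endpoints equal \<open>x\<close>.\<close>
      define k where "k = (1 - t) * v1 + t * v2"
      have nn: "0 \<le> (1 - t) * v1" "0 \<le> t * v2" using t a' b' by auto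
      have u12: "u1 = 1 - v1" "u2 = 1 - v2" using a' b' by auto
      have "x = (1 - k) *\<^sub>R x + (((1 - t) * v1) *\<^sub>R a' + (t * v2) *\<^sub>R b')"
        using t(3) unfolding a'(5) b'(5) u12 k_def by (simp add: algebra_simps)
      then have kx: "k *\<^sub>R x = ((1 - t) * v1) *\<^sub>R a' + (t * v2) *\<^sub>R b'"
        by (simp add: algebra_simps)
      show False
      proof (cases "k = 0")
        case True
        then have "(1 - t) * v1 = 0" "t * v2 = 0" using nn unfolding k_def by linarith+
        then have "v1 = 0" "v2 = 0" using t by auto
        then show False using a' b' t(4) by simp
      next
        case False
        then have k: "0 < k" using nn unfolding k_def by linarith
        have "x = (1 / k) *\<^sub>R (k *\<^sub>R x)" using k by simp
        also have "\<dots> = ((1 - t) * v1 / k) *\<^sub>R a' + (t * v2 / k) *\<^sub>R b'"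
          unfolding kx by (simp add: scaleR_add_right)
        also have "\<dots> \<in> convex hull w"
          using a' b' nn k by (intro convexD[OF convex_convex_hull])
            (auto simp: k_def add_divide_distrib[symmetric])
        finally show False using xw by blast
      qed
    qed
  qed
  then show thesis by (rule that)
qed

text \<open>Simplicity expresses the dimension as the number of facets through a vertex, and a face
  isomorphism carries the facets through one vertex to those through another. The last hypothesis
  provides a vertex of the face that is mapped to a vertex of \<open>Q\<close>.\<close>

lemma pdim_comb_equiv:
  assumes P: "simple_polytope P" and Q: "simple_polytope Q" and PQ: "comb_equiv P Q"
    and ext: "\<And>G. G face_of P \<Longrightarrow> G \<noteq> {} \<Longrightarrow> \<exists>w. w extreme_point_of G"
  shows "pdim P = pdim Q"
proof -
  have cv: "convex P" "convex Q" using P Q unfolding simple_polytope_def polytope_def by auto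
  obtain f where f: "face_iso f P Q" using PQ unfolding comb_equiv_iff_face_iso by blast
  obtain v where v: "v extreme_point_of Q"
    using Q polytope_extreme_point unfolding simple_polytope_def by blast
  then have vf: "{v} face_of Q" by (simp add: face_of_singleton)
  then obtain G where G: "G face_of P" "{v} = f G" using face_iso_surj[OF f] by blast
  then have "G \<noteq> {}" using face_iso_eq_empty[OF f G(1)] by auto
  then obtain w where "w extreme_point_of G" using ext G(1) by blast
  then have wG: "{w} face_of G" by (simp add: face_of_singleton)
  then have wP: "{w} face_of P" using G(1) by (rule face_of_trans)
  have "f {w} \<subseteq> {v}"
    unfolding G(2) using face_iso_subset[OF f wP G(1)] face_of_imp_subset[OF wG] by simp
  moreover have "f {w} \<noteq> {}" using face_iso_eq_empty[OF f wP] by simp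
  ultimately have fw: "f {w} = {v}" by blast
  have "w extreme_point_of P" using wP by (simp add: face_of_singleton)
  then have "pdim P = card {F. is_facet F P \<and> w \<in> F}" using P unfolding simple_polytope_def by simp
  also have "\<dots> = card {F. is_facet F Q \<and> v \<in> F}"
  proof (rule bij_betw_same_card)
    have iff: "v \<in> f F \<longleftrightarrow> w \<in> F" if "F face_of P" for F
      using face_iso_subset[OF f wP that] fw by simp
    show "bij_betw f {F. is_facet F P \<and> w \<in> F} {F. is_facet F Q \<and> v \<in> F}"
      unfolding bij_betw_def
    proof
      show "inj_on f {F. is_facet F P \<and> w \<in> F}"
        using face_iso_eq[OF f] by (auto intro!: inj_onI simp: is_facet_def)
      show "f ` {F. is_facet F P \<and> w \<in> F} = {F. is_facet F Q \<and> v \<in> F}"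
      proof
        show "f ` {F. is_facet F P \<and> w \<in> F} \<subseteq> {F. is_facet F Q \<and> v \<in> F}"
          using face_iso_facet[OF f cv] iff by (auto simp: is_facet_def)
        show "{F. is_facet F Q \<and> v \<in> F} \<subseteq> f ` {F. is_facet F P \<and> w \<in> F}"
        proof
          fix H assume H: "H \<in> {F. is_facet F Q \<and> v \<in> F}"
          then have "H face_of Q" unfolding is_facet_def by blast
          then obtain F where F: "F face_of P" "H = f F" using face_iso_surj[OF f] by blast
          then have "is_facet F P" "w \<in> F" using H face_iso_facet[OF f cv] iff by auto
          then show "H \<in> f ` {F. is_facet F P \<and> w \<in> F}" using F by blast
        qed
      qed
    qed
  qed
  also have "\<dots> = pdim Q" using Q v unfolding simple_polytope_def by simp
  finally show ?thesis .
qed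

section \<open>Nestohedra are simple\<close>

context connected_building_set
begin

lemma nested_V: "nested V B {V}"
  unfolding nested_def using V_in by (auto simp: subset_singleton_iff)

lemma nested_pair:
  assumes S: "S \<in> B" shows "nested V B {V, S}"
  unfolding nested_def
proof (intro conjI allI impI)
  fix M assume M: "M \<subseteq> {V, S}" "M \<noteq> {}"
  then have "M = {V} \<or> M = {S} \<or> M = {V, S}" by blast
  moreover have "\<Union>{V, S} = V" using B_subset[OF S] by auto
  ultimately show "\<Union>M \<in> M" by auto
qed (use S V_in in auto)

text \<open>The inequality of \<open>V\<close> is tight on the whole polytope; this is what allows
  every nested set to contain \<open>V\<close>.\<close>

lemma F_V: "F {V} = P"
proof -
  have "P \<subseteq> F {V}"
  proof
    fix x assume x: "x \<in> P"
    then obtain y where y: "x = (\<Sum>T\<in>B. y T)" "\<And>T. T \<in> B \<Longrightarrow> y T \<in> unit_simplex T" by (rule msumE) blast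
    have "mass x V = low V" unfolding y(1) using mass_decomp(2)[of y, OF y(2) V_in] B_subset by blast
    then show "x \<in> F {V}" using x unfolding F_def by blast
  qed
  then show ?thesis unfolding F_def by blast
qed

lemma F_nonempty: "nested V B N \<Longrightarrow> F N \<noteq> {}"
  using centre_in_F by blast

lemma F_eq_iff: "nested V B N \<Longrightarrow> nested V B M \<Longrightarrow> F N = F M \<longleftrightarrow> N = M"
  using F_subset_iff by (metis subset_antisym order_refl)

lemma F_nested_face: "nested V B N \<Longrightarrow> F N face_of P"
  by (rule F_face[OF nested_subset])

lemma face_model_nested: "face_model P {N. nested V B N} F (\<lambda>N M. M \<subseteq> N)"
proof -
  have "F ` {N. nested V B N} = {G. G face_of P \<and> G \<noteq> {}}"
  proof
    show "F ` {N. nested V B N} \<subseteq> {G. G face_of P \<and> G \<noteq> {}}"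
      using F_nested_face F_nonempty by auto
    show "{G. G face_of P \<and> G \<noteq> {}} \<subseteq> F ` {N. nested V B N}"
    proof
      fix G assume "G \<in> {G. G face_of P \<and> G \<noteq> {}}"
      then have "G face_of P" "G \<noteq> {}" by auto
      then obtain N where "nested V B N" "G = F N" by (rule face_eq_F)
      then show "G \<in> F ` {N. nested V B N}" by blast
    qed
  qed
  moreover have "inj_on F {N. nested V B N}" using F_eq_iff by (auto intro!: inj_onI)
  ultimately show ?thesis
    unfolding face_model_def bij_betw_def using F_subset_iff by auto
qed

lemma face_model_facet:
  assumes S: "S \<in> B"
  shows "face_model (F {V, S}) {N. nested V B N \<and> S \<in> N} F (\<lambda>N M. M \<subseteq> N)"
proof -
  have sub: "F N \<subseteq> F {V, S} \<longleftrightarrow> S \<in> N" if "nested V B N" for N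
    using F_subset_iff[OF that nested_pair[OF S]] nested_top[OF that] by simp
  have eq: "{G. G face_of F {V, S} \<and> G \<noteq> {}} = {G \<in> {G. G face_of P \<and> G \<noteq> {}}. G \<subseteq> F {V, S}}"
    using face_of_face[OF F_nested_face[OF nested_pair[OF S]]] by auto
  have img: "F ` {N. nested V B N} = {G. G face_of P \<and> G \<noteq> {}}" and inj: "inj_on F {N. nested V B N}"
    using face_model_nested unfolding face_model_def bij_betw_def by auto
  have "F ` {N. nested V B N \<and> S \<in> N} = {G. G face_of F {V, S} \<and> G \<noteq> {}}"
    unfolding eq img[symmetric] using sub by auto
  moreover have "inj_on F {N. nested V B N \<and> S \<in> N}" by (rule inj_on_subset[OF inj]) auto
  ultimately show ?thesis
    unfolding face_model_def bij_betw_def using F_subset_iff by auto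
qed

text \<open>Inclusion of faces reverses inclusion of nested sets, so facets belong to the minimal
  nested sets above \<open>{V}\<close>. Every other member of \<open>B\<close> forms such a set
  together with \<open>V\<close>.\<close>

lemma is_facet_P: "is_facet G P \<longleftrightarrow> (\<exists>S\<in>B - {V}. G = F {V, S})"
proof
  assume G: "is_facet G P"
  then have "G face_of P" "G \<noteq> {}" unfolding is_facet_def by auto
  then obtain N where N: "nested V B N" "G = F N" by (rule face_eq_F)
  have "N \<noteq> {V}" using G N(2) F_V unfolding is_facet_def by auto
  then obtain S where S: "S \<in> N" "S \<noteq> V" using nested_top[OF N(1)] by blast
  have SB: "S \<in> B" using S nested_subset[OF N(1)] by blast
  have "G \<subseteq> F {V, S}"
    unfolding N(2) using F_subset_iff[OF N(1) nested_pair[OF SB]] S nested_top[OF N(1)] by simp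
  moreover have "F {V, S} \<noteq> P"
    using F_eq_iff[OF nested_pair[OF SB] nested_V] S F_V by auto
  ultimately have "F {V, S} = G"
    using G F_nested_face[OF nested_pair[OF SB]] unfolding is_facet_def by blast
  then show "\<exists>S\<in>B - {V}. G = F {V, S}" using S SB by blast
next
  assume "\<exists>S\<in>B - {V}. G = F {V, S}"
  then obtain S where S: "S \<in> B" "S \<noteq> V" "G = F {V, S}" by blast
  note nS = nested_pair[OF S(1)]
  show "is_facet G P"
  proof (rule is_facetI)
    show "G face_of P" "G \<noteq> {}" unfolding S(3) using F_nested_face[OF nS] F_nonempty[OF nS] by auto
    show "G \<noteq> P" unfolding S(3) F_V[symmetric] using F_eq_iff[OF nS nested_V] S(2) by auto
    fix H assume H: "H face_of P" "G \<subseteq> H" "H \<noteq> P"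
    then have "H \<noteq> {}" using \<open>G \<noteq> {}\<close> by auto
    with H(1) obtain N where N: "nested V B N" "H = F N" by (rule face_eq_F)
    have "N \<subseteq> {V, S}" using H(2) F_subset_iff[OF nS N(1)] unfolding S(3) N(2) by simp
    moreover have "N \<noteq> {V}" using H(3) N(2) F_V by auto
    ultimately have "N = {V, S}" using nested_top[OF N(1)] by blast
    then show "H = G" unfolding N(2) S(3) by simp
  qed
qed

lemma F_pair_inj: "inj_on (\<lambda>S. F {V, S}) (B - {V})"
proof (rule inj_onI)
  fix S T assume "S \<in> B - {V}" "T \<in> B - {V}" "F {V, S} = F {V, T}"
  then show "S = T" using F_eq_iff[OF nested_pair nested_pair, of S T] by (auto simp: doubleton_eq_iff)
qed

lemma c_singleton:
  assumes N: "nested V B N" and Fv: "F N = {v}" and T: "T \<in> B"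
  shows "is_singleton (c N T)"
proof -
  have "i = j" if ij: "i \<in> c N T" "j \<in> c N T" for i j
  proof (rule ccontr)
    assume ne: "i \<noteq> j"
    \<comment> \<open>Concentrating the summand \<open>T\<close> at \<open>i\<close> or at
      \<open>j\<close> would give two different points of a one-point face.\<close>
    define y where "y k = (\<lambda>S. bary (c N S))(T := bary {k})" for k
    have ys: "(\<Sum>S\<in>B. y k S) \<in> F N" if "k \<in> c N T" for k
      unfolding F_eq[OF nested_subset[OF N]]
    proof (rule msumI)
      fix S assume S: "S \<in> B"
      have "bary {k} \<in> unit_simplex (c N T)"
        using that simplex_iff_mono[OF finite_c[OF T], of "{k}" N "bary {k}"] bary_simplex[of "{k}"] by simp
      then show "y k S \<in> unit_simplex (c N S)"
        using bary_simplex[OF finite_c c_nonempty[OF N]] S unfolding y_def by auto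
    qed
    have split: "(\<Sum>S\<in>B. y k S) = bary {k} + (\<Sum>S\<in>B - {T}. bary (c N S))" for k
      using finite_B T by (subst sum.remove[of B T]) (auto simp: y_def intro!: sum.cong)
    have "bary {i} = (bary {j} :: 'v \<Rightarrow>\<^sub>0 real)" using ys[OF ij(1)] ys[OF ij(2)] unfolding Fv split singleton_iff
      by (metis add_right_cancel)
    then have "Poly_Mapping.keys (bary {i}) = Poly_Mapping.keys (bary {j})" by simp
    then show False using ne bary_simplex(2)[of "{i}"] bary_simplex(2)[of "{j}"] by simp
  qed
  then show ?thesis using c_nonempty[OF N T] by (intro is_singletonI') auto
qed

text \<open>At a vertex each \<open>S\<close> in \<open>N\<close> retains a single element of its
  own. Distinct members retain distinct elements, because the element of \<open>S\<close> lies in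
  another member only if that member contains \<open>S\<close>; and every \<open>i\<close> is
  retained by the smallest member containing it.\<close>

lemma card_nested_vertex:
  assumes N: "nested V B N" and Fv: "F N = {v}"
  shows "card N = card V"
proof (rule bij_betw_same_card)
  let ?h = "\<lambda>S. the_elem (c N S)"
  have NB: "N \<subseteq> B" by (rule nested_subset[OF N])
  have c: "c N S = {?h S}" if "S \<in> N" for S
    using c_singleton[OF N Fv subsetD[OF NB that]] by (simp add: is_singleton_the_elem)
  have hS: "?h S \<in> S" if "S \<in> N" for S using c[OF that] c_subset[of N S] by auto
  have below: "S \<subseteq> T" if "S \<in> N" "T \<in> N" "?h S \<in> T" for S T
  proof (rule ccontr)
    assume "\<not> S \<subseteq> T"
    then have "?h S \<notin> c N S" using that unfolding c_def by blast
    then show False using c[OF that(1)] by blast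
  qed
  show "bij_betw ?h N V"
    unfolding bij_betw_def
  proof
    show "inj_on ?h N"
      using below hS by (intro inj_onI subset_antisym) metis+
    show "?h ` N = V"
    proof
      show "?h ` N \<subseteq> V" using hS NB B_subset by blast
      show "V \<subseteq> ?h ` N"
      proof
        fix i assume i: "i \<in> V"
        obtain R where R: "R \<in> N" "{i} \<subseteq> R" "\<And>R'. R' \<in> N \<Longrightarrow> {i} \<subseteq> R' \<Longrightarrow> R \<subseteq> R'"
          using smallest_above[OF N B_singleton[OF i]] by metis
        then have "i \<in> c N R" unfolding c_def by blast
        then show "i \<in> ?h ` N" using c[OF R(1)] R(1) by auto
      qed
    qed
  qed
qed

section \<open>Dimension and simplicity of a nestohedron\<close>

lemma mass_V: "x \<in> P \<Longrightarrow> mass x V = low V"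
  using F_V unfolding F_def by auto

lemma keys_P:
  assumes "x \<in> P" shows "Poly_Mapping.keys x \<subseteq> V"
proof
  fix i assume i: "i \<in> Poly_Mapping.keys x"
  obtain y where y: "x = (\<Sum>T\<in>B. y T)" "\<And>T. T \<in> B \<Longrightarrow> y T \<in> unit_simplex T" using assms by (rule msumE) blast
  have "\<exists>T\<in>B. Poly_Mapping.lookup (y T) i \<noteq> 0"
  proof (rule ccontr)
    assume "\<not> ?thesis"
    then have "Poly_Mapping.lookup x i = 0" unfolding y(1) lookup_sum_poly by simp
    then show False using i by (simp add: in_keys_iff)
  qed
  then obtain T where T: "T \<in> B" "i \<in> Poly_Mapping.keys (y T)" by (auto simp: in_keys_iff)
  then show "i \<in> V" using simplex_keys[OF y(2)[OF T(1)]] B_subset[OF T(1)] by blast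
qed

lemma pdim_P: "pdim P = card V - 1"
proof -
  obtain r where r: "r \<in> V" using V_nonempty by blast
  let ?e = "\<lambda>i. Poly_Mapping.single i (1::real) :: 'v \<Rightarrow>\<^sub>0 real"
  let ?d = "\<lambda>i. ?e i - ?e r"
  let ?b = "?d ` (V - {r})"
  have ld: "Poly_Mapping.lookup (?d i) k = (if k = i then 1 else 0) - (if k = r then 1 else 0)" for i k
    by (simp add: lookup_minus lookup_single when_def)
  have inj: "inj_on ?d (V - {r})"
  proof (rule inj_onI)
    fix i j assume ij: "i \<in> V - {r}" "j \<in> V - {r}" "?d i = ?d j"
    then have "Poly_Mapping.lookup (?d i) i = Poly_Mapping.lookup (?d j) i" by simp
    then show "i = j" using ij unfolding ld by (auto split: if_splits)
  qed
  have fin: "finite ?b" using finite_V by simp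
  have ind: "independent ?b"
    unfolding real_vector.dependent_finite[OF fin]
  proof (intro notI, elim exE conjE bexE)
    fix u v assume v: "v \<in> ?b" "u v \<noteq> 0" and z: "(\<Sum>v\<in>?b. u v *\<^sub>R v) = 0"
    obtain i where i: "i \<in> V - {r}" "v = ?d i" using v(1) by blast
    have "0 = Poly_Mapping.lookup (\<Sum>v\<in>?b. u v *\<^sub>R v) i" unfolding z by simp
    also have "\<dots> = (\<Sum>k\<in>V - {r}. u (?d k) * Poly_Mapping.lookup (?d k) i)"
      by (simp only: lookup_sum_poly lookup_scaleR sum.reindex[OF inj] o_def)
    also have "\<dots> = (\<Sum>k\<in>V - {r}. if i = k then u (?d k) else 0)"
      unfolding ld using i by (intro sum.cong) auto
    also have "\<dots> = u v" using i finite_V by simp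
    finally show False using v(2) by simp
  qed
  have "?b \<subseteq> point_diffs P"
  proof
    fix z assume "z \<in> ?b"
    then obtain i where i: "i \<in> V" "z = ?d i" by blast
    \<comment> \<open>Only the summand of \<open>V\<close> is changed, and it may be any vertex of
      the full simplex.\<close>
    define y where "y k = (\<lambda>S. bary S)(V := ?e k)" for k
    have ek: "?e k \<in> unit_simplex V" if "k \<in> V" for k
      using that finite_V by (auto simp: unit_simplex_def lookup_single when_def)
    have ys: "(\<Sum>S\<in>B. y k S) \<in> P" if "k \<in> V" for k
      using bary_simplex[OF B_finite B_nonempty] ek[OF that] unfolding y_def by (intro msumI) auto
    have split: "(\<Sum>S\<in>B. y k S) = ?e k + (\<Sum>S\<in>B - {V}. bary S)" for k
      using finite_B V_in by (subst sum.remove[of B V]) (auto simp: y_def intro!: sum.cong)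
    have "z = (\<Sum>S\<in>B. y i S) - (\<Sum>S\<in>B. y r S)" unfolding split i(2) by simp
    then show "z \<in> point_diffs P" unfolding point_diffs_def using ys i(1) r by blast
  qed
  moreover have "point_diffs P \<subseteq> span ?b"
  proof
    fix z assume "z \<in> point_diffs P"
    then obtain x y where xy: "x \<in> P" "y \<in> P" "z = x - y" unfolding point_diffs_def by blast
    have kz: "Poly_Mapping.keys z \<subseteq> V"
      unfolding xy(3) using keys_P[OF xy(1)] keys_P[OF xy(2)] keys_diff[of x y] by blast
    have mz: "(\<Sum>i\<in>V. Poly_Mapping.lookup z i) = 0"
      using mass_V[OF xy(1)] mass_V[OF xy(2)] unfolding mass_def xy(3)
      by (simp add: lookup_minus sum_subtractf)
    \<comment> \<open>The subtracted multiple of \<open>?e r\<close> is zero, since coordinate sums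
      are constant on the polytope. It turns the unit vectors into differences from
      \<open>?e r\<close>.\<close>
    have "z = (\<Sum>i\<in>V. Poly_Mapping.lookup z i *\<^sub>R ?e i) - (\<Sum>i\<in>V. Poly_Mapping.lookup z i) *\<^sub>R ?e r"
      using poly_mapping_expansion[OF finite_V kz] mz by simp
    also have "\<dots> = (\<Sum>i\<in>V. Poly_Mapping.lookup z i *\<^sub>R ?d i)"
      by (simp add: scaleR_sum_left sum_subtractf[symmetric] scaleR_diff_right)
    also have "\<dots> \<in> span ?b"
    proof (intro real_vector.span_sum real_vector.span_scale)
      fix i assume "i \<in> V"
      then show "?d i \<in> span ?b"
        by (cases "i = r") (auto intro: real_vector.span_base real_vector.span_zero)
    qed
    finally show "z \<in> span ?b" .
  qed
  ultimately have "span ?b = span (point_diffs P)"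
    by (simp add: real_vector.span_eq subset_trans[OF _ real_vector.span_superset])
  then have "dim (point_diffs P) = card ?b" using ind by (rule real_vector.dim_eq_card)
  also have "\<dots> = card V - 1" using card_image[OF inj] r finite_V by simp
  finally show ?thesis unfolding pdim_def .
qed

text \<open>A vertex lies on the facets of exactly the members of its nested set other than
  \<open>V\<close>. Their number is \<open>card V - 1\<close>, which is also the dimension.\<close>

lemma simple_P: "simple_polytope P"
  unfolding simple_polytope_def
proof (intro conjI allI impI)
  show "polytope P" using finite_B B_finite by (rule polytope_msum)
  show "P \<noteq> {}" using F_nonempty[OF nested_V] F_V by simp
  fix v assume "v extreme_point_of P"
  then have v: "{v} face_of P" by (simp add: face_of_singleton)
  then obtain N where N: "nested V B N" "{v} = F N" by (rule face_eq_F) auto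
  have iff: "v \<in> F {V, S} \<longleftrightarrow> S \<in> N" if "S \<in> B" for S
    using F_subset_iff[OF N(1) nested_pair[OF that]] N nested_top[OF N(1)] by auto
  have "{G. is_facet G P \<and> v \<in> G} = (\<lambda>S. F {V, S}) ` (N - {V})"
    unfolding is_facet_P using iff nested_subset[OF N(1)] by blast
  also have "card \<dots> = card (N - {V})"
    using nested_subset[OF N(1)] by (intro card_image inj_on_subset[OF F_pair_inj]) blast
  also have "\<dots> = card V - 1"
    using card_nested_vertex[OF N(1) N(2)[symmetric]] nested_top[OF N(1)] by simp
  finally show "card {G. is_facet G P \<and> v \<in> G} = pdim P" unfolding pdim_P .
qed

text \<open>Provides the vertices required by \<open>pdim_comb_equiv\<close>: a face is again a
  Minkowski sum of simplices, hence a polytope.\<close>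

lemma face_extreme_point:
  assumes "G face_of P" "G \<noteq> {}" shows "\<exists>w. w extreme_point_of G"
proof -
  obtain N where N: "nested V B N" "G = F N" using assms by (rule face_eq_F)
  have "polytope G" unfolding N(2) F_eq[OF nested_subset[OF N(1)]]
    using finite_B finite_c by (rule polytope_msum)
  then show ?thesis using assms(2) polytope_extreme_point by blast
qed

end

section \<open>Facets of a nestohedron\<close>

definition restr :: "'v set set \<Rightarrow> 'v set \<Rightarrow> 'v set set"
  where "restr B S = {T\<in>B. T \<subseteq> S}"

text \<open>For \<open>S\<close> in \<open>B\<close> these are the nonempty sets
  \<open>T - S\<close> with \<open>T\<close> in \<open>B\<close>: a \<open>T\<close> meeting
  \<open>S\<close> may be replaced by \<open>T \<union> S\<close>, so only \<open>U\<close> and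
  \<open>U \<union> S\<close> have to be tested.\<close>

definition contr :: "'v set \<Rightarrow> 'v set set \<Rightarrow> 'v set \<Rightarrow> 'v set set"
  where "contr V B S = {U. U \<noteq> {} \<and> U \<subseteq> V - S \<and> (U \<in> B \<or> U \<union> S \<in> B)}"

text \<open>For a nested set containing \<open>S\<close>, \<open>lift\<close> inverts \<open>T \<mapsto> T - S\<close> on the members not contained in \<open>S\<close>.\<close>

definition lift :: "'v set set \<Rightarrow> 'v set \<Rightarrow> 'v set \<Rightarrow> 'v set"
  where "lift B S U = (if U \<union> S \<in> B then U \<union> S else U)"

context connected_building_set
begin

lemma restr_connected:
  assumes S: "S \<in> B" shows "connected_building_set S (restr B S)"
proof
  show "building_set S (restr B S)"
    unfolding building_set_def restr_def
    using S B_finite B_nonempty B_singleton[OF subsetD[OF B_subset[OF S]]] B_Un by auto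
  show "S \<in> restr B S" using S by (simp add: restr_def)
qed

lemma contr_connected:
  assumes S: "S \<in> B" "S \<noteq> V" shows "connected_building_set (V - S) (contr V B S)"
proof
  have VS: "V - S \<union> S = V" using B_subset[OF S(1)] by blast
  show "V - S \<in> contr V B S" using VS S V_in B_subset[OF S(1)] by (auto simp: contr_def)
  have "T \<union> U \<in> contr V B S" if TU: "T \<in> contr V B S" "U \<in> contr V B S" "T \<inter> U \<noteq> {}" for T U
  proof -
    have "T \<union> U \<in> B \<or> T \<union> U \<union> S \<in> B"
    proof -
      obtain T' U' where T': "T' \<in> B" "T' = T \<or> T' = T \<union> S" and U': "U' \<in> B" "U' = U \<or> U' = U \<union> S"
        using TU unfolding contr_def by blast
      have "T' \<union> U' \<in> B" using T' U' TU(3) by (intro B_Un) auto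
      moreover have "T' \<union> U' = T \<union> U \<or> T' \<union> U' = T \<union> U \<union> S" using T'(2) U'(2) by blast
      ultimately show ?thesis by auto
    qed
    then show ?thesis using TU unfolding contr_def by blast
  qed
  then show "building_set (V - S) (contr V B S)"
    unfolding building_set_def using finite_V S B_subset[OF S(1)] B_singleton by (auto simp: contr_def)
qed

lemma lift_in_B: "U \<in> contr V B S \<Longrightarrow> lift B S U \<in> B"
  by (auto simp: lift_def contr_def)

lemma lift_Diff: "U \<in> contr V B S \<Longrightarrow> lift B S U - S = U"
  by (auto simp: lift_def contr_def)

lemma lift_not_subset: "U \<in> contr V B S \<Longrightarrow> \<not> lift B S U \<subseteq> S"
  by (auto simp: lift_def contr_def)

lemma nested_diff_lift:
  assumes N: "nested V B N" and S: "S \<in> N" and T: "T \<in> N" "\<not> T \<subseteq> S"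
  shows "T - S \<in> contr V B S" "lift B S (T - S) = T"
proof -
  have TB: "T \<in> B" "S \<in> B" using nested_subset[OF N] S T by auto
  consider "S \<subseteq> T" | "S \<inter> T = {}" using nested_cases[OF N S T(1)] T(2) by blast
  then have "T - S \<in> contr V B S \<and> lift B S (T - S) = T"
  proof cases
    case 1
    then have "T - S \<union> S = T" by blast
    then show ?thesis using TB T B_subset[OF TB(1)] by (auto simp: lift_def contr_def)
  next
    case 2
    \<comment> \<open>Otherwise the two disjoint members \<open>T\<close> and \<open>S\<close> of a
      nested set would have their union in \<open>B\<close>. This makes the preference of
      \<open>lift\<close> for the larger set the right one.\<close>
    have "T \<union> S \<notin> B"
    proof
      assume "T \<union> S \<in> B"
      then have "\<Union>{T, S} \<in> {T, S}" using S T by (intro nestedD[OF N]) auto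
      then show False using 2 T(2) B_nonempty[OF TB(2)] by auto
    qed
    moreover have "T - S = T" using 2 by blast
    ultimately show ?thesis using TB T(2) B_subset[OF TB(1)] 2 by (auto simp: lift_def contr_def)
  qed
  then show "T - S \<in> contr V B S" "lift B S (T - S) = T" by auto
qed

text \<open>A nested set through \<open>S\<close> splits into its members inside \<open>S\<close>
  and the traces of the others on the complement; \<open>link\<close> reverses this.\<close>

definition unlink :: "'v set \<Rightarrow> 'v set set \<Rightarrow> 'v set set \<times> 'v set set"
  where "unlink S N = ({T\<in>N. T \<subseteq> S}, (\<lambda>T. T - S) ` {T\<in>N. \<not> T \<subseteq> S})"

definition link :: "'v set \<Rightarrow> 'v set set \<times> 'v set set \<Rightarrow> 'v set set"
  where "link S = (\<lambda>(N1, N2). N1 \<union> lift B S ` N2)"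

lemma link_unlink:
  assumes N: "nested V B N" "S \<in> N" shows "link S (unlink S N) = N"
proof -
  let ?A = "{T\<in>N. \<not> T \<subseteq> S}"
  have "lift B S ` (\<lambda>T. T - S) ` ?A = (\<lambda>T. lift B S (T - S)) ` ?A" by (rule image_image)
  also have "\<dots> = (\<lambda>T. T) ` ?A" using nested_diff_lift(2)[OF N] by (intro image_cong) auto
  finally have "lift B S ` (\<lambda>T. T - S) ` ?A = ?A" by (simp only: image_ident)
  then show ?thesis unfolding link_def unlink_def by auto
qed

lemma unlink_link:
  assumes "N1 \<subseteq> restr B S" "N2 \<subseteq> contr V B S" shows "unlink S (link S (N1, N2)) = (N1, N2)"
proof -
  have n1: "\<And>T. T \<in> N1 \<Longrightarrow> T \<subseteq> S" using assms(1) by (auto simp: restr_def)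
  have n2: "\<And>U. U \<in> N2 \<Longrightarrow> \<not> lift B S U \<subseteq> S" using lift_not_subset assms(2) by blast
  have "{T \<in> N1 \<union> lift B S ` N2. T \<subseteq> S} = N1"
    "{T \<in> N1 \<union> lift B S ` N2. \<not> T \<subseteq> S} = lift B S ` N2"
    by (auto simp: n2 dest: subsetD[OF n1])
  moreover have "(\<lambda>T. T - S) ` lift B S ` N2 = N2"
  proof -
    have "(\<lambda>T. T - S) ` lift B S ` N2 = (\<lambda>U. lift B S U - S) ` N2" by (rule image_image)
    also have "\<dots> = (\<lambda>U. U) ` N2" using assms(2) by (intro image_cong[OF refl lift_Diff]) blast
    finally show ?thesis by (simp only: image_ident)
  qed
  ultimately show ?thesis unfolding link_def unlink_def by simp
qed

lemma nested_unlink: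
  assumes N: "nested V B N" "S \<in> N" and SV: "S \<noteq> V"
  shows "nested S (restr B S) (fst (unlink S N))" "nested (V - S) (contr V B S) (snd (unlink S N))"
proof -
  have NB: "N \<subseteq> B" by (rule nested_subset[OF N(1)])
  have SB: "S \<in> B" using N NB by blast
  show "nested S (restr B S) (fst (unlink S N))"
    unfolding nested_def unlink_def fst_conv
  proof (intro conjI allI impI)
    show "{T \<in> N. T \<subseteq> S} \<subseteq> restr B S" "S \<in> {T \<in> N. T \<subseteq> S}" using NB N by (auto simp: restr_def)
    fix M assume "M \<subseteq> {T \<in> N. T \<subseteq> S}" "M \<noteq> {}" "\<Union>M \<in> restr B S"
    then show "\<Union>M \<in> M" by (intro nestedD[OF N(1)]) (auto simp: restr_def)
  qed
  show "nested (V - S) (contr V B S) (snd (unlink S N))"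
    unfolding nested_def
  proof (intro conjI allI impI)
    show sub: "snd (unlink S N) \<subseteq> contr V B S"
      unfolding unlink_def using nested_diff_lift(1)[OF N] by auto
    have "\<not> V \<subseteq> S" using SV B_subset[OF SB] by blast
    then show "V - S \<in> snd (unlink S N)" unfolding unlink_def using nested_top[OF N(1)] by auto
    fix M assume M: "M \<subseteq> snd (unlink S N)" "M \<noteq> {}" "\<Union>M \<in> contr V B S"
    have lN: "lift B S ` M \<subseteq> N"
    proof
      fix L assume "L \<in> lift B S ` M"
      then obtain U where U: "U \<in> M" "L = lift B S U" by blast
      then obtain T where "T \<in> N" "\<not> T \<subseteq> S" "U = T - S"
        using M(1) unfolding unlink_def snd_conv by blast
      with U(2) show "L \<in> N" using nested_diff_lift(2)[OF N] by simp
    qed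
    have MC: "U \<in> contr V B S" if "U \<in> M" for U using M(1) sub that by blast
    show "\<Union>M \<in> M"
    proof (cases "\<Union>M \<union> S \<in> B")
      case True
      \<comment> \<open>Adding \<open>S\<close> itself makes the union exact whether or not the
        individual lifts contain \<open>S\<close>.\<close>
      have "\<Union>(insert S (lift B S ` M)) = \<Union>M \<union> S"
        by (auto simp: lift_def split: if_splits)
      then have "\<Union>M \<union> S \<in> insert S (lift B S ` M)"
        using nestedD[OF N(1), of "insert S (lift B S ` M)"] lN N(2) True by auto
      moreover have "\<Union>M \<union> S \<noteq> S" using M(3) by (auto simp: contr_def)
      ultimately obtain U where U: "U \<in> M" "\<Union>M \<union> S = lift B S U" by blast
      have "\<Union>M = lift B S U - S" using U(2) M(3) by (auto simp: contr_def)
      then show ?thesis using lift_Diff[OF MC[OF U(1)]] U(1) by simp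
    next
      case False
      have MB: "\<Union>M \<in> B" using False M(3) by (auto simp: contr_def)
      \<comment> \<open>A single lift containing \<open>S\<close> would glue \<open>S\<close> to the
        whole union, contrary to the present case.\<close>
      have "lift B S U = U" if U: "U \<in> M" for U
      proof (rule ccontr)
        assume "lift B S U \<noteq> U"
        then have "U \<union> S \<in> B" by (auto simp: lift_def split: if_splits)
        moreover have "(U \<union> S) \<inter> \<Union>M \<noteq> {}" using U MC[OF U] by (auto simp: contr_def)
        ultimately have "(U \<union> S) \<union> \<Union>M \<in> B" using MB B_Un by blast
        moreover have "(U \<union> S) \<union> \<Union>M = \<Union>M \<union> S" using U by blast
        ultimately show False using False by simp
      qed
      then have "lift B S ` M = M" by (simp add: image_def)
      then show ?thesis using nestedD[OF N(1) _ M(2) MB] lN by simp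
    qed
  qed
qed

lemma nested_link:
  assumes S: "S \<in> B" "S \<noteq> V"
    and N1: "nested S (restr B S) N1" and N2: "nested (V - S) (contr V B S) N2"
  shows "nested V B (link S (N1, N2))" "S \<in> link S (N1, N2)"
proof -
  have sub1: "N1 \<subseteq> restr B S" and sub2: "N2 \<subseteq> contr V B S"
    using N1 N2 by (simp_all add: nested_subset)
  show "S \<in> link S (N1, N2)" using nested_top[OF N1] by (simp add: link_def)
  show "nested V B (link S (N1, N2))"
    unfolding nested_def
  proof (intro conjI allI impI)
    show "link S (N1, N2) \<subseteq> B"
      unfolding link_def using sub1 sub2 lift_in_B by (auto simp: restr_def)
    have "V - S \<union> S = V" using B_subset[OF S(1)] by blast
    then have "lift B S (V - S) = V" using V_in by (simp add: lift_def)
    moreover have "V - S \<in> N2" by (rule nested_top[OF N2])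
    ultimately show "V \<in> link S (N1, N2)" unfolding link_def by force
    fix M assume M: "M \<subseteq> link S (N1, N2)" "M \<noteq> {}" "\<Union>M \<in> B"
    define M1 where "M1 = {T\<in>M. T \<in> N1}"
    define M2 where "M2 = {U\<in>N2. lift B S U \<in> M}"
    have Meq: "M = M1 \<union> lift B S ` M2"
      using M(1) unfolding link_def M1_def M2_def by auto
    have M1S: "\<Union>M1 \<subseteq> S" using sub1 unfolding M1_def restr_def by blast
    have M2S: "\<Union>M2 \<inter> S = {}" using sub2 unfolding M2_def contr_def by blast
    show "\<Union>M \<in> M"
    proof (cases "M2 = {}")
      case True
      then have "M = M1" using Meq by simp
      then show ?thesis
        using nestedD[OF N1, of M] M M1S unfolding M1_def restr_def by auto
    next
      case False
      have "\<Union>(lift B S ` M2) - S = \<Union>M2"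
        using lift_Diff sub2 unfolding M2_def by blast
      then have diff: "\<Union>M - S = \<Union>M2" using M1S unfolding Meq by blast
      \<comment> \<open>As soon as the union meets \<open>S\<close>, its trace together with
        \<open>S\<close> lies in \<open>B\<close>, so the lift of the trace contains
        \<open>S\<close>. Thus the lift of \<open>\<Union>M2\<close> covers all of
        \<open>\<Union>M\<close> in either case, and nestedness of \<open>N2\<close> makes it a
        member of \<open>M\<close>.\<close>
      have UnS: "\<Union>M2 \<union> S \<in> B" if "\<Union>M \<inter> S \<noteq> {}"
      proof -
        have "\<Union>M \<union> S \<in> B" using B_Un[OF M(3) S(1) that] .
        moreover have "\<Union>M \<union> S = \<Union>M2 \<union> S" using diff by blast
        ultimately show ?thesis by simp
      qed
      have "\<Union>M2 \<in> B \<or> \<Union>M2 \<union> S \<in> B"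
      proof (cases "\<Union>M \<inter> S = {}")
        case True
        then have "\<Union>M = \<Union>M2" using diff by blast
        then show ?thesis using M(3) by simp
      qed (use UnS in simp)
      moreover have "\<Union>M2 \<noteq> {}" "\<Union>M2 \<subseteq> V - S"
        using False sub2 unfolding M2_def contr_def by blast+
      ultimately have "\<Union>M2 \<in> contr V B S" by (simp add: contr_def)
      then have "\<Union>M2 \<in> M2" using False by (intro nestedD[OF N2]) (auto simp: M2_def)
      then have l: "lift B S (\<Union>M2) \<in> M" unfolding M2_def by simp
      have "\<Union>M \<subseteq> lift B S (\<Union>M2)"
      proof (cases "\<Union>M \<inter> S = {}")
        case True then show ?thesis using diff by (auto simp: lift_def)
      next
        case False then show ?thesis using diff UnS by (auto simp: lift_def)
      qed
      then have "\<Union>M = lift B S (\<Union>M2)" using l by blast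
      then show ?thesis using l by simp
    qed
  qed
qed

lemma bij_betw_link:
  assumes S: "S \<in> B" "S \<noteq> V"
  shows "bij_betw (link S) ({N. nested S (restr B S) N} \<times> {N. nested (V - S) (contr V B S) N})
    {N. nested V B N \<and> S \<in> N}"
proof (rule bij_betw_byWitness[where f' = "unlink S"])
  show "\<forall>a\<in>{N. nested S (restr B S) N} \<times> {N. nested (V - S) (contr V B S) N}. unlink S (link S a) = a"
    by (auto dest!: nested_subset intro: unlink_link)
  show "\<forall>a'\<in>{N. nested V B N \<and> S \<in> N}. link S (unlink S a') = a'"
    using link_unlink by auto
  show "link S ` ({N. nested S (restr B S) N} \<times> {N. nested (V - S) (contr V B S) N})
      \<subseteq> {N. nested V B N \<and> S \<in> N}"
    using nested_link[OF S] by auto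
  show "unlink S ` {N. nested V B N \<and> S \<in> N}
      \<subseteq> {N. nested S (restr B S) N} \<times> {N. nested (V - S) (contr V B S) N}"
    by (intro image_subsetI) (simp add: mem_Times_iff nested_unlink S(2))
qed

lemma link_subset_iff:
  assumes "nested S (restr B S) N1" "nested (V - S) (contr V B S) N2"
    and "nested S (restr B S) M1" "nested (V - S) (contr V B S) M2"
  shows "link S (M1, M2) \<subseteq> link S (N1, N2) \<longleftrightarrow> M1 \<subseteq> N1 \<and> M2 \<subseteq> N2"
proof
  assume "link S (M1, M2) \<subseteq> link S (N1, N2)"
  then have "fst (unlink S (link S (M1, M2))) \<subseteq> fst (unlink S (link S (N1, N2)))"
    "snd (unlink S (link S (M1, M2))) \<subseteq> snd (unlink S (link S (N1, N2)))"
    unfolding unlink_def by auto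
  then show "M1 \<subseteq> N1 \<and> M2 \<subseteq> N2" using unlink_link assms[THEN nested_subset] by simp
qed (auto simp: link_def)

text \<open>Faces of the facet are indexed by the nested sets containing \<open>S\<close>, faces of
  the product by pairs of nested sets; \<open>link\<close> identifies the two posets.\<close>

lemma facet_comb_equiv:
  assumes S: "S \<in> B" "S \<noteq> V"
  shows "comb_equiv (F {V, S}) (nestohedron (restr B S) \<times> nestohedron (contr V B S))"
proof -
  interpret R: connected_building_set S "restr B S" by (rule restr_connected[OF S(1)])
  interpret C: connected_building_set "V - S" "contr V B S" by (rule contr_connected[OF S])
  let ?A = "{N. nested S (restr B S) N} \<times> {N. nested (V - S) (contr V B S) N}"
  have "face_model (F {V, S}) ?A (F \<circ> link S) (\<lambda>(a, b) (c, d). c \<subseteq> a \<and> d \<subseteq> b)"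
    by (rule face_model_reindex[OF face_model_facet[OF S(1)] bij_betw_link[OF S]])
      (clarsimp simp: link_subset_iff)
  moreover have "face_model (R.P \<times> C.P) ?A (\<lambda>(a, b). R.F a \<times> C.F b) (\<lambda>(a, b) (c, d). c \<subseteq> a \<and> d \<subseteq> b)"
    by (rule face_model_Times[OF R.face_model_nested C.face_model_nested])
  ultimately show ?thesis
    unfolding R.nestohedron_eq C.nestohedron_eq by (rule comb_equiv_face_models)
qed

end

subsection \<open>Isomorphic building sets\<close>

lemma nested_image:
  assumes f: "inj_on f V" and B: "B \<subseteq> Pow V" and N: "nested V B N"
  shows "nested (f ` V) ((`) f ` B) ((`) f ` N)"
  unfolding nested_def
proof (intro conjI allI impI)
  show "(`) f ` N \<subseteq> (`) f ` B" using nested_subset[OF N] by blast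
  show "f ` V \<in> (`) f ` N" using nested_top[OF N] by blast
  fix M assume M: "M \<subseteq> (`) f ` N" "M \<noteq> {}" "\<Union>M \<in> (`) f ` B"
  obtain M0 where M0: "M0 \<subseteq> N" "M = (`) f ` M0" using M(1) by (meson subset_imageE)
  obtain T where T: "T \<in> B" "\<Union>M = f ` T" using M(3) by blast
  have "f ` \<Union>M0 = f ` T" using T(2) unfolding M0(2) by (simp add: image_Union)
  moreover have "\<Union>M0 \<subseteq> V" "T \<subseteq> V" using M0(1) nested_subset[OF N] B T(1) by blast+
  ultimately have "\<Union>M0 = T" using inj_on_image_eq_iff[OF f, of "\<Union>M0" T] by simp
  moreover have "M0 \<noteq> {}" using M(2) M0(2) by blast
  ultimately have "\<Union>M0 \<in> M0" using nestedD[OF N M0(1)] T(1) by simp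
  then have "f ` \<Union>M0 \<in> M" unfolding M0(2) by (rule imageI)
  then show "\<Union>M \<in> M" unfolding T(2) \<open>f ` \<Union>M0 = f ` T\<close> .
qed

lemma connected_building_set_image:
  assumes f: "inj_on f V" and B: "connected_building_set V B"
  shows "connected_building_set (f ` V) ((`) f ` B)"
proof -
  interpret connected_building_set V B by (rule B)
  show ?thesis
  proof
    have "f ` S \<union> f ` T \<in> (`) f ` B" if ST: "S \<in> B" "T \<in> B" "f ` S \<inter> f ` T \<noteq> {}" for S T
    proof -
      have "S \<inter> T \<noteq> {}"
        using ST(3) inj_on_image_Int[OF f B_subset[OF ST(1)] B_subset[OF ST(2)]] by auto
      then have "S \<union> T \<in> B" by (rule B_Un[OF ST(1,2)])
      then show ?thesis by (auto simp: image_Un[symmetric])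
    qed
    moreover have "{f i} \<in> (`) f ` B" if "i \<in> V" for i
      using B_singleton[OF that] by (auto intro!: image_eqI[of _ _ "{i}"])
    moreover have "f ` S \<noteq> {} \<and> f ` S \<subseteq> f ` V" if "S \<in> B" for S
      using B_nonempty[OF that] B_subset[OF that] by blast
    ultimately show "building_set (f ` V) ((`) f ` B)"
      unfolding building_set_def using finite_V V_nonempty by auto
    show "f ` V \<in> (`) f ` B" using V_in by blast
  qed
qed

text \<open>Nested sets model the face poset, so it suffices to transport them; the relabelling has
  to be injective on the ground set only.\<close>

lemma comb_equiv_nestohedron_image:
  assumes f: "inj_on f V" and B: "connected_building_set V B"
  shows "comb_equiv (nestohedron B) (nestohedron ((`) f ` B))"
proof -
  interpret C: connected_building_set V B by (rule B)
  interpret I: connected_building_set "f ` V" "(`) f ` B" by (rule connected_building_set_image[OF assms])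
  let ?g = "inv_into V f"
  have BV: "B \<subseteq> Pow V" using C.B_subset by blast
  have g: "inj_on ?g (f ` V)" using f by (simp add: inj_on_inv_into)
  have gf: "?g ` f ` S = S" if "S \<subseteq> V" for S using f that by (simp add: inv_into_image_cancel)
  have gfB: "(`) ?g ` (`) f ` N = N" if "N \<subseteq> B" for N
  proof -
    have "(`) ?g ` (`) f ` N = (\<lambda>S. ?g ` f ` S) ` N" by (rule image_image)
    also have "\<dots> = (\<lambda>S. S) ` N"
      using BV that by (intro image_cong[OF refl gf]) blast
    finally show ?thesis by (simp only: image_ident)
  qed
  have fg: "f ` ?g ` S = S" if "S \<subseteq> f ` V" for S using that by (rule image_inv_into_cancel[OF refl])
  have fgB: "(`) f ` (`) ?g ` N = N" if "N \<subseteq> (`) f ` B" for N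
  proof -
    have "(`) f ` (`) ?g ` N = (\<lambda>S. f ` ?g ` S) ` N" by (rule image_image)
    also have "\<dots> = (\<lambda>S. S) ` N"
      using that I.B_subset by (intro image_cong[OF refl fg]) blast
    finally show ?thesis by (simp only: image_ident)
  qed
  have "bij_betw ((`) ((`) f)) {N. nested V B N} {N. nested (f ` V) ((`) f ` B) N}"
  proof (rule bij_betw_byWitness[where f' = "(`) ((`) ?g)"])
    show "\<forall>N\<in>{N. nested V B N}. (`) ?g ` (`) f ` N = N"
      using gfB[OF nested_subset[of V B]] by simp
    show "\<forall>N\<in>{N. nested (f ` V) ((`) f ` B) N}. (`) f ` (`) ?g ` N = N"
      using fgB[OF nested_subset[of "f ` V" "(`) f ` B"]] by simp
    show "(`) ((`) f) ` {N. nested V B N} \<subseteq> {N. nested (f ` V) ((`) f ` B) N}"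
      by (intro image_subsetI) (simp add: nested_image[OF f BV])
    have BP: "(`) f ` B \<subseteq> Pow (f ` V)" using BV by blast
    have "nested V B ((`) ?g ` N)" if "nested (f ` V) ((`) f ` B) N" for N
      using nested_image[OF g BP that] unfolding gf[OF subset_refl] gfB[OF subset_refl] .
    then show "(`) ((`) ?g) ` {N. nested (f ` V) ((`) f ` B) N} \<subseteq> {N. nested V B N}"
      by (intro image_subsetI) simp
  qed
  moreover have "(`) f ` M \<subseteq> (`) f ` N \<longleftrightarrow> M \<subseteq> N" if "nested V B M" "nested V B N" for M N
  proof
    assume "(`) f ` M \<subseteq> (`) f ` N"
    then have "(`) ?g ` (`) f ` M \<subseteq> (`) ?g ` (`) f ` N" by (rule image_mono)
    then show "M \<subseteq> N" unfolding gfB[OF nested_subset[OF that(1)]] gfB[OF nested_subset[OF that(2)]] .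
  qed (rule image_mono)
  ultimately have "face_model I.P {N. nested V B N} (I.F \<circ> (`) ((`) f)) (\<lambda>N M. M \<subseteq> N)"
    by (intro face_model_reindex[OF I.face_model_nested]) auto
  then show ?thesis
    unfolding C.nestohedron_eq I.nestohedron_eq
    by (rule comb_equiv_face_models[OF C.face_model_nested])
qed

section \<open>The derivation on the ring generated by nestohedra\<close>

text \<open>The condition under which \<open>type_of\<close> is meaningful: the class of
  realisations in the fixed space is inhabited.\<close>

definition has_type :: "'a::real_vector set \<Rightarrow> bool"
  where "has_type P \<longleftrightarrow> (\<exists>Q :: (nat \<Rightarrow>\<^sub>0 real) set. simple_polytope Q \<and> comb_equiv P Q)"

lemma has_type_simple: "simple_polytope (P :: (nat \<Rightarrow>\<^sub>0 real) set) \<Longrightarrow> has_type P"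
  unfolding has_type_def using comb_equiv_refl by blast

lemma has_type_rep: "has_type P \<Longrightarrow> comb_equiv P (rep_of (type_of P))"
  unfolding has_type_def using rep_type_of by blast

lemma has_type_comb_equiv: "comb_equiv P Q \<Longrightarrow> has_type Q \<Longrightarrow> has_type P"
  unfolding has_type_def using comb_equiv_trans by blast

lemma type_of_Times:
  assumes "has_type P" "has_type Q" shows "type_of (P \<times> Q) = type_of P + type_of Q"
  unfolding plus_simple_type_def
  by (intro type_of_eq comb_equiv_Times has_type_rep assms)

lemma has_type_Times:
  assumes "has_type P" "has_type Q" shows "has_type (P \<times> Q)"
proof -
  let ?R = "rep_of (type_of P) \<times> rep_of (type_of Q)"
  have "comb_equiv (P \<times> Q) ?R"
    by (intro comb_equiv_Times has_type_rep assms)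
  moreover have "has_type ?R"
    unfolding has_type_def using simple_rep rep_type_of_Times by blast
  ultimately show ?thesis by (rule has_type_comb_equiv)
qed

text \<open>
  The derivation satisfies the Leibniz rule on the types of polytopes whose facets have a type.
  All facets of simple polytopes have one, but only nestohedra and their products are needed.
\<close>

definition typed_facets :: "'a::real_vector set \<Rightarrow> bool"
  where "typed_facets P \<longleftrightarrow> convex P \<and> P \<noteq> {} \<and> has_type P \<and>
    finite {F. is_facet F P} \<and> (\<forall>F. is_facet F P \<longrightarrow> has_type F)"

lemma typed_facets_comb_equiv:
  assumes PQ: "comb_equiv P Q" and P: "typed_facets P" and Q: "convex Q" "Q \<noteq> {}"
  shows "typed_facets Q"
proof -
  obtain f where f: "face_iso f P Q" using PQ unfolding comb_equiv_iff_face_iso by blast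
  have cP: "convex P" using P unfolding typed_facets_def by blast
  have ex: "\<exists>F. is_facet F P \<and> G = f F" if G: "is_facet G Q" for G
  proof -
    have "G face_of Q" using G unfolding is_facet_def by blast
    then obtain F where F: "F face_of P" "G = f F" using face_iso_surj[OF f] by blast
    then show ?thesis using G face_iso_facet[OF f cP Q(1) F(1)] by blast
  qed
  then have "{G. is_facet G Q} \<subseteq> f ` {F. is_facet F P}" by blast
  then have "finite {G. is_facet G Q}"
    using P finite_subset finite_imageI unfolding typed_facets_def by metis
  moreover have "has_type G" if "is_facet G Q" for G
  proof -
    obtain F where F: "is_facet F P" "G = f F" using ex[OF \<open>is_facet G Q\<close>] by blast
    then have "comb_equiv F G" using face_iso_restrict[OF f] unfolding is_facet_def by blast
    then show ?thesis
      using has_type_comb_equiv[OF comb_equiv_sym] P F(1) unfolding typed_facets_def by blast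
  qed
  moreover have "has_type Q"
    using has_type_comb_equiv[OF comb_equiv_sym[OF PQ]] P unfolding typed_facets_def by blast
  ultimately show ?thesis unfolding typed_facets_def using Q by blast
qed

lemma facets_Times:
  assumes "convex P" "P \<noteq> {}" "convex Q" "Q \<noteq> {}"
  shows "{C. is_facet C (P \<times> Q)} = (\<lambda>F. F \<times> Q) ` {F. is_facet F P} \<union> (\<lambda>G. P \<times> G) ` {G. is_facet G Q}"
  using is_facet_Times[OF assms(2,4,1,3)] by auto

lemma typed_facets_Times:
  assumes P: "typed_facets P" and Q: "typed_facets Q" shows "typed_facets (P \<times> Q)"
proof -
  have cv: "convex P" "P \<noteq> {}" "convex Q" "Q \<noteq> {}" and ht: "has_type P" "has_type Q"
    and fin: "finite {F. is_facet F P}" "finite {F. is_facet F Q}"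
    and facets: "\<And>F. is_facet F P \<Longrightarrow> has_type F" "\<And>F. is_facet F Q \<Longrightarrow> has_type F"
    using P Q unfolding typed_facets_def by auto
  have "finite {C. is_facet C (P \<times> Q)}" unfolding facets_Times[OF cv] using fin by simp
  moreover have "has_type C" if "is_facet C (P \<times> Q)" for C
    using that has_type_Times facets ht unfolding is_facet_Times[OF cv(2,4,1,3)] by blast
  ultimately show ?thesis
    unfolding typed_facets_def using cv has_type_Times[OF ht] by (simp add: convex_Times)
qed

section \<open>The Leibniz rule and the types of nestohedra\<close>

lemma frag_of_mult: "frag_of s * frag_of t = frag_of (s + t)" for s t :: simple_type
  by (simp add: mult_single)

text \<open>Geometric form of the Leibniz rule: a facet of a product replaces exactly one factor by
  one of its facets, and the two kinds never coincide.\<close>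

lemma facet_sum_Times:
  assumes P: "typed_facets P" and Q: "typed_facets Q"
  shows "facet_sum (P \<times> Q) = facet_sum P * frag_of (type_of Q) + frag_of (type_of P) * facet_sum Q"
proof -
  have cv: "convex P" "P \<noteq> {}" "convex Q" "Q \<noteq> {}" and ht: "has_type P" "has_type Q"
    and fin: "finite {F. is_facet F P}" "finite {F. is_facet F Q}"
    and facets: "\<And>F. is_facet F P \<Longrightarrow> has_type F" "\<And>F. is_facet F Q \<Longrightarrow> has_type F"
    using P Q unfolding typed_facets_def by auto
  have disj: "(\<lambda>F. F \<times> Q) ` {F. is_facet F P} \<inter> (\<lambda>G. P \<times> G) ` {G. is_facet G Q} = {}"
    using cv by (auto simp: is_facet_def times_eq_iff)
  have inj: "inj_on (\<lambda>F. F \<times> Q) {F. is_facet F P}" "inj_on (\<lambda>G. P \<times> G) {G. is_facet G Q}"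
    using cv by (auto intro!: inj_onI simp: times_eq_iff is_facet_def)
  have "facet_sum (P \<times> Q) =
      (\<Sum>F | is_facet F P. frag_of (type_of (F \<times> Q))) + (\<Sum>G | is_facet G Q. frag_of (type_of (P \<times> G)))"
    unfolding facet_sum_def facets_Times[OF cv]
    using fin disj by (simp add: sum.union_disjoint sum.reindex[OF inj(1)] sum.reindex[OF inj(2)])
  also have "(\<Sum>F | is_facet F P. frag_of (type_of (F \<times> Q))) = facet_sum P * frag_of (type_of Q)"
    unfolding facet_sum_def sum_distrib_right
    by (intro sum.cong refl) (simp add: type_of_Times facets ht mult_single)
  also have "(\<Sum>G | is_facet G Q. frag_of (type_of (P \<times> G))) = frag_of (type_of P) * facet_sum Q"
    unfolding facet_sum_def sum_distrib_left
    by (intro sum.cong refl) (simp add: type_of_Times facets ht mult_single)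
  finally show ?thesis .
qed

lemma convex_rep: "convex (rep_of t)" and rep_nonempty: "rep_of t \<noteq> {}"
  using simple_rep[of t] unfolding simple_polytope_def polytope_def by auto

lemma pol_d_frag_of: "pol_d (frag_of t) = facet_sum (rep_of t)"
  unfolding pol_d_def by simp

text \<open>The representative of \<open>s + t\<close> is only combinatorially equivalent to the
  product of the representatives, but the sum of facets does not see the difference.\<close>

lemma pol_d_mult_frag_of:
  assumes "typed_facets (rep_of s)" "typed_facets (rep_of t)"
  shows "pol_d (frag_of s * frag_of t) = pol_d (frag_of s) * frag_of t + frag_of s * pol_d (frag_of t)"
proof -
  have "facet_sum (rep_of (s + t)) = facet_sum (rep_of s \<times> rep_of t)"
    unfolding plus_simple_type_def
    by (rule facet_sum_cong[OF rep_type_of_Times, symmetric]) (simp_all add: convex_rep convex_Times)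
  then show ?thesis
    unfolding frag_of_mult pol_d_frag_of using facet_sum_Times[OF assms] by (simp add: type_of_rep)
qed

definition nest_type :: "nat set set \<Rightarrow> simple_type"
  where "nest_type B = type_of (nestohedron B)"

lemma nest_type_image:
  assumes "connected_building_set V B" "inj_on f V"
  shows "nest_type ((`) f ` B) = nest_type B"
  unfolding nest_type_def using comb_equiv_nestohedron_image[OF assms(2,1)] by (rule type_of_eq[symmetric])

lemma simple_nestohedron: "connected_building_set V B \<Longrightarrow> simple_polytope (nestohedron B)"
  using connected_building_set.simple_P connected_building_set.nestohedron_eq by metis

lemma rep_nest_type:
  assumes "connected_building_set V B" shows "comb_equiv (nestohedron B) (rep_of (nest_type B))"
  unfolding nest_type_def by (intro has_type_rep has_type_simple simple_nestohedron[OF assms])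

text \<open>The dimension of the chosen representative, which fixes the truncation in
  \<open>pol_Q\<close>, is transferred from the nestohedron by simplicity.\<close>

lemma type_dim_nest_type:
  assumes "connected_building_set V B" shows "type_dim (nest_type B) = card V - 1"
proof -
  interpret connected_building_set V B by (rule assms)
  have "pdim P = pdim (rep_of (nest_type B))"
    using simple_P simple_rep rep_nest_type[OF assms, unfolded nestohedron_eq] face_extreme_point
    by (rule pdim_comb_equiv)
  then show ?thesis unfolding type_dim_def pdim_P by simp
qed

lemma pol_d_nest_type:
  assumes "connected_building_set V B"
  shows "pol_d (frag_of (nest_type B)) =
    (\<Sum>S\<in>B - {V}. frag_of (nest_type (restr B S)) * frag_of (nest_type (contr V B S)))"
proof -
  interpret connected_building_set V B by (rule assms)
  have "pol_d (frag_of (nest_type B)) = facet_sum P"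
    unfolding nest_type_def nestohedron_eq by (rule pol_d_type_of[OF simple_P])
  also have "\<dots> = (\<Sum>F\<in>(\<lambda>S. F {V, S}) ` (B - {V}). frag_of (type_of F))"
    unfolding facet_sum_def is_facet_P by (intro sum.cong) auto
  also have "\<dots> = (\<Sum>S\<in>B - {V}. frag_of (type_of (F {V, S})))"
    using sum.reindex[OF F_pair_inj] by simp
  also have "\<dots> = (\<Sum>S\<in>B - {V}. frag_of (nest_type (restr B S)) * frag_of (nest_type (contr V B S)))"
  proof (intro sum.cong refl)
    fix S assume "S \<in> B - {V}"
    then have S: "S \<in> B" "S \<noteq> V" by auto
    have "type_of (F {V, S}) = nest_type (restr B S) + nest_type (contr V B S)"
      unfolding nest_type_def
      using type_of_eq[OF facet_comb_equiv[OF S]]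
        type_of_Times[OF has_type_simple[OF simple_nestohedron[OF restr_connected[OF S(1)]]]
          has_type_simple[OF simple_nestohedron[OF contr_connected[OF S]]]] by simp
    then show "frag_of (type_of (F {V, S})) = frag_of (nest_type (restr B S)) * frag_of (nest_type (contr V B S))"
      unfolding frag_of_mult by simp
  qed
  finally show ?thesis .
qed

lemma typed_facets_nestohedron:
  assumes "connected_building_set V (B :: nat set set)" shows "typed_facets (nestohedron B)"
proof -
  interpret connected_building_set V B by (rule assms)
  have "{G. is_facet G P} \<subseteq> (\<lambda>S. F {V, S}) ` B" unfolding is_facet_P by blast
  then have "finite {G. is_facet G P}" using finite_B finite_subset finite_imageI by metis
  moreover have "has_type G" if "is_facet G P" for G
  proof -
    obtain S where S: "S \<in> B" "S \<noteq> V" "G = F {V, S}" using \<open>is_facet G P\<close> unfolding is_facet_P by blast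
    show ?thesis
      unfolding S(3)
      by (rule has_type_comb_equiv[OF facet_comb_equiv[OF S(1,2)]])
        (intro has_type_Times has_type_simple simple_nestohedron[OF restr_connected[OF S(1)]]
          simple_nestohedron[OF contr_connected[OF S(1,2)]])
  qed
  moreover have "convex P" "P \<noteq> {}" using simple_P unfolding simple_polytope_def polytope_def by auto
  ultimately show ?thesis
    unfolding typed_facets_def nestohedron_eq using has_type_simple[OF simple_P] by blast
qed

text \<open>Sums of types are products of polytopes. They are included because facets of nestohedra
  are products of nestohedra, and the class must survive repeated application of
  \<open>d\<close>.\<close>

inductive nestohedral :: "simple_type \<Rightarrow> bool"
  where
    nest: "connected_building_set V B \<Longrightarrow> nestohedral (nest_type B)"
  | plus: "nestohedral s \<Longrightarrow> nestohedral t \<Longrightarrow> nestohedral (s + t)"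

lemma typed_facets_nestohedral: "nestohedral t \<Longrightarrow> typed_facets (rep_of t)"
proof (induction rule: nestohedral.induct)
  case (nest V B)
  show ?case
    using rep_nest_type[OF nest] typed_facets_nestohedron[OF nest] convex_rep rep_nonempty
    by (rule typed_facets_comb_equiv)
next
  case (plus s t)
  show ?case
    using rep_type_of_Times[of s t, folded plus_simple_type_def] typed_facets_Times[OF plus.IH]
      convex_rep rep_nonempty
    by (rule typed_facets_comb_equiv)
qed

definition nest_ring :: "polytope_ring set"
  where "nest_ring = {p. Poly_Mapping.keys p \<subseteq> Collect nestohedral}"

lemma nest_ring_frag_of: "nestohedral t \<Longrightarrow> frag_of t \<in> nest_ring"
  by (simp add: nest_ring_def)

lemma nest_ring_0: "0 \<in> nest_ring"
  by (simp add: nest_ring_def)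

lemma nest_ring_diff: "p \<in> nest_ring \<Longrightarrow> r \<in> nest_ring \<Longrightarrow> p - r \<in> nest_ring"
  unfolding nest_ring_def using keys_diff[of p r] by blast

lemma nest_ring_add: "p \<in> nest_ring \<Longrightarrow> r \<in> nest_ring \<Longrightarrow> p + r \<in> nest_ring"
  unfolding nest_ring_def using Poly_Mapping.keys_add[of p r] by blast

lemma nest_ring_sum: "(\<And>a. a \<in> A \<Longrightarrow> p a \<in> nest_ring) \<Longrightarrow> (\<Sum>a\<in>A. p a) \<in> nest_ring"
  by (induction A rule: infinite_finite_induct) (auto intro: nest_ring_0 nest_ring_add)

lemma nest_ring_mult: "p \<in> nest_ring \<Longrightarrow> r \<in> nest_ring \<Longrightarrow> p * r \<in> nest_ring"
  unfolding nest_ring_def using keys_mult[of p r] nestohedral.plus by blast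

lemma nest_ring_induct [consumes 1, case_names zero one diff]:
  assumes "p \<in> nest_ring" "Q 0" "\<And>t. nestohedral t \<Longrightarrow> Q (frag_of t)"
    "\<And>a b. Q a \<Longrightarrow> Q b \<Longrightarrow> Q (a - b)"
  shows "Q p"
  using assms(1) unfolding nest_ring_def
  by (auto intro: frag_induction[of p "Collect nestohedral" Q] assms)

lemma pol_d_0: "pol_d 0 = 0"
  and pol_d_diff: "pol_d (p - r) = pol_d p - pol_d r"
  and pol_d_add: "pol_d (p + r) = pol_d p + pol_d r"
  by (simp_all add: pol_d_def frag_extend_diff frag_extend_add)

lemma pol_d_sum: "pol_d (\<Sum>a\<in>A. p a) = (\<Sum>a\<in>A. pol_d (p a))"
  by (induction A rule: infinite_finite_induct) (simp_all add: pol_d_0 pol_d_add)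

lemma pol_d_mult:
  assumes "p \<in> nest_ring" "r \<in> nest_ring"
  shows "pol_d (p * r) = pol_d p * r + p * pol_d r"
  using assms(1)
proof (induction p rule: nest_ring_induct)
  case (one s)
  show ?case using assms(2)
  proof (induction r rule: nest_ring_induct)
    case (one t)
    show ?case using \<open>nestohedral s\<close> one by (intro pol_d_mult_frag_of typed_facets_nestohedral)
  qed (simp_all add: pol_d_0 pol_d_diff algebra_simps)
qed (simp_all add: pol_d_0 pol_d_diff algebra_simps)

text \<open>Stability under \<open>d\<close> keeps all iterates inside the domain of
  \<open>pol_d_mult\<close>, so that the Leibniz rule of any order follows.\<close>

lemma pol_d_nest_ring: "p \<in> nest_ring \<Longrightarrow> pol_d p \<in> nest_ring"
proof (induction p rule: nest_ring_induct)
  case (one t)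
  then show ?case
  proof (induction rule: nestohedral.induct)
    case (nest V B)
    interpret connected_building_set V B by (rule nest)
    show ?case
      unfolding pol_d_nest_type[OF nest]
      by (intro nest_ring_sum nest_ring_mult nest_ring_frag_of nestohedral.nest)
        (use restr_connected contr_connected in blast)+
  next
    case (plus s t)
    then show ?case
      unfolding frag_of_mult[symmetric]
      by (simp add: pol_d_mult nest_ring_frag_of nest_ring_add nest_ring_mult)
  qed
qed (simp_all add: pol_d_0 nest_ring_0 pol_d_diff nest_ring_diff)

lemma pol_d_funpow_nest_ring: "p \<in> nest_ring \<Longrightarrow> (pol_d ^^ k) p \<in> nest_ring"
  by (induction k) (simp_all add: pol_d_nest_ring)

lemma pol_d_funpow_sum: "(pol_d ^^ k) (\<Sum>a\<in>A. p a) = (\<Sum>a\<in>A. (pol_d ^^ k) (p a))"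
  by (induction k) (simp_all add: pol_d_sum)

lemma pol_d_of_nat: "pol_d (of_nat k * p) = of_nat k * pol_d p"
  by (induction k) (simp_all add: pol_d_0 pol_d_add algebra_simps)

lemma pol_d_funpow_mult:
  assumes "p \<in> nest_ring" "r \<in> nest_ring"
  shows "(pol_d ^^ k) (p * r) = (\<Sum>j\<le>k. of_nat (k choose j) * ((pol_d ^^ j) p * (pol_d ^^ (k - j)) r))"
proof (induction k)
  case (Suc k)
  let ?u = "\<lambda>i j. (pol_d ^^ i) p * (pol_d ^^ j) r"
  have du: "pol_d (?u i j) = ?u (Suc i) j + ?u i (Suc j)" for i j
    using assms by (simp add: pol_d_mult pol_d_funpow_nest_ring)
  have "(pol_d ^^ Suc k) (p * r) = (\<Sum>j\<le>k. of_nat (k choose j) * pol_d (?u j (k - j)))"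
    by (simp only: funpow.simps o_def Suc.IH pol_d_sum pol_d_of_nat)
  also have "\<dots> = (\<Sum>j\<le>k. of_nat (k choose j) * ?u (Suc j) (k - j)) + (\<Sum>j\<le>k. of_nat (k choose j) * ?u j (Suc k - j))"
    by (simp only: du distrib_left sum.distrib) (simp add: Suc_diff_le)
  also have "(\<Sum>j\<le>k. of_nat (k choose j) * ?u j (Suc k - j)) = (\<Sum>j\<le>Suc k. of_nat (k choose j) * ?u j (Suc k - j))"
    by (simp add: binomial_eq_0)
  also have "\<dots> = ?u 0 (Suc k) + (\<Sum>j\<le>k. of_nat (k choose Suc j) * ?u (Suc j) (k - j))"
    by (subst sum.atMost_Suc_shift) simp
  also have "(\<Sum>j\<le>k. of_nat (k choose j) * ?u (Suc j) (k - j)) +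
      (?u 0 (Suc k) + (\<Sum>j\<le>k. of_nat (k choose Suc j) * ?u (Suc j) (k - j)))
    = ?u 0 (Suc k) + (\<Sum>j\<le>k. of_nat (Suc k choose Suc j) * ?u (Suc j) (k - j))"
    by (simp only: binomial_Suc_Suc of_nat_add distrib_right sum.distrib add.assoc add.left_commute add.commute)
  also have "\<dots> = (\<Sum>j\<le>Suc k. of_nat (Suc k choose j) * ?u j (Suc k - j))"
    by (subst sum.atMost_Suc_shift) simp
  finally show ?case .
qed simp

text \<open>The dimension is \<open>card V - 1\<close>, and each application of \<open>d\<close>
  lowers it by one. The induction replaces a nestohedron by its facets, whose two factors have
  ground sets partitioning \<open>V\<close>.\<close>

lemma pol_d_funpow_nest_type_eq_0:
  assumes "connected_building_set V B" "card V \<le> k"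
  shows "(pol_d ^^ k) (frag_of (nest_type B)) = 0"
  using assms
proof (induction "card V" arbitrary: V B k rule: less_induct)
  case less
  interpret connected_building_set V B by (rule less.prems(1))
  have "card V > 0" using finite_V V_nonempty by (simp add: card_gt_0_iff)
  then obtain l where k: "k = Suc l" using less.prems(2) by (cases k) auto
  have "(pol_d ^^ l) (frag_of (nest_type (restr B S)) * frag_of (nest_type (contr V B S))) = 0"
    if "S \<in> B - {V}" for S
  proof -
    have S: "S \<in> B" "S \<noteq> V" using that by auto
    note rc = restr_connected[OF S(1)] contr_connected[OF S]
    have "card (V - S) = card V - card S" "card S \<le> card V" "0 < card S" "card S < card V"
      using S(2) B_subset[OF S(1)] B_nonempty[OF S(1)] B_finite[OF S(1)] finite_V
      by (auto intro!: psubset_card_mono simp: card_Diff_subset card_mono card_gt_0_iff)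
    then have lt: "card S < card V" "card (V - S) < card V" "card S + card (V - S) = card V"
      by linarith+
    have "(pol_d ^^ j) (frag_of (nest_type (restr B S))) * (pol_d ^^ (l - j)) (frag_of (nest_type (contr V B S))) = 0"
      for j
    proof (cases "card S \<le> j")
      case True
      then show ?thesis using less.hyps[OF lt(1) rc(1)] by simp
    next
      case False
      \<comment> \<open>The orders of the two derivatives add up to \<open>l\<close>, one less than
        \<open>k\<close>, so at least one of them reaches the size of its ground set.\<close>
      then have "card (V - S) \<le> l - j" using lt(3) less.prems(2) k by linarith
      then show ?thesis using less.hyps[OF lt(2) rc(2)] by simp
    qed
    then show ?thesis
      using rc by (simp add: pol_d_funpow_mult nest_ring_frag_of nestohedral.nest)
  qed
  then show ?case
    unfolding k funpow_Suc_right o_def pol_d_nest_type[OF less.prems(1)] pol_d_funpow_sum by simp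
qed

subsection \<open>The series \<open>Q\<close>\<close>

lemma lookup_to_rat: "Poly_Mapping.lookup (to_rat p) t = of_int (Poly_Mapping.lookup p t)"
  unfolding to_rat_def by (simp add: Poly_Mapping.map.rep_eq when_def)

lemma to_rat_0: "to_rat 0 = 0"
  and to_rat_add: "to_rat (p + r) = to_rat p + to_rat r"
  and to_rat_diff: "to_rat (p - r) = to_rat p - to_rat r"
  by (auto intro!: poly_mapping_eqI simp: lookup_to_rat lookup_add lookup_minus)

lemma to_rat_frag_of: "to_rat (frag_of t) = Poly_Mapping.single t 1"
  by (rule poly_mapping_eqI) (simp add: lookup_to_rat lookup_single when_def)

lemma to_rat_sum: "to_rat (\<Sum>a\<in>A. p a) = (\<Sum>a\<in>A. to_rat (p a))"
  by (induction A rule: infinite_finite_induct) (simp_all add: to_rat_0 to_rat_add)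

lemma to_rat_mult: "to_rat (p * r) = to_rat p * to_rat r"
proof (rule frag_induction[of p UNIV])
  fix s
  show "to_rat (frag_of s * r) = to_rat (frag_of s) * to_rat r"
  proof (rule frag_induction[of r UNIV])
    show "to_rat (frag_of s * frag_of t) = to_rat (frag_of s) * to_rat (frag_of t)" for t
      unfolding frag_of_mult to_rat_frag_of by (simp add: mult_single)
  qed (simp_all add: to_rat_0 to_rat_diff right_diff_distrib)
qed (simp_all add: to_rat_0 to_rat_diff left_diff_distrib)

lemma rat_scalar_mult: "rat_scalar a * rat_scalar b = rat_scalar (a * b)"
  by (simp add: rat_scalar_def mult_single)

lemma rat_scalar_1: "rat_scalar 1 = 1"
  by (simp add: rat_scalar_def)

lemma rat_scalar_of_nat: "rat_scalar (of_nat n) = of_nat n"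
  by (simp add: rat_scalar_def)

lemma to_rat_1: "to_rat 1 = 1"
  by (rule poly_mapping_eqI) (simp add: lookup_to_rat lookup_one when_def)

lemma to_rat_of_nat: "to_rat (of_nat n) = of_nat n"
  by (induction n) (simp_all add: to_rat_0 to_rat_1 to_rat_add)

text \<open>The untruncated series \<open>exp(q d)\<close>, defined on the whole ring, where the
  derivative and products of factors in \<open>nest_ring\<close> can be treated without regard to
  dimensions.\<close>

definition Q_series :: "polytope_ring \<Rightarrow> rat_polytope_ring fps"
  where "Q_series p = Abs_fps (\<lambda>k. to_rat ((pol_d ^^ k) p) * rat_scalar (1 / fact k))"

lemma Q_series_nth: "fps_nth (Q_series p) k = to_rat ((pol_d ^^ k) p) * rat_scalar (1 / fact k)"
  by (simp add: Q_series_def)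

lemma fps_deriv_Q_series: "fps_deriv (Q_series p) = Q_series (pol_d p)"
proof (rule fps_ext)
  fix k
  have "of_nat (k + 1) * rat_scalar (1 / fact (k + 1)) = rat_scalar (1 / fact k)"
    unfolding rat_scalar_of_nat[symmetric] rat_scalar_mult
    by (simp add: field_simps del: of_nat_Suc)
  then show "fps_nth (fps_deriv (Q_series p)) k = fps_nth (Q_series (pol_d p)) k"
    by (simp add: Q_series_nth funpow_swap1 mult.left_commute[of "1 + of_nat k"] add.commute)
qed

lemma Q_series_sum: "Q_series (\<Sum>a\<in>A. p a) = (\<Sum>a\<in>A. Q_series (p a))"
  by (rule fps_ext) (simp add: Q_series_nth fps_sum_nth pol_d_funpow_sum to_rat_sum sum_distrib_right)

lemma Q_series_mult:
  assumes "p \<in> nest_ring" "r \<in> nest_ring"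
  shows "Q_series (p * r) = Q_series p * Q_series r"
proof (rule fps_ext)
  fix k
  let ?u = "\<lambda>j. to_rat ((pol_d ^^ j) p)" and ?v = "\<lambda>j. to_rat ((pol_d ^^ j) r)"
  have "fps_nth (Q_series (p * r)) k = (\<Sum>j\<le>k. of_nat (k choose j) * (?u j * ?v (k - j)) * rat_scalar (1 / fact k))"
    by (simp add: Q_series_nth pol_d_funpow_mult[OF assms] to_rat_sum to_rat_mult to_rat_of_nat sum_distrib_right)
  also have "\<dots> = (\<Sum>j\<le>k. ?u j * rat_scalar (1 / fact j) * (?v (k - j) * rat_scalar (1 / fact (k - j))))"
  proof (intro sum.cong refl)
    fix j assume "j \<in> {..k}"
    then have j: "j \<le> k" by simp
    have "of_nat (k choose j) * (1 / fact k) = (1 / fact j) * (1 / fact (k - j) :: rat)"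
      using binomial_fact[OF j, where ?'a = rat] by simp
    then have "of_nat (k choose j) * rat_scalar (1 / fact k) = rat_scalar (1 / fact j) * rat_scalar (1 / fact (k - j))"
      unfolding rat_scalar_of_nat[symmetric] rat_scalar_mult by simp
    then have "?u j * ?v (k - j) * (of_nat (k choose j) * rat_scalar (1 / fact k)) =
        ?u j * ?v (k - j) * (rat_scalar (1 / fact j) * rat_scalar (1 / fact (k - j)))" by simp
    then show "of_nat (k choose j) * (?u j * ?v (k - j)) * rat_scalar (1 / fact k) =
        ?u j * rat_scalar (1 / fact j) * (?v (k - j) * rat_scalar (1 / fact (k - j)))"
      by (simp only: mult_ac)
  qed
  also have "\<dots> = fps_nth (Q_series p * Q_series r) k"
    by (simp add: fps_mult_nth Q_series_nth atLeast0AtMost)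
  finally show "fps_nth (Q_series (p * r)) k = fps_nth (Q_series p * Q_series r) k" .
qed

text \<open>Beyond the dimension all powers of \<open>d\<close> vanish, so cutting the series off
  there loses nothing.\<close>

lemma pol_Q_nest_type:
  assumes "connected_building_set V B"
  shows "pol_Q (nest_type B) = Q_series (frag_of (nest_type B))"
proof (rule fps_ext)
  fix k
  have "fps_nth (pol_Q (nest_type B)) k =
      (\<Sum>j\<le>card V - 1. if k = j then to_rat ((pol_d ^^ j) (frag_of (nest_type B))) * rat_scalar (1 / fact j) else 0)"
    unfolding pol_Q_def type_dim_nest_type[OF assms] fps_sum_nth
    by (intro sum.cong refl) simp
  also have "\<dots> = fps_nth (Q_series (frag_of (nest_type B))) k"
  proof (cases "k \<le> card V - 1")
    case False
    then have "(pol_d ^^ k) (frag_of (nest_type B)) = 0"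
      using assms by (intro pol_d_funpow_nest_type_eq_0) auto
    then show ?thesis using False by (simp add: Q_series_nth to_rat_0)
  qed (simp add: Q_series_nth)
  finally show "fps_nth (pol_Q (nest_type B)) k = fps_nth (Q_series (frag_of (nest_type B))) k" .
qed

lemma fps_deriv_pol_Q:
  assumes "connected_building_set V B"
  shows "fps_deriv (pol_Q (nest_type B)) =
    (\<Sum>S\<in>B - {V}. pol_Q (nest_type (restr B S)) * pol_Q (nest_type (contr V B S)))"
proof -
  interpret connected_building_set V B by (rule assms)
  have "fps_deriv (pol_Q (nest_type B)) =
    (\<Sum>S\<in>B - {V}. Q_series (frag_of (nest_type (restr B S)) * frag_of (nest_type (contr V B S))))"
    by (simp only: pol_Q_nest_type[OF assms] fps_deriv_Q_series pol_d_nest_type[OF assms] Q_series_sum)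
  also have "\<dots> = (\<Sum>S\<in>B - {V}. pol_Q (nest_type (restr B S)) * pol_Q (nest_type (contr V B S)))"
  proof (intro sum.cong refl)
    fix S assume "S \<in> B - {V}"
    then have rc: "connected_building_set S (restr B S)" "connected_building_set (V - S) (contr V B S)"
      using restr_connected contr_connected by auto
    show "Q_series (frag_of (nest_type (restr B S)) * frag_of (nest_type (contr V B S))) =
        pol_Q (nest_type (restr B S)) * pol_Q (nest_type (contr V B S))"
      unfolding pol_Q_nest_type[OF rc(1)] pol_Q_nest_type[OF rc(2)]
      using rc by (intro Q_series_mult nest_ring_frag_of nestohedral.nest)
  qed
  finally show ?thesis .
qed

section \<open>Constant terms and the point\<close>

lemma face_of_singleton_set: "F face_of {a} \<longleftrightarrow> F = {} \<or> F = {a}"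
  using face_of_imp_subset[of F "{a}"] face_of_refl[of "{a}"] by (auto simp: subset_singleton_iff)

lemma comb_equiv_singletons: "comb_equiv {a::'a::real_vector} {b::'b::real_vector}"
  unfolding comb_equiv_def face_of_singleton_set
  by (intro exI[of _ "\<lambda>F. if F = {} then {} else {b}"]) (auto simp: bij_betw_def inj_on_def)

lemma pol_Q_nth_0: "fps_nth (pol_Q t) 0 = to_rat (frag_of t)"
proof -
  have "fps_nth (pol_Q t) 0 =
      (\<Sum>k\<le>type_dim t. if k = 0 then to_rat ((pol_d ^^ k) (frag_of t)) * rat_scalar (1 / fact k) else 0)"
    unfolding pol_Q_def fps_sum_nth by (intro sum.cong refl) simp
  then show ?thesis by (simp add: rat_scalar_1)
qed

text \<open>The zero of the additively written monoid of types is the point, that is, the unit of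
  the ring. Singletons in a building set therefore contribute trivial first factors.\<close>

lemma nest_type_singleton: "nest_type {{i}} = 0"
proof -
  have "nestohedron {{i}} = {Poly_Mapping.single i 1}" by (simp add: nestohedron_def)
  then show ?thesis
    unfolding nest_type_def zero_simple_type_def by (simp add: type_of_eq[OF comb_equiv_singletons])
qed

lemma pol_Q_nest_type_singleton: "pol_Q (nest_type {{i}}) = 1"
proof (rule fps_ext)
  fix k
  have c: "connected_building_set {i} {{i}}" by standard (auto simp: building_set_def)
  show "fps_nth (pol_Q (nest_type {{i}})) k = fps_nth 1 k"
  proof (cases k)
    case 0
    then show ?thesis by (simp add: pol_Q_nth_0 nest_type_singleton to_rat_1)
  next
    case (Suc l)
    then have "(pol_d ^^ k) (frag_of (nest_type {{i}})) = 0"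
      using c by (intro pol_d_funpow_nest_type_eq_0) auto
    then show ?thesis unfolding pol_Q_nest_type[OF c] Q_series_nth using Suc by (simp add: to_rat_0)
  qed
qed

section \<open>The four families\<close>

text \<open>This and the next three definitions are the building sets of the families over an
  arbitrary ground set: \<open>c\<close> is the centre of the star, \<open>a\<close> and
  \<open>z\<close> stand for 1 and n+1, and in \<open>Mas_sets\<close> the elements
  \<open>a\<close>, \<open>b\<close>, \<open>z\<close> stand for 1, 2 and n+1.\<close>

definition all_sets :: "'v set \<Rightarrow> 'v set set"
  where "all_sets V = {S. S \<subseteq> V \<and> S \<noteq> {}}"

definition star_sets :: "'v set \<Rightarrow> 'v \<Rightarrow> 'v set set"
  where "star_sets V c = {S. S \<subseteq> V \<and> S \<noteq> {} \<and> (c \<in> S \<or> is_singleton S)}"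

definition Gamma_sets :: "'v set \<Rightarrow> 'v \<Rightarrow> 'v \<Rightarrow> 'v set set"
  where "Gamma_sets V a z = {S. S \<subseteq> V \<and> S \<noteq> {} \<and> (z \<in> S \<longrightarrow> a \<in> S \<or> S = {z})}"

definition Mas_sets :: "'v set \<Rightarrow> 'v \<Rightarrow> 'v \<Rightarrow> 'v \<Rightarrow> 'v set set"
  where "Mas_sets V a b z = {S. S \<subseteq> V \<and> S \<noteq> {} \<and> (is_singleton S \<or> a \<in> S \<and> (z \<in> S \<longrightarrow> b \<in> S))}"

lemma is_singleton_Un_cases: "is_singleton S \<Longrightarrow> S \<inter> T \<noteq> {} \<Longrightarrow> S \<union> T = T"
  by (auto elim!: is_singletonE)

lemma connected_all_sets: "finite V \<Longrightarrow> V \<noteq> {} \<Longrightarrow> connected_building_set V (all_sets V)"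
  by standard (auto simp: building_set_def all_sets_def)

lemma connected_star_sets:
  assumes "finite V" "c \<in> V" shows "connected_building_set V (star_sets V c)"
proof
  show "building_set V (star_sets V c)"
    unfolding building_set_def
  proof (intro conjI ballI impI)
    fix S T assume ST: "S \<in> star_sets V c" "T \<in> star_sets V c" "S \<inter> T \<noteq> {}"
    show "S \<union> T \<in> star_sets V c"
    proof (cases "is_singleton S \<or> is_singleton T")
      case True
      then have "S \<union> T = T \<or> S \<union> T = S" using is_singleton_Un_cases ST(3) by (metis Int_commute Un_commute)
      then show ?thesis using ST(1,2) by auto
    qed (use ST in \<open>auto simp: star_sets_def\<close>)
  qed (use assms in \<open>auto simp: star_sets_def\<close>)
qed (use assms in \<open>auto simp: star_sets_def\<close>)

lemma connected_Gamma_sets: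
  "finite V \<Longrightarrow> a \<in> V \<Longrightarrow> connected_building_set V (Gamma_sets V a z)"
  by standard (auto simp: building_set_def Gamma_sets_def)

lemma connected_Mas_sets:
  assumes "finite V" "a \<in> V" "b \<in> V" shows "connected_building_set V (Mas_sets V a b z)"
proof
  show "building_set V (Mas_sets V a b z)"
    unfolding building_set_def
  proof (intro conjI ballI impI)
    fix S T assume ST: "S \<in> Mas_sets V a b z" "T \<in> Mas_sets V a b z" "S \<inter> T \<noteq> {}"
    show "S \<union> T \<in> Mas_sets V a b z"
    proof (cases "is_singleton S \<or> is_singleton T")
      case True
      then have "S \<union> T = T \<or> S \<union> T = S" using is_singleton_Un_cases ST(3) by (metis Int_commute Un_commute)
      then show ?thesis using ST(1,2) by auto
    qed (use ST in \<open>auto simp: Mas_sets_def\<close>)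
  qed (use assms in \<open>auto simp: Mas_sets_def\<close>)
qed (use assms in \<open>auto simp: Mas_sets_def\<close>)

section \<open>Relabelling the ground set\<close>

lemma image_Collect_subsets:
  assumes "\<And>S. S \<subseteq> V \<Longrightarrow> Q (f ` S) \<longleftrightarrow> P S"
  shows "(`) f ` {S. S \<subseteq> V \<and> S \<noteq> {} \<and> P S} = {T. T \<subseteq> f ` V \<and> T \<noteq> {} \<and> Q T}"
proof
  show "(`) f ` {S. S \<subseteq> V \<and> S \<noteq> {} \<and> P S} \<subseteq> {T. T \<subseteq> f ` V \<and> T \<noteq> {} \<and> Q T}"
    using assms by (auto simp: image_mono)
  show "{T. T \<subseteq> f ` V \<and> T \<noteq> {} \<and> Q T} \<subseteq> (`) f ` {S. S \<subseteq> V \<and> S \<noteq> {} \<and> P S}"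
  proof
    fix T assume T: "T \<in> {T. T \<subseteq> f ` V \<and> T \<noteq> {} \<and> Q T}"
    then obtain S where "S \<subseteq> V" "T = f ` S" by (auto simp: subset_image_iff)
    then show "T \<in> (`) f ` {S. S \<subseteq> V \<and> S \<noteq> {} \<and> P S}" using T assms by auto
  qed
qed

lemma is_singleton_image:
  assumes "inj_on f V" "S \<subseteq> V" shows "is_singleton (f ` S) \<longleftrightarrow> is_singleton S"
  using card_image[OF inj_on_subset[OF assms]] by (simp add: is_singleton_altdef)

lemma image_all_sets: "(`) f ` all_sets V = all_sets (f ` V)"
  unfolding all_sets_def using image_Collect_subsets[of V "\<lambda>_. True" f "\<lambda>_. True"] by simp

lemma image_star_sets:
  assumes "inj_on f V" "c \<in> V" shows "(`) f ` star_sets V c = star_sets (f ` V) (f c)"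
  unfolding star_sets_def
  by (rule image_Collect_subsets) (simp add: is_singleton_image[OF assms(1)] inj_on_image_mem_iff[OF assms])

lemma image_Gamma_sets:
  assumes f: "inj_on f V" and az: "a \<in> V" "z \<in> V"
  shows "(`) f ` Gamma_sets V a z = Gamma_sets (f ` V) (f a) (f z)"
  unfolding Gamma_sets_def
proof (rule image_Collect_subsets)
  fix S assume S: "S \<subseteq> V"
  have "f ` S = {f z} \<longleftrightarrow> S = {z}"
    using inj_on_image_eq_iff[OF f S, of "{z}"] az by simp
  then show "(f z \<in> f ` S \<longrightarrow> f a \<in> f ` S \<or> f ` S = {f z}) \<longleftrightarrow> (z \<in> S \<longrightarrow> a \<in> S \<or> S = {z})"
    using S by (simp add: inj_on_image_mem_iff[OF f] az)
qed

lemma image_Mas_sets: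
  assumes "inj_on f V" "a \<in> V" "b \<in> V" "z \<in> V"
  shows "(`) f ` Mas_sets V a b z = Mas_sets (f ` V) (f a) (f b) (f z)"
  unfolding Mas_sets_def
  by (rule image_Collect_subsets) (simp add: is_singleton_image[OF assms(1)] inj_on_image_mem_iff[OF assms(1)] assms)

text \<open>The lists hold the marked elements and their prescribed labels; the remaining elements
  are matched arbitrarily.\<close>

lemma ex_bij_betw_map:
  assumes "finite V" "finite W" "card V = card W" "length xs = length ys"
    "distinct xs" "distinct ys" "set xs \<subseteq> V" "set ys \<subseteq> W"
  shows "\<exists>f. bij_betw f V W \<and> map f xs = ys"
  using assms(4) assms(1-3,5-)
proof (induction xs ys arbitrary: V W rule: list_induct2)
  case Nil
  then show ?case using finite_same_card_bij by auto
next
  case (Cons x xs y ys)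
  have "\<exists>f. bij_betw f (V - {x}) (W - {y}) \<and> map f xs = ys"
    using Cons.prems by (intro Cons.IH) auto
  then obtain f where f: "bij_betw f (V - {x}) (W - {y})" "map f xs = ys" by blast
  let ?f = "f(x := y)"
  have "bij_betw ?f (V - {x}) (W - {y})"
    using f(1) by (rule bij_betw_cong[THEN iffD1, rotated]) simp
  then have "bij_betw ?f (V - {x} \<union> {x}) (W - {y} \<union> {?f x})"
    by (intro notIn_Un_bij_betw) auto
  moreover have "V - {x} \<union> {x} = V" "W - {y} \<union> {?f x} = W" using Cons.prems by auto
  ultimately have "bij_betw ?f V W" by simp
  moreover have "map ?f (x # xs) = y # ys" using f(2) Cons.prems by auto
  ultimately show ?case by (intro exI[of _ ?f] conjI)
qed

section \<open>Identification with the given building sets and types\<close>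

lemma complete_graph_building: "graph_building V (complete_graph m) = all_sets V" if "V = {1..m}"
proof -
  have "(u, v) \<in> (complete_graph m \<inter> S \<times> S)\<^sup>*" if "S \<subseteq> V" "u \<in> S" "v \<in> S" for S u v
    using that \<open>V = {1..m}\<close> by (cases "u = v") (auto simp: complete_graph_def subset_iff intro!: r_into_rtrancl)
  then show ?thesis unfolding graph_building_def all_sets_def by blast
qed

text \<open>Every edge of the star uses the centre, so an induced subgraph missing it has no edges
  and is connected only if it is a single vertex.\<close>

lemma star_graph_building:
  assumes V: "V = {1..m}" "0 < m"
  shows "graph_building V (star_graph m) = star_sets V 1"
proof -
  have "(\<forall>u\<in>S. \<forall>v\<in>S. (u, v) \<in> (star_graph m \<inter> S \<times> S)\<^sup>*) \<longleftrightarrow> 1 \<in> S \<or> is_singleton S"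
    if S: "S \<subseteq> V" "S \<noteq> {}" for S
  proof
    assume con: "\<forall>u\<in>S. \<forall>v\<in>S. (u, v) \<in> (star_graph m \<inter> S \<times> S)\<^sup>*"
    show "1 \<in> S \<or> is_singleton S"
    proof (cases "1 \<in> S")
      case False
      then have "star_graph m \<inter> S \<times> S = {}" by (auto simp: star_graph_def)
      then have "\<forall>u\<in>S. \<forall>v\<in>S. u = v" using con by simp
      then show ?thesis using S(2) by (intro disjI2 is_singletonI') auto
    qed simp
  next
    assume "1 \<in> S \<or> is_singleton S"
    then show "\<forall>u\<in>S. \<forall>v\<in>S. (u, v) \<in> (star_graph m \<inter> S \<times> S)\<^sup>*"
    proof
      assume 1: "1 \<in> S"
      have to: "(u, 1) \<in> (star_graph m \<inter> S \<times> S)\<^sup>*" if "u \<in> S" for u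
        using that 1 S V by (cases "u = 1") (auto simp: star_graph_def subset_iff intro!: r_into_rtrancl)
      have "(1, v) \<in> (star_graph m \<inter> S \<times> S)\<^sup>*" if "v \<in> S" for v
        using that 1 S V by (cases "v = 1") (auto simp: star_graph_def subset_iff intro!: r_into_rtrancl)
      then show ?thesis using rtrancl_trans[OF to] by simp
    qed (auto elim!: is_singletonE)
  qed
  then show ?thesis unfolding graph_building_def star_sets_def by blast
qed

lemma card_ge_2_iff_not_singleton:
  assumes "finite S" "S \<noteq> {}" shows "2 \<le> card S \<longleftrightarrow> \<not> is_singleton S"
proof -
  have "card S \<noteq> 0" using assms by simp
  then show ?thesis unfolding is_singleton_altdef by linarith
qed

text \<open>The case n = 1 is covered as well: there \<open>P_Gamma\<close> is a segment by
  convention, and this has to be matched with a building set.\<close>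

lemma B_Gamma_eq:
  assumes "1 \<le> n" shows "B_Gamma n = Gamma_sets {1..n+1} 1 (n+1)"
proof (intro subset_antisym subsetI)
  fix S assume "S \<in> B_Gamma n"
  then show "S \<in> Gamma_sets {1..n+1} 1 (n+1)"
    using assms unfolding B_Gamma_def Gamma_sets_def by fastforce
next
  fix S assume "S \<in> Gamma_sets {1..n+1} 1 (n+1)"
  then have S: "S \<subseteq> {1..n+1}" "S \<noteq> {}" "n + 1 \<in> S \<longrightarrow> 1 \<in> S \<or> S = {n+1}"
    unfolding Gamma_sets_def by auto
  show "S \<in> B_Gamma n"
  proof (cases "is_singleton S")
    case True
    then show ?thesis using S(1) unfolding B_Gamma_def by (auto elim!: is_singletonE)
  next
    case False
    show ?thesis
    proof (cases "n + 1 \<in> S")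
      case True
      then have "1 \<in> S" using S(3) False by auto
      have "S = {1, n+1} \<union> (S - {1, n+1})" using True \<open>1 \<in> S\<close> by auto
      moreover have "S - {1, n+1} \<subseteq> {2..n}" using S(1) by (auto simp: subset_iff le_Suc_eq)
      ultimately show ?thesis unfolding B_Gamma_def by blast
    next
      case F: False
      then have "S \<subseteq> {1..n}" using S(1) by (auto simp: subset_iff le_Suc_eq)
      moreover have "2 \<le> card S"
        using False card_ge_2_iff_not_singleton S(2) finite_subset[OF S(1)] by blast
      ultimately show ?thesis unfolding B_Gamma_def by blast
    qed
  qed
qed

lemma B_P_eq:
  assumes "2 \<le> n" shows "B_P n = Mas_sets {1..n+1} 1 2 (n+1)"
proof (intro subset_antisym subsetI)
  fix S assume "S \<in> B_P n"
  then show "S \<in> Mas_sets {1..n+1} 1 2 (n+1)"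
    using assms unfolding B_P_def Mas_sets_def by fastforce
next
  fix S assume "S \<in> Mas_sets {1..n+1} 1 2 (n+1)"
  then have S: "S \<subseteq> {1..n+1}" "is_singleton S \<or> 1 \<in> S \<and> (n + 1 \<in> S \<longrightarrow> 2 \<in> S)"
    unfolding Mas_sets_def by auto
  have ge: "S - {1, 2} \<subseteq> {3..n+1}"
  proof
    fix i assume i: "i \<in> S - {1, 2}"
    then have "1 \<le> i" "i \<le> n + 1" "i \<noteq> 1" "i \<noteq> 2" using S(1) by auto
    then show "i \<in> {3..n+1}" by simp
  qed
  show "S \<in> B_P n"
  proof (cases "is_singleton S")
    case True
    then show ?thesis using S(1) unfolding B_P_def by (auto elim!: is_singletonE)
  next
    case False
    then have 1: "1 \<in> S" "n + 1 \<in> S \<longrightarrow> 2 \<in> S" using S(2) by auto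
    show ?thesis
    proof (cases "2 \<in> S")
      case True
      then have "S = {1, 2} \<union> (S - {1, 2})" using 1 by auto
      then show ?thesis using ge unfolding B_P_def by blast
    next
      case F: False
      have "S - {1} \<subseteq> {3..n}"
      proof
        fix i assume i: "i \<in> S - {1}"
        then have "i \<in> {3..n+1}" "i \<noteq> n + 1" using ge F 1 by auto
        then show "i \<in> {3..n}" by simp
      qed
      moreover have "S = {1} \<union> (S - {1})" using 1 by auto
      moreover have "S - {1} \<noteq> {}"
      proof
        assume "S - {1} = {}"
        then have "S = {1}" using 1 by auto
        then show False using False by simp
      qed
      ultimately show ?thesis unfolding B_P_def by blast
    qed
  qed
qed

lemma comb_equiv_translation: "comb_equiv P ((+) c ` P)"
  unfolding comb_equiv_def
proof (intro exI[of _ "image ((+) c)"] conjI allI impI)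
  have "inj ((+) c)" by simp
  show "bij_betw ((`) ((+) c)) {F. F face_of P} {G. G face_of (+) c ` P}"
    unfolding bij_betw_def
  proof
    show "inj_on ((`) ((+) c)) {F. F face_of P}"
      by (auto intro!: inj_onI simp: inj_image_eq_iff)
    show "(`) ((+) c) ` {F. F face_of P} = {G. G face_of (+) c ` P}"
    proof
      show "{G. G face_of (+) c ` P} \<subseteq> (`) ((+) c) ` {F. F face_of P}"
      proof
        fix G assume G: "G \<in> {G. G face_of (+) c ` P}"
        have eq: "G = (+) c ` (+) (- c) ` G" by (simp add: image_image)
        then have "(+) c ` (+) (- c) ` G face_of (+) c ` P" using G by simp
        then have "(+) (- c) ` G face_of P" by (simp only: face_of_translation_eq)
        then show "G \<in> (`) ((+) c) ` {F. F face_of P}" using eq by blast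
      qed
    qed auto
  qed
  show "F \<subseteq> F' \<longleftrightarrow> (+) c ` F \<subseteq> (+) c ` F'" for F F' :: "'a set"
    by (simp add: inj_image_subset_iff)
qed

text \<open>The singletons only translate the segment between the two unit vectors. This serves the
  constant coefficient of the series of \<open>P_Gamma\<close>, which involves the segment.\<close>

lemma nest_type_segment:
  assumes "a \<noteq> b" shows "nest_type {{a}, {b}, {a, b}} = segment_type"
proof -
  let ?e = "\<lambda>i::nat. Poly_Mapping.single i (1::real)"
  let ?f = "\<lambda>t::real. t *\<^sub>R (?e b - ?e a)"
  have ne: "?e b - ?e a \<noteq> 0"
  proof
    assume "?e b - ?e a = 0"
    then have "Poly_Mapping.lookup (?e b - ?e a) b = 0" by simp
    then show False using assms by (simp add: lookup_minus lookup_single when_def)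
  qed
  have f: "linear ?f" by (rule linearI) (simp_all add: algebra_simps)
  have inj: "inj ?f" using ne scaleR_cancel_right by (intro injI) blast
  have "{a} \<noteq> {b}" "{a} \<noteq> {a, b}" "{b} \<noteq> {a, b}" using assms by auto
  then have "nestohedron {{a}, {b}, {a, b}} = {?e a} + ({?e b} + convex hull {?e a, ?e b})"
    unfolding nestohedron_def by simp
  also have "\<dots> = (+) (?e a + ?e b) ` (convex hull {?e a, ?e b})"
    by (force simp: set_plus_def image_iff add.assoc)
  also have "{?e a, ?e b} = (+) (?e a) ` {0, ?e b - ?e a}" by auto
  also have "convex hull \<dots> = (+) (?e a) ` (convex hull {0, ?e b - ?e a})" by (rule convex_hull_translation)
  also have "{0, ?e b - ?e a} = ?f ` {0, 1}" by simp
  also have "convex hull \<dots> = ?f ` (convex hull {0, 1})"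
    by (rule convex_hull_linear_image[OF f, symmetric])
  also have "convex hull {0, 1::real} = {0..1}"
    by (simp add: segment_convex_hull[symmetric] closed_segment_eq_real_ivl)
  finally have "nestohedron {{a}, {b}, {a, b}} = (+) (?e a + ?e b) ` (+) (?e a) ` ?f ` {0..1}" .
  then have "comb_equiv {0..1::real} (nestohedron {{a}, {b}, {a, b}})"
    using comb_equiv_trans[OF comb_equiv_linear_image[OF f inj] comb_equiv_trans[OF comb_equiv_translation comb_equiv_translation]]
    by simp
  then show ?thesis unfolding nest_type_def segment_type_def by (rule type_of_eq[symmetric])
qed

lemma nest_type_all_sets:
  assumes "finite V" "card V = n + 1" shows "nest_type (all_sets V) = Pe n"
proof -
  obtain f where f: "bij_betw f V {1..n+1}"
    using assms finite_same_card_bij[of V "{1..n+1}"] by auto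
  have "V \<noteq> {}" using assms by auto
  then have "nest_type (all_sets V) = nest_type ((`) f ` all_sets V)"
    using nest_type_image[OF connected_all_sets] assms(1) f unfolding bij_betw_def by metis
  also have "\<dots> = nest_type (all_sets {1..n+1})" using f by (simp add: image_all_sets bij_betw_def)
  finally show ?thesis unfolding Pe_def nest_type_def complete_graph_building[OF refl] .
qed

lemma nest_type_star_sets:
  assumes "finite V" "card V = n + 1" "c \<in> V" shows "nest_type (star_sets V c) = St n"
proof -
  obtain f where f: "bij_betw f V {1..n+1}" "map f [c] = [1]"
    using assms ex_bij_betw_map[of V "{1..n+1}" "[c]" "[1]"] by auto
  have inj: "inj_on f V" and img: "f ` V = {1..n+1}" using f(1) unfolding bij_betw_def by auto
  have "nest_type (star_sets V c) = nest_type ((`) f ` star_sets V c)"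
    using nest_type_image[OF connected_star_sets[OF assms(1,3)] inj] by simp
  also have "\<dots> = nest_type (star_sets {1..n+1} 1)"
    using f(2) by (simp add: image_star_sets[OF inj assms(3)] img)
  also have "\<dots> = St n"
    unfolding St_def nest_type_def using star_graph_building[of "{1..n+1}" "n+1"] by simp
  finally show ?thesis .
qed

lemma nest_type_Gamma_sets:
  assumes "finite V" "card V = n + 2" "a \<in> V" "z \<in> V" "a \<noteq> z"
  shows "nest_type (Gamma_sets V a z) = P_Gamma (n + 1)"
proof -
  obtain f where f: "bij_betw f V {1..n+2}" "map f [a, z] = [1, n+2]"
    using assms ex_bij_betw_map[of V "{1..n+2}" "[a, z]" "[1, n+2]"] by auto
  have inj: "inj_on f V" and img: "f ` V = {1..n+2}" using f(1) unfolding bij_betw_def by auto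
  have "nest_type (Gamma_sets V a z) = nest_type ((`) f ` Gamma_sets V a z)"
    using nest_type_image[OF connected_Gamma_sets[OF assms(1,3)] inj] by simp
  also have "\<dots> = nest_type (B_Gamma (n + 1))"
    using f(2) by (simp add: image_Gamma_sets[OF inj assms(3,4)] img B_Gamma_eq)
  also have "\<dots> = P_Gamma (n + 1)"
  proof (cases n)
    case 0
    have "B_Gamma 1 = {{1}, {2}, {1, 2}}"
      unfolding B_Gamma_eq[OF order_refl] Gamma_sets_def
    proof (intro subset_antisym subsetI)
      fix S :: "nat set" assume "S \<in> {S. S \<subseteq> {1..1 + 1} \<and> S \<noteq> {} \<and> (1 + 1 \<in> S \<longrightarrow> 1 \<in> S \<or> S = {1 + 1})}"
      moreover have "{1..1+1} = {1, 2::nat}" by auto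
      ultimately have "S \<subseteq> {1, 2}" "S \<noteq> {}" by auto
      then show "S \<in> {{1}, {2}, {1, 2}}" by blast
    qed auto
    then show ?thesis using 0 nest_type_segment[of 1 2] by (simp add: P_Gamma_def)
  qed (simp add: P_Gamma_def nest_type_def)
  finally show ?thesis .
qed

text \<open>The index is at least 2, so the conventional values of \<open>P_Mas\<close> for the
  point and the segment never enter the series.\<close>

lemma nest_type_Mas_sets:
  assumes "finite V" "card V = n + 3" "a \<in> V" "b \<in> V" "z \<in> V" "a \<noteq> b" "a \<noteq> z" "b \<noteq> z"
  shows "nest_type (Mas_sets V a b z) = P_Mas (n + 2)"
proof -
  obtain f where f: "bij_betw f V {1..n+3}" "map f [a, b, z] = [1, 2, n+3]"
    using assms ex_bij_betw_map[of V "{1..n+3}" "[a, b, z]" "[1, 2, n+3]"] by auto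
  have inj: "inj_on f V" and img: "f ` V = {1..n+3}" using f(1) unfolding bij_betw_def by auto
  have B: "B_P (n + 2) = Mas_sets {1..n+3} 1 2 (n + 3)"
    using B_P_eq[of "n + 2"] by (simp add: numeral_3_eq_3)
  have "nest_type (Mas_sets V a b z) = nest_type ((`) f ` Mas_sets V a b z)"
    using nest_type_image[OF connected_Mas_sets[OF assms(1,3,4)] inj] by simp
  also have "\<dots> = nest_type (B_P (n + 2))"
    unfolding B using f(2) by (simp add: image_Mas_sets[OF inj assms(3,4,5)] img)
  also have "\<dots> = P_Mas (n + 2)" by (simp add: P_Mas_def nest_type_def)
  finally show ?thesis .
qed

section \<open>Facet recurrences\<close>

text \<open>
  The coefficients of the four series, normalised so that the exponential generating functions of
  \<open>pe\<close>, \<open>st\<close>, \<open>ga\<close> are \<open>Pe(q,x)\<close>, \<open>St(q,x)\<close>, \<open>P\<^sub>\<Gamma>(q,x)\<close> and that of \<open>ma\<close> is \<open>P\<^sub>M\<^sub>a\<^sub>s(q,x) / x\<^sup>2\<close>. In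
  particular \<open>pe 0 = 0\<close>, so that empty parts contribute nothing to the recurrences.
\<close>

definition pe :: "nat \<Rightarrow> rat_polytope_ring fps"
  where "pe n = (if n = 0 then 0 else pol_Q (Pe (n - 1)))"

definition st :: "nat \<Rightarrow> rat_polytope_ring fps"
  where "st n = pol_Q (St n)"

definition ga :: "nat \<Rightarrow> rat_polytope_ring fps"
  where "ga n = pol_Q (P_Gamma (n + 1))"

definition ma :: "nat \<Rightarrow> rat_polytope_ring fps"
  where "ma n = pol_Q (P_Mas (n + 2))"

lemma pol_Q_all_sets: "finite V \<Longrightarrow> V \<noteq> {} \<Longrightarrow> pol_Q (nest_type (all_sets V)) = pe (card V)"
  using nest_type_all_sets[of V "card V - 1"] by (simp add: pe_def card_gt_0_iff)

lemma pol_Q_star_sets: "finite V \<Longrightarrow> c \<in> V \<Longrightarrow> card V = n + 1 \<Longrightarrow> pol_Q (nest_type (star_sets V c)) = st n"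
  by (simp add: st_def nest_type_star_sets)

lemma pol_Q_Gamma_sets:
  "finite V \<Longrightarrow> a \<in> V \<Longrightarrow> z \<in> V \<Longrightarrow> a \<noteq> z \<Longrightarrow> card V = n + 2 \<Longrightarrow>
    pol_Q (nest_type (Gamma_sets V a z)) = ga n"
  unfolding ga_def by (subst nest_type_Gamma_sets) auto

lemma pol_Q_Mas_sets:
  "finite V \<Longrightarrow> a \<in> V \<Longrightarrow> b \<in> V \<Longrightarrow> z \<in> V \<Longrightarrow> a \<noteq> b \<Longrightarrow> a \<noteq> z \<Longrightarrow> b \<noteq> z \<Longrightarrow> card V = n + 3 \<Longrightarrow>
    pol_Q (nest_type (Mas_sets V a b z)) = ma n"
  unfolding ma_def by (subst nest_type_Mas_sets) auto

text \<open>Splits off one marked element; repeated use sorts the subsets by the marked elements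
  they contain.\<close>

lemma sum_Pow_insert:
  assumes "finite X" "a \<notin> X"
  shows "(\<Sum>S\<in>Pow (insert a X). g S) = (\<Sum>J\<in>Pow X. g J) + (\<Sum>J\<in>Pow X. g (insert a J))"
proof -
  have inj: "inj_on (insert a) (Pow X)" using assms(2) by (auto intro!: inj_onI)
  have "Pow X \<inter> insert a ` Pow X = {}" using assms(2) by auto
  then show ?thesis
    unfolding Pow_insert using assms(1) by (simp add: sum.union_disjoint sum.reindex[OF inj])
qed

lemma sum_Pow_empty:
  assumes "finite X" shows "(\<Sum>J\<in>Pow X. if J = {} then c else 0) = c"
  using assms by (simp add: sum.delta)

lemma restr_singleton: "{i} \<in> B \<Longrightarrow> {} \<notin> B \<Longrightarrow> restr B {i} = {{i}}"
  by (auto simp: restr_def subset_singleton_iff)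

text \<open>Binomial convolution, the operation on coefficients behind products of exponential
  generating functions. It counts the ways of distributing labelled elements among two
  parts.\<close>

definition conv :: "(nat \<Rightarrow> 'a::comm_semiring_1) \<Rightarrow> (nat \<Rightarrow> 'a) \<Rightarrow> nat \<Rightarrow> 'a"
  where "conv f g n = (\<Sum>k\<le>n. of_nat (n choose k) * (f k * g (n - k)))"

lemma sum_Pow_card:
  assumes "finite X"
  shows "(\<Sum>J\<in>Pow X. h (card J)) = (\<Sum>k\<le>card X. of_nat (card X choose k) * h k)"
proof -
  have "(\<Sum>J\<in>Pow X. h (card J)) = (\<Sum>k\<le>card X. \<Sum>J\<in>{J\<in>Pow X. card J = k}. h (card J))"
    using assms by (intro sum.group[symmetric]) (auto intro: card_mono)
  also have "\<dots> = (\<Sum>k\<le>card X. of_nat (card X choose k) * h k)"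
  proof (intro sum.cong refl)
    fix k
    have "(\<Sum>J\<in>{J\<in>Pow X. card J = k}. h (card J)) = (\<Sum>J\<in>{J\<in>Pow X. card J = k}. h k)"
      by (intro sum.cong) auto
    then show "(\<Sum>J\<in>{J\<in>Pow X. card J = k}. h (card J)) = of_nat (card X choose k) * h k"
      using n_subsets[OF assms, of k] by simp
  qed
  finally show ?thesis .
qed

lemma sum_Pow_conv:
  assumes "finite X" shows "(\<Sum>J\<in>Pow X. f (card J) * g (card (X - J))) = conv f g (card X)"
proof -
  have "(\<Sum>J\<in>Pow X. f (card J) * g (card (X - J))) = (\<Sum>J\<in>Pow X. f (card J) * g (card X - card J))"
    using assms by (intro sum.cong refl) (auto simp: card_Diff_subset finite_subset)
  then show ?thesis unfolding conv_def using sum_Pow_card[OF assms, of "\<lambda>k. f k * g (card X - k)"] by simp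
qed

text \<open>In the second equation this accounts for the contribution of \<open>x\<close> to the
  factor \<open>x + Pe(q,x)\<close>: unmarked elements enter on their own only as
  singletons.\<close>

lemma sum_Pow_singletons:
  assumes "finite X"
  shows "(\<Sum>J\<in>Pow X. if is_singleton J then c else 0) = of_nat (card X) * c"
proof -
  have "(\<Sum>J\<in>Pow X. if is_singleton J then c else 0) = (\<Sum>k\<le>card X. of_nat (card X choose k) * (if k = 1 then c else 0))"
    using sum_Pow_card[OF assms, of "\<lambda>k. if k = 1 then c else 0"] by (simp add: is_singleton_altdef)
  also have "\<dots> = (\<Sum>k\<le>card X. if k = 1 then of_nat (card X) * c else 0)"
    by (intro sum.cong) auto
  also have "\<dots> = of_nat (card X) * c" by (cases "card X") auto
  finally show ?thesis .
qed

text \<open>Extension by zero to the full power set, so that the sum can be split by marked elements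
  without attention to membership in \<open>B\<close>.\<close>

lemma sum_facets_Pow:
  assumes B: "connected_building_set V B"
  shows "(\<Sum>S\<in>B - {V}. g S) = (\<Sum>S\<in>Pow V. if S \<in> B - {V} then g S else 0)"
proof -
  interpret connected_building_set V B by (rule B)
  have "B - {V} = {S\<in>Pow V. S \<in> B - {V}}" using B_subset by auto
  then show ?thesis using finite_V by (simp add: sum.If_cases Int_def)
qed

text \<open>The terms come from the trace of \<open>S\<close> on the marked pair: neither element,
  \<open>a\<close> alone, \<open>z\<close> alone (then \<open>S\<close> is \<open>{z}\<close>), or
  both. The first and the last case together produce the coefficient 2 in the equation.\<close>

lemma fps_deriv_ga: "fps_deriv (ga n) =
  conv pe ga n + conv (\<lambda>k. pe (k + 1)) (\<lambda>k. pe (k + 1)) n + pe (n + 1) + conv ga pe n"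
proof -
  define V where "V = {..<n + 2}"
  define a where "a = n" define z where "z = n + 1" define X where "X = {..<n}"
  have fin: "finite X" "finite V" and V: "V = insert a (insert z X)" and az: "a \<notin> X" "z \<notin> X" "a \<noteq> z"
    and cX: "card X = n"
    by (auto simp: V_def a_def z_def X_def)
  let ?B = "Gamma_sets V a z"
  have B: "connected_building_set V ?B" using fin V by (intro connected_Gamma_sets) auto
  have cV: "card V = n + 2" by (simp add: V_def)
  define \<phi> where "\<phi> S = (if S \<in> ?B - {V} then pol_Q (nest_type (restr ?B S)) * pol_Q (nest_type (contr V ?B S)) else 0)" for S
  have finJ: "finite J" if "J \<subseteq> X" for J using that fin finite_subset by blast
  have 1: "\<phi> J = pe (card J) * ga (card (X - J))" if J: "J \<in> Pow X" for J
  proof (cases "J = {}")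
    \<comment> \<open>The empty set is not in the building set; the convention
      \<open>pe 0 = 0\<close> lets the convolution include it.\<close>
    case True then show ?thesis by (simp add: \<phi>_def Gamma_sets_def pe_def)
  next
    case False
    have aJ: "a \<notin> J" "z \<notin> J" using J az by auto
    have "restr ?B J = all_sets J" using J aJ V by (auto simp: restr_def all_sets_def Gamma_sets_def)
    moreover have "contr V ?B J = Gamma_sets (V - J) a z"
      using False aJ J V by (auto simp: contr_def Gamma_sets_def)
    moreover have "V - J = insert a (insert z (X - J))" using aJ V by auto
    moreover have "J \<in> ?B - {V}" using J False aJ V by (auto simp: Gamma_sets_def)
    ultimately show ?thesis
      using J False fin az finJ by (simp add: \<phi>_def pol_Q_all_sets pol_Q_Gamma_sets)
  qed
  have 2: "\<phi> (insert a J) = pe (card J + 1) * pe (card (X - J) + 1)" if J: "J \<in> Pow X" for J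
  proof -
    have aJ: "a \<notin> J" "z \<notin> J" using J az by auto
    have "restr ?B (insert a J) = all_sets (insert a J)"
      using J aJ az V by (auto simp: restr_def all_sets_def Gamma_sets_def)
    moreover have "contr V ?B (insert a J) = all_sets (V - insert a J)"
      using J V by (auto simp: contr_def all_sets_def Gamma_sets_def)
    moreover have "V - insert a J = insert z (X - J)" using aJ az V by auto
    moreover have "insert a J \<in> ?B - {V}" using J aJ az V by (auto simp: Gamma_sets_def)
    ultimately show ?thesis
      using J fin az aJ finJ by (simp add: \<phi>_def pol_Q_all_sets)
  qed
  have 3: "\<phi> (insert z J) = (if J = {} then pe (n + 1) else 0)" if J: "J \<in> Pow X" for J
  proof (cases "J = {}")
    case True
    have "restr ?B {z} = {{z}}" using V by (intro restr_singleton) (auto simp: Gamma_sets_def)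
    moreover have "contr V ?B {z} = all_sets (V - {z})"
      by (auto simp: contr_def all_sets_def Gamma_sets_def)
    moreover have "V - {z} = insert a X" using az V by auto
    moreover have "{z} \<in> ?B - {V}" using az V by (auto simp: Gamma_sets_def)
    ultimately show ?thesis
      using True fin az cX by (simp add: \<phi>_def pol_Q_all_sets pol_Q_nest_type_singleton)
  next
    case False
    then have "insert z J \<notin> ?B" using J az by (auto simp: Gamma_sets_def)
    then show ?thesis using False by (simp add: \<phi>_def)
  qed
  have 4: "\<phi> (insert a (insert z J)) = ga (card J) * pe (card (X - J))" if J: "J \<in> Pow X" for J
  proof (cases "J = X")
    \<comment> \<open>Here \<open>S\<close> is all of \<open>V\<close>, which gives no facet; again
      \<open>pe 0 = 0\<close> absorbs this on the right.\<close>
    case True then show ?thesis using V by (simp add: \<phi>_def pe_def)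
  next
    case False
    have aJ: "a \<notin> J" "z \<notin> J" using J az by auto
    let ?S = "insert a (insert z J)"
    have "restr ?B ?S = Gamma_sets ?S a z"
      using J V by (auto simp: restr_def Gamma_sets_def)
    moreover have "contr V ?B ?S = all_sets (V - ?S)"
      using J V by (auto simp: contr_def all_sets_def Gamma_sets_def)
    moreover have "V - ?S = X - J" using az V by auto
    moreover have "X - J \<noteq> {}" using False J by auto
    moreover have "?S \<in> ?B - {V}"
    proof -
      have "?S \<noteq> V" using \<open>V - ?S = X - J\<close> \<open>X - J \<noteq> {}\<close> by auto
      then show ?thesis using J V by (auto simp: Gamma_sets_def)
    qed
    ultimately show ?thesis
      using J fin az aJ finJ by (simp add: \<phi>_def pol_Q_all_sets pol_Q_Gamma_sets)
  qed
  have "fps_deriv (ga n) = (\<Sum>S\<in>Pow V. \<phi> S)"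
    using fps_deriv_pol_Q[OF B] pol_Q_Gamma_sets[of V a z n] fin V az cV
    unfolding \<phi>_def sum_facets_Pow[OF B] by simp
  also have "\<dots> = (\<Sum>J\<in>Pow X. \<phi> J) + (\<Sum>J\<in>Pow X. \<phi> (insert z J)) +
      ((\<Sum>J\<in>Pow X. \<phi> (insert a J)) + (\<Sum>J\<in>Pow X. \<phi> (insert a (insert z J))))"
    unfolding V using fin az by (simp only: sum_Pow_insert finite_insert insert_iff simp_thms)
  also have "\<dots> = conv pe ga n + pe (n + 1) +
      (conv (\<lambda>k. pe (k + 1)) (\<lambda>k. pe (k + 1)) n + conv ga pe n)"
    using sum_Pow_conv[OF fin(1), of pe ga] sum_Pow_conv[OF fin(1), of ga pe]
      sum_Pow_conv[OF fin(1), of "\<lambda>k. pe (k + 1)" "\<lambda>k. pe (k + 1)"] sum_Pow_empty[OF fin(1), of "pe (n + 1)"]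
    unfolding cX by (simp only: 1 2 3 4 cong: sum.cong)
  finally show ?thesis by (simp add: algebra_simps)
qed

text \<open>Without \<open>a\<close> only singletons occur, namely those of \<open>X\<close>,
  \<open>{b}\<close> and \<open>{z}\<close>. With \<open>a\<close>, the marked part can be
  \<open>a\<close>, \<open>a\<close> and \<open>b\<close>, or all three elements, while
  \<open>z\<close> without \<open>b\<close> is excluded.\<close>

lemma fps_deriv_ma: "fps_deriv (ma n) =
  of_nat n * ma (n - 1) + conv st ga n + 2 * st (n + 1)
    + conv (\<lambda>k. st (k + 1)) (\<lambda>k. pe (k + 1)) n + conv ma pe n"
proof -
  define V where "V = {..<n + 3}"
  define a where "a = n" define b where "b = n + 1" define z where "z = n + 2" define X where "X = {..<n}"
  have fin: "finite X" "finite V" and V: "V = insert a (insert b (insert z X))"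
    and abz: "a \<notin> X" "b \<notin> X" "z \<notin> X" "a \<noteq> b" "a \<noteq> z" "b \<noteq> z" "b \<noteq> a" "z \<noteq> a" "z \<noteq> b" and cX: "card X = n"
    by (auto simp: V_def a_def b_def z_def X_def)
  let ?B = "Mas_sets V a b z"
  have B: "connected_building_set V ?B" using fin V by (intro connected_Mas_sets) auto
  have cV: "card V = n + 3" by (simp add: V_def)
  define \<phi> where "\<phi> S = (if S \<in> ?B - {V} then pol_Q (nest_type (restr ?B S)) * pol_Q (nest_type (contr V ?B S)) else 0)" for S
  have finJ: "finite J" if "J \<subseteq> X" for J using that fin finite_subset by blast
  have rs: "restr ?B {i} = {{i}}" and sV: "{i} \<in> ?B - {V}" if "i \<in> V" for i
    using that V abz by (auto simp: Mas_sets_def intro!: restr_singleton)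
  have ns: "is_singleton (insert x S) \<longleftrightarrow> S \<subseteq> {x}" for x S
    by (auto simp: is_singleton_def)
  \<comment> \<open>Contracting an unmarked point leaves the same kind of building set on one
    element less. For \<open>n = 0\<close> there is no such point, so the truncated
    \<open>n - 1\<close> is harmless.\<close>
  have 1: "\<phi> J = (if is_singleton J then ma (n - 1) else 0)" if J: "J \<in> Pow X" for J
  proof (cases "is_singleton J")
    case True
    then obtain i where i: "J = {i}" by (rule is_singletonE)
    then have iX: "i \<in> X" using J by simp
    then have iV: "i \<in> V" "i \<noteq> a" "i \<noteq> b" "i \<noteq> z" using V abz by auto
    have "T \<in> contr V ?B {i} \<longleftrightarrow> T \<in> Mas_sets (V - {i}) a b z" for T
    proof -
      have "is_singleton (insert i T) \<Longrightarrow> i \<notin> T \<Longrightarrow> T = {}" unfolding ns by auto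
      then show ?thesis using iV by (auto simp: contr_def Mas_sets_def)
    qed
    then have "contr V ?B {i} = Mas_sets (V - {i}) a b z" by blast
    moreover have "card (V - {i}) = (n - 1) + 3"
      using iV cV fin iX cX by (cases n) (auto simp: card_Diff_singleton)
    ultimately show ?thesis
      using i rs[OF iV(1)] sV[OF iV(1)] iV V fin abz
      by (simp add: \<phi>_def pol_Q_nest_type_singleton pol_Q_Mas_sets)
  next
    case False
    then have "J \<notin> ?B" using J abz by (auto simp: Mas_sets_def)
    then show ?thesis using False by (simp add: \<phi>_def)
  qed
  \<comment> \<open>Restriction excludes \<open>z\<close> and leaves a star around \<open>a\<close>.
    After contracting \<open>a\<close>, the one remaining condition ties \<open>z\<close> to
    \<open>b\<close>, with \<open>{z}\<close> itself still allowed: this is the pattern of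
    \<open>Gamma_sets\<close>.\<close>
  have 2: "\<phi> (insert a J) = st (card J) * ga (card (X - J))" if J: "J \<in> Pow X" for J
  proof -
    have aJ: "a \<notin> J" "b \<notin> J" "z \<notin> J" using J abz by auto
    let ?S = "insert a J"
    have "restr ?B ?S = star_sets ?S a"
      using J aJ abz V by (auto simp: restr_def star_sets_def Mas_sets_def)
    moreover have "contr V ?B ?S = Gamma_sets (V - ?S) b z"
    proof -
      have "T \<in> contr V ?B ?S \<longleftrightarrow> T \<in> Gamma_sets (V - ?S) b z" if "T \<subseteq> V - ?S" for T
        using that J aJ V abz
        by (cases "is_singleton T") (auto simp: contr_def Mas_sets_def Gamma_sets_def ns elim!: is_singletonE)
      moreover have "T \<subseteq> V - ?S" if "T \<in> contr V ?B ?S \<or> T \<in> Gamma_sets (V - ?S) b z" for T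
        using that by (auto simp: contr_def Gamma_sets_def)
      ultimately show ?thesis by blast
    qed
    moreover have "V - ?S = insert b (insert z (X - J))" using aJ abz V by auto
    moreover have "?S \<in> ?B - {V}" using J aJ abz V by (auto simp: Mas_sets_def)
    ultimately show ?thesis
      using J fin abz aJ finJ by (simp add: \<phi>_def pol_Q_star_sets pol_Q_Gamma_sets)
  qed
  \<comment> \<open>Contracting \<open>b\<close> frees \<open>z\<close> from its condition; only the
    requirement to contain \<open>a\<close> or be a singleton remains.\<close>
  have 3: "\<phi> (insert b J) = (if J = {} then st (n + 1) else 0)" if J: "J \<in> Pow X" for J
  proof (cases "J = {}")
    case True
    have "contr V ?B {b} = star_sets (V - {b}) a"
    proof -
      have "T \<in> contr V ?B {b} \<longleftrightarrow> T \<in> star_sets (V - {b}) a" if "T \<subseteq> V - {b}" for T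
        using that V abz by (auto simp: contr_def Mas_sets_def star_sets_def ns)
      moreover have "T \<subseteq> V - {b}" if "T \<in> contr V ?B {b} \<or> T \<in> star_sets (V - {b}) a" for T
        using that by (auto simp: contr_def star_sets_def)
      ultimately show ?thesis by blast
    qed
    moreover have "V - {b} = insert a (insert z X)" using abz V by auto
    ultimately show ?thesis
      using True fin abz cX V rs[of b] sV[of b]
      by (simp add: \<phi>_def pol_Q_star_sets pol_Q_nest_type_singleton)
  next
    case False
    then have "insert b J \<notin> ?B" using J abz by (auto simp: Mas_sets_def ns)
    then show ?thesis using False by (simp add: \<phi>_def)
  qed
  \<comment> \<open>Removing \<open>z\<close> makes its condition void, so a star around
    \<open>a\<close> arises once more. Together with the previous case this explains the coefficient
    2 at the derivative of \<open>St\<close>.\<close>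
  have 4: "\<phi> (insert z J) = (if J = {} then st (n + 1) else 0)" if J: "J \<in> Pow X" for J
  proof (cases "J = {}")
    case True
    have "contr V ?B {z} = star_sets (V - {z}) a"
    proof -
      have "T \<in> contr V ?B {z} \<longleftrightarrow> T \<in> star_sets (V - {z}) a" if "T \<subseteq> V - {z}" for T
        using that V abz by (auto simp: contr_def Mas_sets_def star_sets_def ns)
      moreover have "T \<subseteq> V - {z}" if "T \<in> contr V ?B {z} \<or> T \<in> star_sets (V - {z}) a" for T
        using that by (auto simp: contr_def star_sets_def)
      ultimately show ?thesis by blast
    qed
    moreover have "V - {z} = insert a (insert b X)" using abz V by auto
    ultimately show ?thesis
      using True fin abz cX V rs[of z] sV[of z]
      by (simp add: \<phi>_def pol_Q_star_sets pol_Q_nest_type_singleton)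
  next
    case False
    then have "insert z J \<notin> ?B" using J abz by (auto simp: Mas_sets_def ns)
    then show ?thesis using False by (simp add: \<phi>_def)
  qed
  have 5: "\<phi> (insert a (insert b J)) = st (card J + 1) * pe (card (X - J) + 1)" if J: "J \<in> Pow X" for J
  proof -
    have aJ: "a \<notin> J" "b \<notin> J" "z \<notin> J" using J abz by auto
    let ?S = "insert a (insert b J)"
    have "restr ?B ?S = star_sets ?S a"
      using J aJ abz V by (auto simp: restr_def star_sets_def Mas_sets_def)
    moreover have "contr V ?B ?S = all_sets (V - ?S)"
      using J V by (auto simp: contr_def all_sets_def Mas_sets_def)
    moreover have "V - ?S = insert z (X - J)" using aJ abz V by auto
    moreover have "?S \<in> ?B - {V}" using J aJ abz V by (auto simp: Mas_sets_def)
    ultimately show ?thesis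
      using J fin abz aJ finJ by (simp add: \<phi>_def pol_Q_star_sets pol_Q_all_sets)
  qed
  have 6: "\<phi> (insert a (insert z J)) = 0" "\<phi> (insert b (insert z J)) = 0" if J: "J \<in> Pow X" for J
    using J abz by (auto simp: \<phi>_def Mas_sets_def ns)
  have 7: "\<phi> (insert a (insert b (insert z J))) = ma (card J) * pe (card (X - J))" if J: "J \<in> Pow X" for J
  proof (cases "J = X")
    \<comment> \<open>This is \<open>S = V\<close>, excluded as a facet and matched by
      \<open>pe 0 = 0\<close>.\<close>
    case True then show ?thesis using V by (simp add: \<phi>_def pe_def)
  next
    case False
    have aJ: "a \<notin> J" "b \<notin> J" "z \<notin> J" using J abz by auto
    let ?S = "insert a (insert b (insert z J))"
    have "restr ?B ?S = Mas_sets ?S a b z"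
      using J V by (auto simp: restr_def Mas_sets_def)
    moreover have "contr V ?B ?S = all_sets (V - ?S)"
      using J V by (auto simp: contr_def all_sets_def Mas_sets_def)
    moreover have "V - ?S = X - J" using abz V by auto
    moreover have "X - J \<noteq> {}" using False J by auto
    moreover have "?S \<in> ?B - {V}"
    proof -
      have "?S \<noteq> V" using \<open>V - ?S = X - J\<close> \<open>X - J \<noteq> {}\<close> by auto
      then show ?thesis using J V by (auto simp: Mas_sets_def)
    qed
    ultimately show ?thesis
      using J fin abz aJ finJ by (simp add: \<phi>_def pol_Q_all_sets pol_Q_Mas_sets)
  qed
  have "fps_deriv (ma n) = (\<Sum>S\<in>Pow V. \<phi> S)"
    using fps_deriv_pol_Q[OF B] pol_Q_Mas_sets[of V a b z n] fin V abz cV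
    unfolding \<phi>_def sum_facets_Pow[OF B] by simp
  also have "\<dots> = (\<Sum>J\<in>Pow X. \<phi> J) + (\<Sum>J\<in>Pow X. \<phi> (insert z J)) +
      ((\<Sum>J\<in>Pow X. \<phi> (insert b J)) + (\<Sum>J\<in>Pow X. \<phi> (insert b (insert z J)))) +
      ((\<Sum>J\<in>Pow X. \<phi> (insert a J)) + (\<Sum>J\<in>Pow X. \<phi> (insert a (insert z J))) +
      ((\<Sum>J\<in>Pow X. \<phi> (insert a (insert b J))) + (\<Sum>J\<in>Pow X. \<phi> (insert a (insert b (insert z J))))))"
    unfolding V using fin abz by (simp only: sum_Pow_insert finite_insert insert_iff simp_thms)
  also have "\<dots> = of_nat n * ma (n - 1) + st (n + 1) + (st (n + 1) + 0) +
      (conv st ga n + 0 + (conv (\<lambda>k. st (k + 1)) (\<lambda>k. pe (k + 1)) n + conv ma pe n))"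
    using sum_Pow_conv[OF fin(1), of st ga] sum_Pow_conv[OF fin(1), of ma pe]
      sum_Pow_conv[OF fin(1), of "\<lambda>k. st (k + 1)" "\<lambda>k. pe (k + 1)"] sum_Pow_empty[OF fin(1), of "st (n + 1)"]
      sum_Pow_singletons[OF fin(1), of "ma (n - 1)"]
    unfolding cX by (simp only: 1 2 3 4 5 6 7 sum.neutral_const cong: sum.cong)
  finally show ?thesis by (simp add: algebra_simps)
qed

section \<open>Exponential generating functions\<close>

definition egf :: "(nat \<Rightarrow> rat_polytope_ring fps) \<Rightarrow> rat_polytope_ring fps fps"
  where "egf a = Abs_fps (\<lambda>n. fps_const (rat_scalar (1 / fact n)) * a n)"

lemma egf_nth: "fps_nth (egf a) n = fps_const (rat_scalar (1 / fact n)) * a n"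
  by (simp add: egf_def)

lemma egf_add: "egf a + egf b = egf (\<lambda>n. a n + b n)"
  by (rule fps_ext) (simp add: egf_nth distrib_left)

lemma egf_mult: "egf a * egf b = egf (conv a b)"
proof (rule fps_ext)
  fix n
  let ?\<kappa> = "\<lambda>k. fps_const (rat_scalar (1 / fact k))"
  have "fps_nth (egf a * egf b) n = (\<Sum>k\<le>n. (?\<kappa> k * a k) * (?\<kappa> (n - k) * b (n - k)))"
    by (simp add: fps_mult_nth egf_nth atLeast0AtMost)
  also have "\<dots> = (\<Sum>k\<le>n. ?\<kappa> n * (of_nat (n choose k) * (a k * b (n - k))))"
  proof (intro sum.cong refl)
    fix k assume "k \<in> {..n}"
    then have "(1 / fact k) * (1 / fact (n - k)) = (1 / fact n) * (of_nat (n choose k) :: rat)"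
      using binomial_fact[of k n, where ?'a = rat] by simp
    then have "?\<kappa> k * ?\<kappa> (n - k) = ?\<kappa> n * of_nat (n choose k)"
      unfolding fps_of_nat[symmetric] fps_const_mult rat_scalar_of_nat[symmetric] rat_scalar_mult by simp
    then have "?\<kappa> k * ?\<kappa> (n - k) * (a k * b (n - k)) = ?\<kappa> n * of_nat (n choose k) * (a k * b (n - k))"
      by simp
    then show "(?\<kappa> k * a k) * (?\<kappa> (n - k) * b (n - k)) = ?\<kappa> n * (of_nat (n choose k) * (a k * b (n - k)))"
      by (simp only: mult_ac)
  qed
  also have "\<dots> = fps_nth (egf (conv a b)) n" by (simp add: egf_nth conv_def sum_distrib_left)
  finally show "fps_nth (egf a * egf b) n = fps_nth (egf (conv a b)) n" .
qed

lemma rat_scalar_fact_Suc: "of_nat (n + 1) * rat_scalar (1 / fact (n + 1)) = rat_scalar (1 / fact n)"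
  unfolding rat_scalar_of_nat[symmetric] rat_scalar_mult by (simp add: field_simps del: of_nat_Suc)

lemma deriv_x_egf: "deriv_x (egf a) = egf (\<lambda>n. a (n + 1))"
proof (rule fps_ext)
  fix n
  have "of_nat (n + 1) * fps_const (rat_scalar (1 / fact (n + 1))) = fps_const (rat_scalar (1 / fact n))"
    unfolding fps_of_nat[symmetric] fps_const_mult rat_scalar_fact_Suc ..
  then show "fps_nth (deriv_x (egf a)) n = fps_nth (egf (\<lambda>n. a (n + 1))) n"
    unfolding deriv_x_def fps_deriv_nth egf_nth by (simp only: mult.assoc[symmetric])
qed

text \<open>At \<open>n = 0\<close> the factor \<open>of_nat n\<close> vanishes, so the truncated
  subtraction does not matter.\<close>

lemma fps_X_egf: "fps_X * egf a = egf (\<lambda>n. of_nat n * a (n - 1))"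
proof (rule fps_ext)
  fix n
  show "fps_nth (fps_X * egf a) n = fps_nth (egf (\<lambda>n. of_nat n * a (n - 1))) n"
  proof (cases n)
    case (Suc m)
    have "of_nat (m + 1) * fps_const (rat_scalar (1 / fact (m + 1))) = fps_const (rat_scalar (1 / fact m))"
      unfolding fps_of_nat[symmetric] fps_const_mult rat_scalar_fact_Suc ..
    then show ?thesis using Suc by (simp add: egf_nth) (metis mult.assoc mult.commute)
  qed (simp add: egf_nth)
qed

lemma deriv_q_egf: "deriv_q (egf a) = egf (\<lambda>n. fps_deriv (a n))"
  by (rule fps_ext) (simp add: deriv_q_def egf_nth)

lemma deriv_q_fps_X_power_mult: "deriv_q (fps_X ^ k * F) = fps_X ^ k * deriv_q F"
  by (rule fps_ext) (simp add: deriv_q_def fps_X_power_mult_nth)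

section \<open>The four series in exponential form\<close>

lemma Pe_series2_egf: "Pe_series2 = egf pe"
proof (rule fps_ext)
  show "fps_nth Pe_series2 n = fps_nth (egf pe) n" for n
    by (cases n) (simp_all add: Pe_series2_def gen_series2_def egf_nth pe_def)
qed

lemma St_series2_egf: "St_series2 = egf st"
  by (rule fps_ext) (simp add: St_series2_def gen_series2_def egf_nth st_def)

lemma P_Gamma_series2_egf: "P_Gamma_series2 = egf ga"
  by (rule fps_ext) (simp add: P_Gamma_series2_def gen_series2_def egf_nth ga_def)

text \<open>The exponent \<open>s + 2\<close> is paired with the factorial of \<open>s\<close>, so
  two powers of \<open>x\<close> must be taken out; being free of \<open>q\<close>, they pass
  through the derivative.\<close>

lemma P_Mas_series2_egf: "P_Mas_series2 = fps_X ^ 2 * egf ma"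
  by (rule fps_ext) (simp add: P_Mas_series2_def gen_series2_def egf_nth ma_def fps_X_power_mult_nth)

text \<open>The constant term of \<open>pol_Q\<close> in \<open>q\<close> is the polytope itself,
  which settles both initial conditions at once.\<close>

lemma at_q0_gen_series2: "at_q0 (gen_series2 e c T) = gen_series e c T"
  by (rule fps_ext) (simp add: at_q0_def gen_series2_def gen_series_def pol_Q_nth_0)

theorem theorem4p9:
  shows
    "(deriv_q P_Gamma_series2 =
        2 * Pe_series2 * P_Gamma_series2 + deriv_x Pe_series2 * (1 + deriv_x Pe_series2)
      \<and> at_q0 P_Gamma_series2 = P_Gamma_series)
     \<and>
     (deriv_q P_Mas_series2 =
        (fps_X + Pe_series2) * P_Mas_series2
        + fps_X ^ 2 * (2 * deriv_x St_series2 + St_series2 * P_Gamma_series2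
                       + deriv_x St_series2 * deriv_x Pe_series2)
      \<and> at_q0 P_Mas_series2 = P_Mas_series)"
proof (intro conjI)
  let ?pe' = "\<lambda>n. pe (n + 1)" and ?st' = "\<lambda>n. st (n + 1)"
  have "deriv_q P_Gamma_series2 = egf pe * egf ga + egf ?pe' * egf ?pe' + egf ?pe' + egf ga * egf pe"
    unfolding P_Gamma_series2_egf deriv_q_egf fps_deriv_ga egf_mult egf_add ..
  also have "\<dots> = 2 * egf pe * egf ga + egf ?pe' * (1 + egf ?pe')"
    by (simp add: algebra_simps)
  finally show "deriv_q P_Gamma_series2 =
      2 * Pe_series2 * P_Gamma_series2 + deriv_x Pe_series2 * (1 + deriv_x Pe_series2)"
    unfolding Pe_series2_egf P_Gamma_series2_egf deriv_x_egf .
  have "deriv_q (egf ma) = fps_X * egf ma + egf st * egf ga + (egf ?st' + egf ?st')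
      + egf ?st' * egf ?pe' + egf ma * egf pe"
    unfolding deriv_q_egf fps_deriv_ma egf_mult fps_X_egf egf_add mult_2 ..
  then have "deriv_q P_Mas_series2 = fps_X ^ 2 * (fps_X * egf ma + egf st * egf ga + (egf ?st' + egf ?st')
      + egf ?st' * egf ?pe' + egf ma * egf pe)"
    unfolding P_Mas_series2_egf deriv_q_fps_X_power_mult by simp
  also have "\<dots> = (fps_X + egf pe) * (fps_X ^ 2 * egf ma)
      + fps_X ^ 2 * (2 * egf ?st' + egf st * egf ga + egf ?st' * egf ?pe')"
    by (simp only: mult_2) (simp add: algebra_simps)
  finally show "deriv_q P_Mas_series2 = (fps_X + Pe_series2) * P_Mas_series2
      + fps_X ^ 2 * (2 * deriv_x St_series2 + St_series2 * P_Gamma_series2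
                     + deriv_x St_series2 * deriv_x Pe_series2)"
    unfolding Pe_series2_egf P_Gamma_series2_egf P_Mas_series2_egf St_series2_egf deriv_x_egf .
qed (simp_all add: P_Gamma_series2_def P_Gamma_series_def P_Mas_series2_def P_Mas_series_def
  at_q0_gen_series2)

end
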